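(* Let $(M^3,g)$ be the Anderson manifold (defined in the context). Then the real vector space of harmonic vector fields on $M$ that belong to $W^{1,2}(TM)\cap W^{1,4}(TM)$ is infinite-dimensional.
   Context: The Anderson manifold $(M^3,g)$. Let $H=\{z=x+iy\in\mathbb{C}: x^2+y^2<1,\ x>0\}$, equipped with the hyperbolic metric of sectional curvature $-a^2$, $ds_a^2=\dfrac{4(dx^2+dy^2)}{a^2(1-|z|^2)^2}$, where $a=2$ (so $ds_2^2=\dfrac{dx^2+dy^2}{(1-|z|^2)^2}$). Let $L$ be the line segment from $(0,-1)$ to $(0,1)$ and let $\rho_a(z)=\frac1a\,\mathrm{arcsinh}\!\left(\frac{2x}{1-|z|^2}\right)$ be the $ds_a^2$-distance from $z\in H$ to $L$. Put $f(z)=\sinh(\rho_a(z))$. The warped product $H\times_f S^1$, with metric $$g=\frac{4(dx^2+dy^2)}{a^2(1-|z|^2)^2}+f^2\,d\theta^2$$ ($\theta$ the standard angular coordinate on $S^1$, of period $2\pi$), extends smoothly across $L$, where $f=0$ and the circle factor collapses to a point. The resulting complete Riemannian three-manifold, diffeomorphic to $\mathbb{R}^3$, is $(M^3,g)$; up to a set of measure zero it equals $H\times_f S^1$. Vector fields and $1$-forms are identified via $g$. A vector field is harmonic if its dual $1$-form $\omega$ satisfies $\Delta_H\omega=0$, where $\Delta_H=dd^*+d^*d$ is the Hodge Laplacian of $(M,g)$. $W^{1,p}(TM)$ denotes the $L^p$-based Sobolev space of sections $X$ of $TM$ with $X\in L^p$ and $\nabla X\in L^p$, where $\nabla$ is the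 Levi-Civita connection and norms and volume are those of $g$. *)

theory Defs
  imports "HOL-Analysis.Analysis" "HOL-Library.Function_Algebras"
begin

section \<open>Smooth functions on open subsets of Euclidean space\<close>

definition partial :: "'n::finite \<Rightarrow> (real^'n \<Rightarrow> real) \<Rightarrow> real^'n \<Rightarrow> real" where
  "partial i f p = deriv (\<lambda>t. f (p + t *\<^sub>R axis i 1)) 0"

fun Ck_on :: "nat \<Rightarrow> (real^'n::finite) set \<Rightarrow> (real^'n \<Rightarrow> real) \<Rightarrow> bool" where
  "Ck_on 0 U f \<longleftrightarrow> continuous_on U f"
| "Ck_on (Suc k) U f \<longleftrightarrow> f differentiable_on U \<and> (\<forall>i. Ck_on k U (partial i f))"

text \<open>Only meaningful for open \<open>U\<close>, as \<^const>\<open>partial\<close> takes two-sided derivatives.\<close>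

definition smooth_on :: "(real^'n::finite) set \<Rightarrow> (real^'n \<Rightarrow> real) \<Rightarrow> bool" where
  "smooth_on U f \<longleftrightarrow> (\<forall>k. Ck_on k U f)"

definition test_function_on :: "(real^'n::finite) set \<Rightarrow> (real^'n \<Rightarrow> real) \<Rightarrow> bool" where
  "test_function_on U \<phi> \<longleftrightarrow>
     smooth_on UNIV \<phi> \<and> compact (closure {p. \<phi> p \<noteq> 0}) \<and> closure {p. \<phi> p \<noteq> 0} \<subseteq> U"

definition locally_integrable_on ::
  "(real^'n::finite) set \<Rightarrow> (real^'n \<Rightarrow> 'b::euclidean_space) \<Rightarrow> bool" where
  "locally_integrable_on U F \<longleftrightarrow>
     (\<forall>K. compact K \<and> K \<subseteq> U \<longrightarrow> integrable (lebesgue_on K) F)"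

section \<open>Riemannian geometry in a global chart\<close>

text \<open>A Riemannian metric on an open set \<open>U\<close> of \<open>real^'n\<close> is given by its Gram matrix
  \<open>G p $ i $ j\<close> in the coordinate frame. Vector fields and 1-forms are given by
  their components; a 2-form \<open>\<eta>\<close> by its antisymmetric matrix of components, so that
  \<open>\<eta> = (\<Sum>i<j. \<eta> $ i $ j dx\<^sub>i \<and> dx\<^sub>j)\<close>.\<close>

type_synonym 'n metric_field = "real^'n \<Rightarrow> real^'n^'n"
type_synonym 'n vec_field = "real^'n \<Rightarrow> real^'n"

definition vol_density :: "'n::finite metric_field \<Rightarrow> real^'n \<Rightarrow> real" where
  "vol_density G p = sqrt (det (G p))"

definition vol_measure :: "'n::finite metric_field \<Rightarrow> (real^'n) set \<Rightarrow> (real^'n) measure" where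
  "vol_measure G U = density (lebesgue_on U) (\<lambda>p. ennreal (vol_density G p))"

definition flat :: "'n::finite metric_field \<Rightarrow> 'n vec_field \<Rightarrow> 'n vec_field" where
  "flat G X p = G p *v X p"

subsection \<open>Levi-Civita connection\<close>

text \<open>\<open>christoffel G k i j\<close> has \<open>k\<close> as its upper index.\<close>

definition christoffel ::
  "'n::finite metric_field \<Rightarrow> 'n \<Rightarrow> 'n \<Rightarrow> 'n \<Rightarrow> real^'n \<Rightarrow> real" where
  "christoffel G k i j p =
     (\<Sum>l\<in>UNIV. matrix_inv (G p) $ k $ l *
        (partial i (\<lambda>q. G q $ j $ l) p + partial j (\<lambda>q. G q $ i $ l) p
          - partial l (\<lambda>q. G q $ i $ j) p)) / 2"

text \<open>\<open>T\<close> is the distributional covariant derivative of \<open>X\<close>, with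
  \<open>T p $ i $ k\<close> the \<open>k\<close>-th component of \<open>\<nabla>\<^sub>i X\<close>: the components
  \<open>\<nabla>\<^sub>i X\<^sup>k = \<partial>\<^sub>i X\<^sup>k + \<Gamma>\<^sup>k\<^sub>i\<^sub>j X\<^sup>j\<close> are tested against
  coordinate test functions, so that only \<open>\<partial>\<^sub>i X\<^sup>k\<close> is integrated by parts.\<close>

definition has_weak_cov_deriv ::
  "'n::finite metric_field \<Rightarrow> (real^'n) set \<Rightarrow> 'n vec_field \<Rightarrow> (real^'n \<Rightarrow> real^'n^'n) \<Rightarrow> bool"
  where
  "has_weak_cov_deriv G U X T \<longleftrightarrow>
     locally_integrable_on U X \<and> locally_integrable_on U T \<and>
     (\<forall>\<phi> i k. test_function_on U \<phi> \<longrightarrow>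
        (\<integral>p. X p $ k * partial i \<phi> p \<partial>(lebesgue_on U)) =
        - (\<integral>p. (T p $ i $ k - (\<Sum>j\<in>UNIV. christoffel G k i j p * X p $ j)) * \<phi> p
            \<partial>(lebesgue_on U)))"

subsection \<open>Sobolev spaces of vector fields\<close>

definition vec_norm :: "'n::finite metric_field \<Rightarrow> 'n vec_field \<Rightarrow> real^'n \<Rightarrow> real" where
  "vec_norm G X p = sqrt (X p \<bullet> (G p *v X p))"

definition endo_norm ::
  "'n::finite metric_field \<Rightarrow> (real^'n \<Rightarrow> real^'n^'n) \<Rightarrow> real^'n \<Rightarrow> real" where
  "endo_norm G T p =
     sqrt (\<Sum>i\<in>UNIV. \<Sum>j\<in>UNIV. matrix_inv (G p) $ i $ j * (T p $ i \<bullet> (G p *v T p $ j)))"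

definition Lp_vec ::
  "'n::finite metric_field \<Rightarrow> (real^'n) set \<Rightarrow> real \<Rightarrow> 'n vec_field \<Rightarrow> bool" where
  "Lp_vec G U q X \<longleftrightarrow> X \<in> borel_measurable (lebesgue_on U) \<and>
     integrable (vol_measure G U) (\<lambda>p. vec_norm G X p powr q)"

definition Lp_endo ::
  "'n::finite metric_field \<Rightarrow> (real^'n) set \<Rightarrow> real \<Rightarrow> (real^'n \<Rightarrow> real^'n^'n) \<Rightarrow> bool" where
  "Lp_endo G U q T \<longleftrightarrow> T \<in> borel_measurable (lebesgue_on U) \<and>
     integrable (vol_measure G U) (\<lambda>p. endo_norm G T p powr q)"

definition sobolev_W1 ::
  "'n::finite metric_field \<Rightarrow> (real^'n) set \<Rightarrow> real \<Rightarrow> 'n vec_field set" where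
  "sobolev_W1 G U q =
     {X. Lp_vec G U q X \<and> (\<exists>T. has_weak_cov_deriv G U X T \<and> Lp_endo G U q T)}"

subsection \<open>Hodge Laplacian on 1-forms\<close>

definition ext_d0 :: "(real^'n::finite \<Rightarrow> real) \<Rightarrow> 'n vec_field" where
  "ext_d0 f p = (\<chi> i. partial i f p)"

definition ext_d1 :: "'n::finite vec_field \<Rightarrow> real^'n \<Rightarrow> real^'n^'n" where
  "ext_d1 \<omega> p = (\<chi> i j. partial i (\<lambda>q. \<omega> q $ j) p - partial j (\<lambda>q. \<omega> q $ i) p)"

text \<open>The formal adjoints of \<open>d\<close> with respect to \<open>G\<close>, by the usual coordinate formulas
  \<open>d\<^sup>*\<omega> = - |G|\<^sup>-\<^sup>1\<^sup>/\<^sup>2 \<partial>\<^sub>i(|G|\<^sup>1\<^sup>/\<^sup>2 \<omega>\<^sup>i)\<close> and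
  \<open>(d\<^sup>*\<eta>)\<^sup>l = - |G|\<^sup>-\<^sup>1\<^sup>/\<^sup>2 \<partial>\<^sub>i(|G|\<^sup>1\<^sup>/\<^sup>2 \<eta>\<^sup>i\<^sup>l)\<close>, the latter with its index lowered.\<close>

definition codiff1 :: "'n::finite metric_field \<Rightarrow> 'n vec_field \<Rightarrow> real^'n \<Rightarrow> real" where
  "codiff1 G \<omega> p =
     - (\<Sum>i\<in>UNIV. partial i (\<lambda>q. vol_density G q * (matrix_inv (G q) *v \<omega> q) $ i) p)
       / vol_density G p"

definition codiff2 ::
  "'n::finite metric_field \<Rightarrow> (real^'n \<Rightarrow> real^'n^'n) \<Rightarrow> 'n vec_field" where
  "codiff2 G \<eta> p = G p *v (\<chi> l.
     - (\<Sum>i\<in>UNIV. partial i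
          (\<lambda>q. vol_density G q * (matrix_inv (G q) ** \<eta> q ** matrix_inv (G q)) $ i $ l) p)
       / vol_density G p)"

definition hodge_laplacian :: "'n::finite metric_field \<Rightarrow> 'n vec_field \<Rightarrow> 'n vec_field" where
  "hodge_laplacian G \<omega> p = ext_d0 (codiff1 G \<omega>) p + codiff2 G (ext_d1 \<omega>) p"

text \<open>A vector field on \<open>U\<close> is represented by the function vanishing outside \<open>U\<close>,
  so that distinct functions are distinct vector fields on \<open>U\<close>.\<close>

definition harmonic_vec_fields ::
  "'n::finite metric_field \<Rightarrow> (real^'n) set \<Rightarrow> 'n vec_field set" where
  "harmonic_vec_fields G U =
     {X. (\<forall>p. p \<notin> U \<longrightarrow> X p = 0) \<and> (\<forall>i. smooth_on U (\<lambda>p. X p $ i)) \<and>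
         (\<forall>p\<in>U. hodge_laplacian G (flat G X) p = 0)}"

global_interpretation vf: vector_space
  "\<lambda>c (X :: real^'n::finite \<Rightarrow> real^'n) p. c *\<^sub>R X p"
  by unfold_locales (auto simp: fun_eq_iff scaleR_add_right scaleR_add_left)

definition infinite_dimensional :: "('n::finite vec_field) set \<Rightarrow> bool" where
  "infinite_dimensional V \<longleftrightarrow> \<not> (\<exists>B. finite B \<and> B \<subseteq> V \<and> V \<subseteq> vf.span B)"

section \<open>The Anderson manifold\<close>

definition half_disk :: "complex set" where
  "half_disk = {z. (Re z)\<^sup>2 + (Im z)\<^sup>2 < 1 \<and> Re z > 0}"

definition conf_factor :: "real \<Rightarrow> complex \<Rightarrow> real" where
  "conf_factor a z = 4 / (a\<^sup>2 * (1 - (cmod z)\<^sup>2)\<^sup>2)"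

definition rho :: "real \<Rightarrow> complex \<Rightarrow> real" where
  "rho a z = arsinh (2 * Re z / (1 - (cmod z)\<^sup>2)) / a"

definition warp :: "real \<Rightarrow> complex \<Rightarrow> real" where
  "warp a z = sinh (rho a z)"

text \<open>Rotating the half disk about the segment \<open>L\<close> gives the open unit ball: the point
  \<open>(x + iy, \<theta>)\<close> becomes \<open>(x cos \<theta>, x sin \<theta>, y)\<close> and \<open>L\<close> becomes the third axis.\<close>

definition ball3 :: "(real^3) set" where
  "ball3 = ball 0 1"

definition polar :: "complex \<Rightarrow> real \<Rightarrow> real^3" where
  "polar z \<theta> = vector [Re z * cos \<theta>, Re z * sin \<theta>, Im z]"

definition axis_dist :: "real^3 \<Rightarrow> real" where
  "axis_dist p = sqrt ((p $ 1)\<^sup>2 + (p $ 2)\<^sup>2)"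

definition half_plane_pt :: "real^3 \<Rightarrow> complex" where
  "half_plane_pt p = Complex (axis_dist p) (p $ 3)"

text \<open>Components of the differentials of \<open>x\<close>, \<open>y\<close> and \<open>\<theta>\<close> off the axis.\<close>

definition dx_form :: "real^3 \<Rightarrow> real^3" where
  "dx_form p = vector [p $ 1 / axis_dist p, p $ 2 / axis_dist p, 0]"

definition dy_form :: "real^3 \<Rightarrow> real^3" where
  "dy_form p = vector [0, 0, 1]"

definition dtheta_form :: "real^3 \<Rightarrow> real^3" where
  "dtheta_form p = vector [- p $ 2 / (axis_dist p)\<^sup>2, p $ 1 / (axis_dist p)\<^sup>2, 0]"

text \<open>Off the axis this is the warped product metric; on the axis, its smooth extension.
  See \<open>anderson_metric_polar\<close> and, for \<open>a = 2\<close>, \<open>anderson_metric_smooth_form\<close>.\<close>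

definition anderson_metric :: "real \<Rightarrow> 3 metric_field" where
  "anderson_metric a p =
     (if axis_dist p = 0 then conf_factor a (half_plane_pt p) *\<^sub>R mat 1
      else (\<chi> i j.
        conf_factor a (half_plane_pt p) *
          (dx_form p $ i * dx_form p $ j + dy_form p $ i * dy_form p $ j)
        + (warp a (half_plane_pt p))\<^sup>2 * (dtheta_form p $ i * dtheta_form p $ j)))"

lemma axis_dist_polar: "Re z > 0 \<Longrightarrow> axis_dist (polar z \<theta>) = Re z"
proof -
  assume "Re z > 0"
  have "(Re z * cos \<theta>)\<^sup>2 + (Re z * sin \<theta>)\<^sup>2 = (Re z)\<^sup>2 * ((cos \<theta>)\<^sup>2 + (sin \<theta>)\<^sup>2)"
    by (simp only: power_mult_distrib distrib_left)
  then show ?thesis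
    using \<open>Re z > 0\<close> by (simp add: axis_dist_def polar_def)
qed

lemma half_plane_pt_polar: "Re z > 0 \<Longrightarrow> half_plane_pt (polar z \<theta>) = z"
  by (simp add: half_plane_pt_def axis_dist_polar) (simp add: polar_def complex_eq_iff)

lemma polar_image: "(\<Union>\<theta>. (\<lambda>z. polar z \<theta>) ` half_disk) = {p \<in> ball3. axis_dist p \<noteq> 0}"
proof (intro equalityI subsetI)
  fix p assume "p \<in> (\<Union>\<theta>. (\<lambda>z. polar z \<theta>) ` half_disk)"
  then obtain z \<theta> where z: "z \<in> half_disk" and p: "p = polar z \<theta>" by auto
  have e: "(Re z * cos \<theta>)\<^sup>2 + (Re z * sin \<theta>)\<^sup>2 = (Re z)\<^sup>2 * ((cos \<theta>)\<^sup>2 + (sin \<theta>)\<^sup>2)"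
    by (simp only: power_mult_distrib distrib_left)
  have "norm p ^ 2 = (Re z)\<^sup>2 + (Im z)\<^sup>2"
    using e by (simp add: p polar_def power2_norm_eq_inner inner_vec_def sum_3 flip: power2_eq_square)
  then have "norm p < 1"
    using z by (simp add: half_disk_def) (smt (verit) one_le_power)
  then show "p \<in> {p \<in> ball3. axis_dist p \<noteq> 0}"
    using z by (simp add: p ball3_def half_disk_def axis_dist_polar)
next
  fix p :: "real^3" assume p: "p \<in> {p \<in> ball3. axis_dist p \<noteq> 0}"
  have pos: "axis_dist p > 0"
    using p by (simp add: axis_dist_def sum_power2_gt_zero_iff)
  have sq: "(axis_dist p)\<^sup>2 = (p $ 1)\<^sup>2 + (p $ 2)\<^sup>2"
    by (simp add: axis_dist_def)
  have "(p $ 1 / axis_dist p)\<^sup>2 + (p $ 2 / axis_dist p)\<^sup>2 = 1"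
    unfolding power_divide add_divide_distrib[symmetric] sq[symmetric] using pos by simp
  then obtain \<theta> where th: "p $ 1 / axis_dist p = cos \<theta>" "p $ 2 / axis_dist p = sin \<theta>"
    using sincos_total_2pi by metis
  have "(norm p)\<^sup>2 = (axis_dist p)\<^sup>2 + (p $ 3)\<^sup>2"
    by (simp add: sq power2_norm_eq_inner inner_vec_def sum_3 flip: power2_eq_square)
  moreover have "(norm p)\<^sup>2 < 1"
    using p by (simp add: ball3_def power_less_one_iff abs_square_less_1)
  ultimately have "half_plane_pt p \<in> half_disk"
    using pos by (simp add: half_disk_def half_plane_pt_def)
  moreover have "p = polar (half_plane_pt p) \<theta>"
    using pos th by (simp add: polar_def half_plane_pt_def vec_eq_iff forall_3 field_simps)
  ultimately show "p \<in> (\<Union>\<theta>. (\<lambda>z. polar z \<theta>) ` half_disk)" by blast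
qed

text \<open>In the coordinates \<open>(x, y, \<theta>)\<close> the metric is
  \<open>4(dx\<^sup>2 + dy\<^sup>2) / (a\<^sup>2(1 - |z|\<^sup>2)\<^sup>2) + f\<^sup>2 d\<theta>\<^sup>2\<close>; \<open>D\<close> is the differential of \<^const>\<open>polar\<close>.\<close>

lemma anderson_metric_polar:
  fixes v w :: "real^3"
  defines "D \<equiv> \<lambda>z \<theta> u. vector [u $ 1 * cos \<theta> - u $ 3 * Re z * sin \<theta>,
                              u $ 1 * sin \<theta> + u $ 3 * Re z * cos \<theta>, u $ 2] :: real^3"
  assumes "z \<in> half_disk"
  shows "D z \<theta> v \<bullet> (anderson_metric a (polar z \<theta>) *v D z \<theta> w) =
     4 * (v $ 1 * w $ 1 + v $ 2 * w $ 2) / (a\<^sup>2 * (1 - (cmod z)\<^sup>2)\<^sup>2)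
     + (warp a z)\<^sup>2 * (v $ 3 * w $ 3)"
proof -
  have x: "Re z > 0" using assms by (simp add: half_disk_def)
  let ?p = "polar z \<theta>"
  have dx: "dx_form ?p = vector [cos \<theta>, sin \<theta>, 0]"
    using x by (simp add: dx_form_def axis_dist_polar) (simp add: polar_def)
  have dt: "dtheta_form ?p = vector [- sin \<theta> / Re z, cos \<theta> / Re z, 0]"
    using x by (simp add: dtheta_form_def axis_dist_polar) (simp add: polar_def power2_eq_square)
  have form: "u \<bullet> (anderson_metric a ?p *v u') =
      conf_factor a z * ((dx_form ?p \<bullet> u) * (dx_form ?p \<bullet> u') + (dy_form ?p \<bullet> u) * (dy_form ?p \<bullet> u'))
      + (warp a z)\<^sup>2 * ((dtheta_form ?p \<bullet> u) * (dtheta_form ?p \<bullet> u'))" for u u' :: "real^3"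
    using x
    by (simp add: anderson_metric_def axis_dist_polar half_plane_pt_polar inner_vec_def
        matrix_vector_mult_def sum_3 algebra_simps)
  have cs: "cos \<theta> * cos \<theta> + sin \<theta> * sin \<theta> = 1"
    by (metis power2_eq_square sin_cos_squared_add2)
  have 1: "dx_form ?p \<bullet> D z \<theta> u = u $ 1" for u
  proof -
    have "dx_form ?p \<bullet> D z \<theta> u = cos \<theta> * (u $ 1 * cos \<theta> - u $ 3 * Re z * sin \<theta>)
        + sin \<theta> * (u $ 1 * sin \<theta> + u $ 3 * Re z * cos \<theta>)"
      by (simp add: dx D_def inner_vec_def sum_3)
    also have "\<dots> = u $ 1 * (cos \<theta> * cos \<theta> + sin \<theta> * sin \<theta>)" by algebra
    finally show ?thesis by (simp only: cs mult_1_right)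
  qed
  have 2: "dy_form ?p \<bullet> D z \<theta> u = u $ 2" for u
    by (simp add: dy_form_def D_def inner_vec_def sum_3)
  have 3: "dtheta_form ?p \<bullet> D z \<theta> u = u $ 3" for u
  proof -
    have "Re z * (dtheta_form ?p \<bullet> D z \<theta> u) =
        - sin \<theta> * (u $ 1 * cos \<theta> - u $ 3 * Re z * sin \<theta>)
        + cos \<theta> * (u $ 1 * sin \<theta> + u $ 3 * Re z * cos \<theta>)"
      using x by (simp add: dt D_def inner_vec_def sum_3 field_simps)
    also have "\<dots> = Re z * (u $ 3 * (cos \<theta> * cos \<theta> + sin \<theta> * sin \<theta>))" by algebra
    finally show ?thesis using x by (simp only: cs mult_1_right) simp
  qed
  show ?thesis
    by (simp add: form 1 2 3 conf_factor_def)
qed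

text \<open>For \<open>a = 2\<close> the metric has real-analytic coefficients on the whole ball,
  the axis included.\<close>

lemma anderson_metric_smooth_form:
  fixes p :: "real^3"
  assumes "p \<in> ball3"
  defines "m \<equiv> 1 / (1 - (norm p)\<^sup>2)\<^sup>2"
  defines "w \<equiv> sqrt (1 + 4 * m * ((p $ 1)\<^sup>2 + (p $ 2)\<^sup>2))"
  defines "t \<equiv> vector [- p $ 2, p $ 1, 0] :: real^3"
  shows "anderson_metric 2 p $ i $ j =
     m * (if i = j then 1 else 0) - 4 * m\<^sup>2 / (1 + w)\<^sup>2 * (t $ i * t $ j)"
proof -
  define x where "x = axis_dist p"
  let ?z = "half_plane_pt p"
  have x2: "x\<^sup>2 = (p $ 1)\<^sup>2 + (p $ 2)\<^sup>2" by (simp add: x_def axis_dist_def)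
  have R: "(cmod ?z)\<^sup>2 = (norm p)\<^sup>2"
    by (simp add: half_plane_pt_def cmod_power2 flip: x_def)
       (simp add: x2 power2_norm_eq_inner inner_vec_def sum_3 flip: power2_eq_square)
  have cf: "conf_factor 2 ?z = m" by (simp add: conf_factor_def R m_def)
  have m0: "m \<ge> 0" by (simp add: m_def)
  have w0: "w \<ge> 1" using m0 by (simp add: w_def)
  have w2: "w\<^sup>2 = 1 + 4 * m * x\<^sup>2" using m0 by (simp add: w_def x2)
  define s where "s = arsinh (2 * x / (1 - (norm p)\<^sup>2))"
  have rz: "rho 2 ?z = s / 2" by (simp add: rho_def R s_def) (simp add: half_plane_pt_def x_def)
  have "(cosh s)\<^sup>2 = 1 + (sinh s)\<^sup>2" by (simp add: cosh_square_eq)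
  also have "\<dots> = w\<^sup>2"
    by (simp add: s_def w2 m_def power_divide power_mult_distrib)
  finally have cw: "cosh s = w" using w0 by (simp add: power2_eq_iff_nonneg)
  have "cosh s = 2 * (sinh (s / 2))\<^sup>2 + 1"
    using cosh_double[of "s / 2"] by (simp add: cosh_square_eq)
  then have wp: "(warp 2 ?z)\<^sup>2 = (w - 1) / 2" by (simp add: warp_def rz cw)
  show ?thesis
  proof (cases "x = 0")
    case True
    then have "p $ 1 = 0" "p $ 2 = 0" using x2 by (auto simp: sum_power2_eq_zero_iff)
    moreover have "t $ k = 0" for k
      using exhaust_3[of k] calculation by (auto simp: t_def)
    ultimately show ?thesis using True
      by (simp add: anderson_metric_def cf mat_def flip: x_def)
  next
    case False
    have k: "4 * m\<^sup>2 / (1 + w)\<^sup>2 * x ^ 4 = m * x\<^sup>2 - (w - 1) / 2"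
    proof -
      have mx: "m * x\<^sup>2 = (w - 1) * (w + 1) / 4"
        using w2 by (simp add: algebra_simps power2_eq_square)
      have "4 * m\<^sup>2 / (1 + w)\<^sup>2 * x ^ 4 = 4 * (m * x\<^sup>2)\<^sup>2 / (1 + w)\<^sup>2"
        by (simp add: power_mult_distrib flip: power_mult)
      also have "\<dots> = (w - 1)\<^sup>2 / 4"
        using w0 by (simp add: mx power_mult_distrib power_divide add.commute)
      also have "\<dots> = m * x\<^sup>2 - (w - 1) / 2"
        unfolding mx by (simp add: power2_eq_square field_simps)
      finally show ?thesis .
    qed
    define c where "c = 4 * m\<^sup>2 / (1 + w)\<^sup>2"
    have f2: "(w - 1) / 2 = m * x\<^sup>2 - c * x ^ 4" using k by (simp add: c_def)
    have t: "dtheta_form p $ k = t $ k / x\<^sup>2" for k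
      using exhaust_3[of k] by (auto simp: dtheta_form_def t_def x_def)
    have "anderson_metric 2 p $ i $ j =
        m * (dx_form p $ i * dx_form p $ j + dy_form p $ i * dy_form p $ j)
        + (m * x\<^sup>2 - c * x ^ 4) * (t $ i / x\<^sup>2 * (t $ j / x\<^sup>2))"
      using False by (simp add: anderson_metric_def cf wp f2 t flip: x_def)
    also have "(m * x\<^sup>2 - c * x ^ 4) * (t $ i / x\<^sup>2 * (t $ j / x\<^sup>2)) =
        m * (t $ i * t $ j / x\<^sup>2) - c * (t $ i * t $ j)"
      using False by (simp add: field_simps power2_eq_square power4_eq_xxxx)
    also have "dx_form p $ i * dx_form p $ j =
        vector [p $ 1, p $ 2, 0] $ i * vector [p $ 1, p $ 2, 0 :: real] $ j / x\<^sup>2"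
      using exhaust_3[of i] exhaust_3[of j]
      by (auto simp: dx_form_def power2_eq_square simp flip: x_def)
    finally have e: "anderson_metric 2 p $ i $ j =
        m * ((vector [p $ 1, p $ 2, 0] $ i * vector [p $ 1, p $ 2, 0 :: real] $ j + t $ i * t $ j) / x\<^sup>2
             + dy_form p $ i * dy_form p $ j) - c * (t $ i * t $ j)"
      by (simp add: algebra_simps add_divide_distrib)
    have "(vector [p $ 1, p $ 2, 0] $ i * vector [p $ 1, p $ 2, 0 :: real] $ j + t $ i * t $ j) / x\<^sup>2
             + dy_form p $ i * dy_form p $ j = (if i = j then 1 else 0)"
      using exhaust_3[of i] exhaust_3[of j] False x2
      by (auto simp: t_def dy_form_def power2_eq_square)
    then show ?thesis by (simp only: e c_def)
  qed
qed

end

theory Submission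
  imports Defs "HOL-Complex_Analysis.Cauchy_Integral_Formula"
begin

text \<open>Since \<open>dd\<^sup>* + d\<^sup>*d\<close> annihilates the differential of a harmonic function, gradients of harmonic functions
are harmonic vector fields; the point is to find enough harmonic functions \<open>u\<close> whose gradient and Hessian
have integrable powers.

\<^bold>\<open>Separation of variables.\<close> The conformal map \<open>y + ix \<mapsto> artanh (y + ix) = t + is\<close> takes the half disk to
the strip \<open>0 < s < \<pi>/4\<close> and the axis \<open>L\<close> to \<open>s = 0\<close>. There the metric is
\<open>(ds\<^sup>2 + dt\<^sup>2) / cos\<^sup>2(2s) + f\<^sup>2 d\<theta>\<^sup>2\<close> with \<open>f = sin s / \<surd>cos (2s)\<close>, and a function \<open>u(s, t)\<close> is harmonic iff
\<open>\<partial>\<^sub>s (f \<partial>\<^sub>s u) + f \<partial>\<^sub>t\<^sup>2 u = 0\<close>. Let \<open>\<phi>\<^sub>0 = 1\<close> and let \<open>\<phi>\<^sub>n\<^sub>+\<^sub>1\<close> be the solution of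
\<open>(f \<phi>\<^sub>n\<^sub>+\<^sub>1')' = f \<phi>\<^sub>n\<close> that is smooth on the axis and zero there. For every function \<open>h\<close> the series
\<open>u = \<Sum>\<^sub>n (-1)\<^sup>n h\<^sup>(\<^sup>2\<^sup>n\<^sup>)(t) \<phi>\<^sub>n(s)\<close> is a formal solution with \<open>u = h\<close> on the axis.

\<^bold>\<open>Convergence and decay.\<close> As \<open>\<phi>\<^sub>n\<close> arises by \<open>2n\<close> integrations, \<open>\<bar>\<phi>\<^sub>n\<bar> \<le> C\<^sup>n / (n!)\<^sup>2\<close>, up to the boundary.
For \<open>h = exp (- c t\<^sup>2)\<close>, Cauchy's inequality on circles of an arbitrary radius \<open>R\<close> gives
\<open>\<bar>h\<^sup>(\<^sup>m\<^sup>)(t)\<bar> \<le> M m! R\<^sup>-\<^sup>m exp (- K\<bar>t\<bar>)\<close>. So the series converges, and it decays faster than any exponential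
in \<open>t\<close>, as do the derivatives that enter the Hessian (\<open>wave_bound\<close>); only the second radial derivative has to be
multiplied by the distance to the boundary first. In the variable \<open>x = tan\<^sup>2 s\<close> the \<open>\<phi>\<^sub>n\<close> are holomorphic on the
unit disc, which gives smoothness across the axis.

\<^bold>\<open>Integrability.\<close> Let \<open>E = 1 - \<bar>p\<bar>\<^sup>2\<close>. The norms of the field and of its covariant derivative are \<open>E\<close> times a
function that vanishes to infinite order at the two ends of the axis (\<open>rapid_field_norms\<close>). The volume
density is \<open>E\<^sup>-\<^sup>5\<^sup>/\<^sup>2\<close> up to a power of the distance to those ends. So for \<open>q \<ge> 2\<close> the \<open>q\<close>-th powers have a
density of at most a constant times \<open>E\<^sup>-\<^sup>1\<^sup>/\<^sup>2\<close> (\<open>density_power_bound\<close>), which is integrable on the ball. The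
exponent exceeds \<open>-1\<close> because the circle factor \<open>f\<close> grows only like \<open>E\<^sup>-\<^sup>1\<^sup>/\<^sup>a\<close>, where \<open>a = 2\<close>.

\<^bold>\<open>Infinitely many fields.\<close> On the axis the field of \<open>h = exp (- c t\<^sup>2)\<close> is \<open>h'(t)\<close> times a field that does not
depend on \<open>c\<close> (\<open>harm_field_axis\<close>), so different \<open>c\<close> give independent fields. That the fields in question form
a vector space follows from the smoothness and positivity of the metric.\<close>

section \<open>Calculus of smooth functions\<close>

lemma has_field_derivative_along_axis:
  assumes "(f has_derivative f') (at p)"
  shows "((\<lambda>t. f (p + t *\<^sub>R axis i 1)) has_field_derivative f' (axis i 1)) (at 0)"
proof -
  have 1: "((\<lambda>t. p + t *\<^sub>R axis i 1) has_derivative (\<lambda>t. t *\<^sub>R axis i 1)) (at (0::real))"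
    by (auto intro!: derivative_eq_intros)
  have "(f \<circ> (\<lambda>t. p + t *\<^sub>R axis i 1) has_derivative f' \<circ> (\<lambda>t. t *\<^sub>R axis i 1)) (at 0)"
    by (rule diff_chain_at[OF 1]) (simp add: assms)
  moreover have "f' (t *\<^sub>R axis i 1) = f' (axis i 1) * t" for t
    using assms by (simp add: has_derivative_def bounded_linear.linear linear_cmul)
  ultimately show ?thesis by (simp add: has_field_derivative_def o_def)
qed

lemma partial_eq_derivative: "(f has_derivative f') (at p) \<Longrightarrow> partial i f p = f' (axis i 1)"
  by (simp add: partial_def DERIV_imp_deriv has_field_derivative_along_axis)

lemma partial_cong:
  assumes "open U" "p \<in> U" "\<And>q. q \<in> U \<Longrightarrow> f q = g q"
  shows "partial i f p = partial i g p"
proof -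
  have "open ((\<lambda>t::real. p + t *\<^sub>R axis i 1) -` U)"
    by (intro open_vimage assms(1) continuous_intros)
  then have "\<forall>\<^sub>F t in nhds (0::real). t \<in> (\<lambda>t. p + t *\<^sub>R axis i 1) -` U"
    using assms(2) by (intro eventually_nhds_in_open) auto
  then have "\<forall>\<^sub>F t in nhds (0::real). f (p + t *\<^sub>R axis i 1) = g (p + t *\<^sub>R axis i 1)"
    by (rule eventually_mono) (use assms(3) in simp)
  then show ?thesis unfolding partial_def by (intro deriv_cong_ev) auto
qed

lemma partial_zero_on: "open U \<Longrightarrow> p \<in> U \<Longrightarrow> (\<And>q. q \<in> U \<Longrightarrow> f q = 0) \<Longrightarrow> partial i f p = 0"
  using partial_cong[of U p f "\<lambda>_. 0" i] by (simp add: partial_def)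

lemma differentiable_on_cong_open:
  fixes f g :: "real^'n::finite \<Rightarrow> real"
  assumes "open U" "\<And>q. q \<in> U \<Longrightarrow> f q = g q"
  shows "f differentiable_on U \<longleftrightarrow> g differentiable_on U"
proof -
  have "f differentiable_on U \<Longrightarrow> g differentiable_on U"
    if "\<And>q. q \<in> U \<Longrightarrow> f q = g q" for f g :: "real^'n \<Rightarrow> real"
    unfolding differentiable_on_def differentiable_def
    using has_derivative_transform[of _ U g f] that by metis
  then show ?thesis using assms(2) by (metis)
qed

lemma Ck_on_cong:
  assumes "open U" "\<And>q. q \<in> U \<Longrightarrow> f q = g q"
  shows "Ck_on k U f \<longleftrightarrow> Ck_on k U g"
  using assms(2)
proof (induction k arbitrary: f g)
  case 0
  then show ?case by (auto cong: continuous_on_cong)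
next
  case (Suc k)
  have "f differentiable_on U \<longleftrightarrow> g differentiable_on U"
    using differentiable_on_cong_open[OF assms(1)] Suc.prems by blast
  moreover have "Ck_on k U (partial i f) \<longleftrightarrow> Ck_on k U (partial i g)" for i
    by (rule Suc.IH) (rule partial_cong[OF assms(1)], use Suc.prems in auto)
  ultimately show ?case by simp
qed

lemma Ck_on_SucD: "Ck_on (Suc k) U f \<Longrightarrow> Ck_on k U f"
proof (induction k arbitrary: f)
  case 0
  then show ?case by (auto intro: differentiable_imp_continuous_on)
next
  case (Suc k)
  then show ?case by (metis Ck_on.simps(2))
qed

lemma smooth_on_imp_Ck: "smooth_on U f \<Longrightarrow> Ck_on k U f"
  by (simp add: smooth_on_def)

lemma smooth_on_imp_continuous: "smooth_on U f \<Longrightarrow> continuous_on U f"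
  using smooth_on_imp_Ck[of U f 0] by simp

lemma Ck_on_Suc_differentiable:
  "Ck_on (Suc k) U f \<Longrightarrow> open U \<Longrightarrow> p \<in> U \<Longrightarrow> f differentiable (at p)"
  by (simp add: differentiable_on_eq_differentiable_at)

lemma smooth_on_imp_differentiable:
  "smooth_on U f \<Longrightarrow> open U \<Longrightarrow> p \<in> U \<Longrightarrow> f differentiable (at p)"
  using smooth_on_imp_Ck[of U f "Suc 0"] Ck_on_Suc_differentiable by blast

lemma smooth_on_partial: "smooth_on U f \<Longrightarrow> smooth_on U (partial i f)"
  unfolding smooth_on_def by (metis Ck_on.simps(2))

lemma smooth_on_cong:
  "open U \<Longrightarrow> (\<And>q. q \<in> U \<Longrightarrow> f q = g q) \<Longrightarrow> smooth_on U f \<longleftrightarrow> smooth_on U g"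
  unfolding smooth_on_def by (metis Ck_on_cong)

lemma Ck_on_const: "Ck_on k U (\<lambda>_. c)"
proof (induction k arbitrary: c)
  case (Suc k)
  have "partial i (\<lambda>_. c) = (\<lambda>_. 0)" for i :: 'a
    by (simp add: partial_def fun_eq_iff)
  then show ?case using Suc by simp
qed simp

lemma partial_add:
  assumes "f differentiable (at p)" "g differentiable (at p)"
  shows "partial i (\<lambda>q. f q + g q) p = partial i f p + partial i g p"
proof -
  obtain f' g' where "(f has_derivative f') (at p)" "(g has_derivative g') (at p)"
    using assms by (auto simp: differentiable_def)
  then show ?thesis
    by (simp add: partial_eq_derivative has_derivative_add partial_eq_derivative[OF has_derivative_add])
qed

lemma partial_mult:
  assumes "f differentiable (at p)" "g differentiable (at p)"
  shows "partial i (\<lambda>q. f q * g q) p = f p * partial i g p + partial i f p * g p"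
proof -
  obtain f' g' where "(f has_derivative f') (at p)" "(g has_derivative g') (at p)"
    using assms by (auto simp: differentiable_def)
  then show ?thesis
    by (simp add: partial_eq_derivative partial_eq_derivative[OF has_derivative_mult])
qed

lemma partial_cmult:
  assumes "f differentiable (at p)"
  shows "partial i (\<lambda>q. c * f q) p = c * partial i f p"
  using partial_mult[of "\<lambda>_. c" p f i] assms by (simp add: partial_def)

lemma partial_sum:
  assumes "\<And>j. j \<in> J \<Longrightarrow> f j differentiable (at p)"
  shows "partial i (\<lambda>q. \<Sum>j\<in>J. f j q) p = (\<Sum>j\<in>J. partial i (f j) p)"
proof -
  have "\<exists>f'. \<forall>j\<in>J. (f j has_derivative f' j) (at p)"
    using assms unfolding differentiable_def by (intro bchoice) blast
  then obtain f' where f': "\<And>j. j \<in> J \<Longrightarrow> (f j has_derivative f' j) (at p)" by blast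
  have "((\<lambda>q. \<Sum>j\<in>J. f j q) has_derivative (\<lambda>v. \<Sum>j\<in>J. f' j v)) (at p)"
    by (rule has_derivative_sum) (rule f')
  from partial_eq_derivative[OF this] show ?thesis
    by (auto intro!: sum.cong simp: partial_eq_derivative[OF f'])
qed

lemma Ck_on_add:
  assumes "open U" "Ck_on k U f" "Ck_on k U g"
  shows "Ck_on k U (\<lambda>p. f p + g p)"
  using assms(2,3)
proof (induction k arbitrary: f g)
  case 0
  then show ?case by (simp add: continuous_on_add continuous_on_mult)
next
  case (Suc k)
  have "Ck_on k U (partial i (\<lambda>p. f p + g p))" for i
  proof -
    have "Ck_on k U (\<lambda>p. partial i f p + partial i g p)"
      by (rule Suc.IH) (use Suc.prems in auto)
    moreover have "partial i (\<lambda>p. f p + g p) p = partial i f p + partial i g p" if "p \<in> U" for p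
      using partial_add Ck_on_Suc_differentiable assms(1) that Suc.prems by blast
    ultimately show ?thesis using Ck_on_cong[OF assms(1)] by (metis (no_types, lifting))
  qed
  then show ?case using Suc.prems by (simp add: differentiable_on_add)
qed

lemma Ck_on_mult:
  assumes "open U" "Ck_on k U f" "Ck_on k U g"
  shows "Ck_on k U (\<lambda>p. f p * g p)"
  using assms(2,3)
proof (induction k arbitrary: f g)
  case 0
  then show ?case by (simp add: continuous_on_add continuous_on_mult)
next
  case (Suc k)
  have "Ck_on k U (partial i (\<lambda>p. f p * g p))" for i
  proof -
    have "Ck_on k U (\<lambda>p. f p * partial i g p + partial i f p * g p)"
      by (intro Ck_on_add[OF assms(1)] Suc.IH) (use Suc.prems Ck_on_SucD in auto)
    moreover have "partial i (\<lambda>p. f p * g p) p = f p * partial i g p + partial i f p * g p"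
      if "p \<in> U" for p
      using partial_mult Ck_on_Suc_differentiable assms(1) that Suc.prems by blast
    ultimately show ?thesis using Ck_on_cong[OF assms(1)] by (metis (no_types, lifting))
  qed
  then show ?case using Suc.prems by (simp add: differentiable_on_mult)
qed

lemma Ck_on_inverse:
  assumes "open U" "\<And>p. p \<in> U \<Longrightarrow> f p \<noteq> 0" "Ck_on k U f"
  shows "Ck_on k U (\<lambda>p. inverse (f p))"
  using assms(3)
proof (induction k)
  case 0
  then show ?case using assms(2) by (auto intro!: continuous_intros)
next
  case (Suc k)
  have d: "((\<lambda>p. inverse (f p)) has_derivative (\<lambda>v. - (inverse (f p) * f' v * inverse (f p)))) (at p)"
    if "p \<in> U" "(f has_derivative f') (at p)" for p f'
    using Deriv.has_derivative_inverse[of f p f' UNIV] that assms(2) by auto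
  have diff: "f differentiable (at p)" if "p \<in> U" for p
    using Ck_on_Suc_differentiable assms(1) that Suc.prems by blast
  have "Ck_on k U (partial i (\<lambda>p. inverse (f p)))" for i
  proof -
    have "Ck_on k U (\<lambda>p. (-1) * ((inverse (f p) * partial i f p) * inverse (f p)))"
      by (intro Ck_on_mult[OF assms(1)] Ck_on_const Suc.IH Ck_on_SucD[OF Suc.prems]) (use Suc.prems in auto)
    moreover have "partial i (\<lambda>p. inverse (f p)) p = (-1) * ((inverse (f p) * partial i f p) * inverse (f p))"
      if p: "p \<in> U" for p
      using diff[OF p] unfolding differentiable_def
      by (auto simp: partial_eq_derivative partial_eq_derivative[OF d[OF p]])
    ultimately show ?thesis using Ck_on_cong[OF assms(1)] by (metis (no_types, lifting))
  qed
  moreover have "(\<lambda>p. inverse (f p)) differentiable_on U"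
    using diff d unfolding differentiable_def
    by (intro differentiable_at_imp_differentiable_on) (metis differentiable_def)
  ultimately show ?case by simp
qed

lemma Ck_on_sqrt:
  assumes "open U" "\<And>p. p \<in> U \<Longrightarrow> f p > 0" "Ck_on k U f"
  shows "Ck_on k U (\<lambda>p. sqrt (f p))"
  using assms(3)
proof (induction k)
  case 0
  then show ?case using assms(2) by (auto intro!: continuous_intros)
next
  case (Suc k)
  have d: "((\<lambda>p. sqrt (f p)) has_derivative (\<lambda>v. f' v * (1/2 * inverse (sqrt (f p))))) (at p)"
    if "p \<in> U" "(f has_derivative f') (at p)" for p f'
    using that assms(2)[of p] by (auto intro!: derivative_eq_intros simp: field_simps)
  have diff: "f differentiable (at p)" if "p \<in> U" for p
    using Ck_on_Suc_differentiable assms(1) that Suc.prems by blast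
  have "Ck_on k U (partial i (\<lambda>p. sqrt (f p)))" for i
  proof -
    have "Ck_on k U (\<lambda>p. partial i f p * (1/2 * inverse (sqrt (f p))))"
      by (intro Ck_on_mult[OF assms(1)] Ck_on_const Ck_on_inverse Suc.IH Ck_on_SucD[OF Suc.prems] assms(1))
         (use Suc.prems assms(2) in force)+
    moreover have "partial i (\<lambda>p. sqrt (f p)) p = partial i f p * (1/2 * inverse (sqrt (f p)))"
      if p: "p \<in> U" for p
      using diff[OF p] unfolding differentiable_def
      by (auto simp: partial_eq_derivative partial_eq_derivative[OF d[OF p]])
    ultimately show ?thesis using Ck_on_cong[OF assms(1)] by (metis (no_types, lifting))
  qed
  moreover have "(\<lambda>p. sqrt (f p)) differentiable_on U"
    using diff d unfolding differentiable_def
    by (intro differentiable_at_imp_differentiable_on) (metis differentiable_def)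
  ultimately show ?case by simp
qed

lemma Ck_on_nth: "Ck_on k U (\<lambda>p. p $ i)"
proof (cases k)
  case (Suc l)
  have d: "((\<lambda>p::real^'a. p $ i) has_derivative (\<lambda>v. v $ i)) (at p within V)" for p V
    by (intro bounded_linear_imp_has_derivative bounded_linear_vec_nth)
  have "partial j (\<lambda>p. p $ i) = (\<lambda>_. axis j 1 $ i)" for j :: 'a
    using partial_eq_derivative[OF d] by (simp add: fun_eq_iff)
  then show ?thesis using d Suc
    by (auto simp: Ck_on_const differentiable_on_def differentiable_def)
qed (simp add: continuous_intros)

named_theorems smooth_rules

lemma smooth_on_const [smooth_rules]: "smooth_on U (\<lambda>_. c)"
  by (simp add: smooth_on_def Ck_on_const)

lemma smooth_on_nth [smooth_rules]: "smooth_on U (\<lambda>p. p $ i)"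
  by (simp add: smooth_on_def Ck_on_nth)

lemma smooth_on_add [smooth_rules]:
  "open U \<Longrightarrow> smooth_on U f \<Longrightarrow> smooth_on U g \<Longrightarrow> smooth_on U (\<lambda>p. f p + g p)"
  by (simp add: smooth_on_def Ck_on_add)

lemma smooth_on_mult [smooth_rules]:
  "open U \<Longrightarrow> smooth_on U f \<Longrightarrow> smooth_on U g \<Longrightarrow> smooth_on U (\<lambda>p. f p * g p)"
  by (simp add: smooth_on_def Ck_on_mult)

lemma smooth_on_minus [smooth_rules]:
  "open U \<Longrightarrow> smooth_on U f \<Longrightarrow> smooth_on U (\<lambda>p. - f p)"
  using smooth_on_mult[of U "\<lambda>_. -1" f] by (simp add: smooth_on_const)

lemma smooth_on_diff [smooth_rules]:
  "open U \<Longrightarrow> smooth_on U f \<Longrightarrow> smooth_on U g \<Longrightarrow> smooth_on U (\<lambda>p. f p - g p)"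
  using smooth_on_add[of U f "\<lambda>p. - g p"] by (simp add: smooth_on_minus)

lemma smooth_on_inverse [smooth_rules]:
  "open U \<Longrightarrow> (\<And>p. p \<in> U \<Longrightarrow> f p \<noteq> 0) \<Longrightarrow> smooth_on U f \<Longrightarrow> smooth_on U (\<lambda>p. inverse (f p))"
  by (simp add: smooth_on_def Ck_on_inverse)

lemma smooth_on_divide [smooth_rules]:
  "open U \<Longrightarrow> (\<And>p. p \<in> U \<Longrightarrow> g p \<noteq> 0) \<Longrightarrow> smooth_on U f \<Longrightarrow> smooth_on U g \<Longrightarrow>
    smooth_on U (\<lambda>p. f p / g p)"
  by (simp add: divide_inverse smooth_on_inverse smooth_on_mult)

lemma smooth_on_sqrt [smooth_rules]:
  "open U \<Longrightarrow> (\<And>p. p \<in> U \<Longrightarrow> f p > 0) \<Longrightarrow> smooth_on U f \<Longrightarrow> smooth_on U (\<lambda>p. sqrt (f p))"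
  by (simp add: smooth_on_def Ck_on_sqrt)

lemma smooth_on_power [smooth_rules]:
  "open U \<Longrightarrow> smooth_on U f \<Longrightarrow> smooth_on U (\<lambda>p. f p ^ n)"
  by (induction n) (auto intro: smooth_rules)

lemma smooth_on_sum [smooth_rules]:
  "open U \<Longrightarrow> (\<And>j. j \<in> J \<Longrightarrow> smooth_on U (f j)) \<Longrightarrow> smooth_on U (\<lambda>p. \<Sum>j\<in>J. f j p)"
  by (induction J rule: infinite_finite_induct) (auto intro!: smooth_rules)

text \<open>The model case is \<open>\<Phi> a b = (\<partial>\<^sub>t\<^sup>a \<partial>\<^sub>x\<^sup>b F)(x(p), t(p))\<close> with smooth coordinates \<open>x\<close> and \<open>t\<close>. By the chain rule the partial
derivatives of a member are combinations of members, so regularity of order \<open>k\<close> of all members gives order \<open>k + 1\<close>.\<close>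

lemma smooth_on_jet_family:
  fixes \<Phi> :: "nat \<Rightarrow> nat \<Rightarrow> real^'n::finite \<Rightarrow> real"
  assumes "open U"
    and der: "\<And>a b p. p \<in> U \<Longrightarrow> (\<Phi> a b has_derivative
               (\<lambda>v. \<Phi> a (Suc b) p * X' p v + \<Phi> (Suc a) b p * Y' p v)) (at p)"
    and "\<And>i. smooth_on U (\<lambda>p. X' p (axis i 1))" "\<And>i. smooth_on U (\<lambda>p. Y' p (axis i 1))"
  shows "smooth_on U (\<Phi> a b)"
proof -
  have diff: "\<Phi> a b differentiable_on U" for a b
  proof (rule differentiable_at_imp_differentiable_on)
    fix p assume "p \<in> U"
    from der[OF this, of a b] show "\<Phi> a b differentiable (at p)"
      using differentiable_def by blast
  qed
  have "Ck_on k U (\<Phi> a b)" for k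
  proof (induction k arbitrary: a b)
    case 0
    have "\<Phi> a b differentiable_on U"
      by (rule diff)
    then show ?case by (simp add: differentiable_imp_continuous_on)
  next
    case (Suc k)
    have "Ck_on k U (partial i (\<Phi> a b))" for i
    proof -
      have eq: "partial i (\<Phi> a b) p
          = \<Phi> a (Suc b) p * X' p (axis i 1) + \<Phi> (Suc a) b p * Y' p (axis i 1)" if "p \<in> U" for p
        by (rule partial_eq_derivative[OF der[OF that]])
      have "Ck_on k U (\<lambda>p. \<Phi> a (Suc b) p * X' p (axis i 1) + \<Phi> (Suc a) b p * Y' p (axis i 1))"
        by (intro Ck_on_add[OF assms(1)] Ck_on_mult[OF assms(1)] Suc.IH smooth_on_imp_Ck assms(3,4))
      moreover have "Ck_on k U (partial i (\<Phi> a b)) = Ck_on k U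
          (\<lambda>p. \<Phi> a (Suc b) p * X' p (axis i 1) + \<Phi> (Suc a) b p * Y' p (axis i 1))"
        by (rule Ck_on_cong[OF assms(1)]) (rule eq)
      ultimately show ?thesis by simp
    qed
    moreover have "\<Phi> a b differentiable_on U"
      by (rule diff)
    ultimately show ?case by simp
  qed
  then show ?thesis by (simp add: smooth_on_def)
qed

section \<open>The radial functions\<close>

abbreviation unit_disc :: "complex set" where "unit_disc \<equiv> ball 0 1"

text \<open>In the variable \<open>x = tan\<^sup>2 s\<close> the equation \<open>(f G')' = f g\<close> of the introduction is solved by two integrations,
\<open>P(x) = \<integral>\<^sub>0\<^sup>x inner_weight \<cdot> g\<close> and \<open>x G'(x) = outer_weight(x) P(x)\<close>. The weights are \<open>f\<close> and \<open>1 / f\<close>, with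
\<open>f = \<surd>(x / (1 - x))\<close>, times factors from \<open>ds = dx / (2 \<surd>x (1 + x))\<close>; the square roots of \<open>x\<close> cancel, so that
both are holomorphic on the unit disc.\<close>

definition outer_weight :: "complex \<Rightarrow> complex" where
  "outer_weight z = csqrt (1 - z) / (2 * (1 + z))"

definition inner_weight :: "complex \<Rightarrow> complex" where
  "inner_weight z = 1 / (2 * (1 + z) * csqrt (1 - z))"

lemma unit_disc_slit: "z \<in> unit_disc \<Longrightarrow> 1 - z \<notin> \<real>\<^sub>\<le>\<^sub>0"
  using complex_Re_le_cmod[of z] by (auto simp: complex_nonpos_Reals_iff)

lemma unit_disc_nz: "z \<in> unit_disc \<Longrightarrow> 1 + z \<noteq> 0" "z \<in> unit_disc \<Longrightarrow> 1 - z \<noteq> 0"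
   apply (metis add.inverse_inverse add_eq_0_iff dist_0_norm less_irrefl mem_ball norm_minus_cancel norm_one)
  by auto

lemma holomorphic_on_unit_discI:
  "(\<And>z. z \<in> unit_disc \<Longrightarrow> (f has_field_derivative f' z) (at z)) \<Longrightarrow> f holomorphic_on unit_disc"
  by (simp only: holomorphic_on_open open_ball) blast

lemma outer_weight_deriv:
  assumes "z \<in> unit_disc"
  shows "(outer_weight has_field_derivative
            outer_weight z * (- 1 / (2 * (1 - z)) - 1 / (1 + z))) (at z)"
proof -
  note nz = unit_disc_nz[OF assms]
  have s: "csqrt (1 - z) * csqrt (1 - z) = 1 - z"
    by (metis power2_csqrt power2_eq_square)
  have sn: "csqrt (1 - z) \<noteq> 0" using nz by simp
  have e: "inverse (2 * csqrt (1 - z)) = csqrt (1 - z) / (2 * (1 - z))"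
  proof -
    have "inverse (2 * c) = c / (2 * (c * c))" if "c \<noteq> 0" for c :: complex
      using that by (simp add: field_simps)
    from this[OF sn] show ?thesis by (simp only: s)
  qed
  have 1: "((\<lambda>z. csqrt (1 - z)) has_field_derivative inverse (2 * csqrt (1 - z)) * (0 - 1)) (at z)"
    by (rule DERIV_chain2[where f = csqrt and g = "\<lambda>z. 1 - z"],
        rule has_field_derivative_csqrt[OF unit_disc_slit[OF assms]], intro derivative_intros)
  have 2: "((\<lambda>z. 2 * (1 + z)) has_field_derivative 2) (at z)"
    by (auto intro!: derivative_eq_intros)
  have "(outer_weight has_field_derivative
      ((- inverse (2 * csqrt (1 - z))) * (2 * (1 + z)) - csqrt (1 - z) * 2)
        / (2 * (1 + z) * (2 * (1 + z)))) (at z)"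
    using DERIV_divide[OF 1 2] nz unfolding outer_weight_def[abs_def]
    by (simp only: mult_eq_0_iff) simp
  also have "((- inverse (2 * csqrt (1 - z))) * (2 * (1 + z)) - csqrt (1 - z) * 2)
        / (2 * (1 + z) * (2 * (1 + z))) = outer_weight z * (- 1 / (2 * (1 - z)) - 1 / (1 + z))"
  proof -
    have "((- (c / (2 * v))) * (2 * u) - c * 2) / (2 * u * (2 * u)) = c / (2 * u) * (- 1 / (2 * v) - 1 / u)"
      if "u \<noteq> 0" "v \<noteq> 0" for c u v :: complex
      using that by (simp add: divide_simps) (simp add: algebra_simps)
    from this[OF nz] show ?thesis unfolding outer_weight_def e .
  qed
  finally show ?thesis .
qed

lemma outer_weight_holomorphic: "outer_weight holomorphic_on unit_disc"
  by (rule holomorphic_on_unit_discI, rule outer_weight_deriv)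

lemma inner_weight_holomorphic: "inner_weight holomorphic_on unit_disc"
proof -
  have "csqrt (1 - z) \<noteq> 0" if "z \<in> unit_disc" for z
    using unit_disc_nz[OF that] by simp
  then show ?thesis unfolding inner_weight_def
    by (intro holomorphic_intros) (use unit_disc_nz unit_disc_slit in \<open>auto simp del: distrib_left_numeral\<close>)
qed

lemma weight_product:
  assumes "z \<in> unit_disc"
  shows "outer_weight z * inner_weight z = 1 / (4 * (1 + z)\<^sup>2)"
proof -
  note nz = unit_disc_nz[OF assms]
  have sn: "csqrt (1 - z) \<noteq> 0" using nz by simp
  moreover have "c / (2 * u) * (1 / (2 * u * c)) = 1 / (4 * u\<^sup>2)"
    if "u \<noteq> 0" "c \<noteq> 0" for u c :: complex
    using that by (simp add: power2_eq_square)
  ultimately show ?thesis using nz unfolding outer_weight_def inner_weight_def by blast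
qed

text \<open>\<open>P\<close> vanishes at the origin, so \<open>P(z) / z\<close> extends holomorphically and the second integration can start on the
axis.\<close>

lemma ex_radial_solution:
  assumes g: "g holomorphic_on unit_disc"
  shows "\<exists>G. G holomorphic_on unit_disc \<and> G 0 = 0 \<and>
     (\<exists>P. P 0 = 0 \<and> (\<forall>z\<in>unit_disc. (P has_field_derivative inner_weight z * g z) (at z)) \<and>
          (\<forall>z\<in>unit_disc. z * deriv G z = outer_weight z * P z))"
proof -
  have h: "(\<lambda>z. inner_weight z * g z) holomorphic_on unit_disc"
    by (intro holomorphic_intros inner_weight_holomorphic g)
  obtain P0 where "\<And>z. z \<in> unit_disc \<Longrightarrow>
      (P0 has_field_derivative inner_weight z * g z) (at z within unit_disc)"
    using holomorphic_convex_primitive'[OF convex_ball open_ball h] by blast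
  then have P0: "(P0 has_field_derivative inner_weight z * g z) (at z)" if "z \<in> unit_disc" for z
    using that at_within_open[OF that open_ball] by metis
  define P where "P z = P0 z - P0 0" for z
  have P: "(P has_field_derivative inner_weight z * g z) (at z)" if "z \<in> unit_disc" for z
    unfolding P_def using P0[OF that] by (auto intro!: derivative_eq_intros)
  have holP: "P holomorphic_on unit_disc"
    by (rule holomorphic_on_unit_discI, rule P)
  define Q where "Q z = (if z = 0 then deriv P 0 else (P z - P 0) / (z - 0))" for z
  have holQ: "Q holomorphic_on unit_disc"
    unfolding Q_def by (rule pole_lemma_open[OF holP open_ball])
  have hol: "(\<lambda>z. outer_weight z * Q z) holomorphic_on unit_disc"
    by (intro holomorphic_intros outer_weight_holomorphic holQ)
  obtain G0 where "\<And>z. z \<in> unit_disc \<Longrightarrow>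
      (G0 has_field_derivative outer_weight z * Q z) (at z within unit_disc)"
    using holomorphic_convex_primitive'[OF convex_ball open_ball hol] by blast
  then have G0: "(G0 has_field_derivative outer_weight z * Q z) (at z)" if "z \<in> unit_disc" for z
    using that at_within_open[OF that open_ball] by metis
  define G where "G z = G0 z - G0 0" for z
  have G: "(G has_field_derivative outer_weight z * Q z) (at z)" if "z \<in> unit_disc" for z
    unfolding G_def using G0[OF that] by (auto intro!: derivative_eq_intros)
  have "z * deriv G z = outer_weight z * P z" if "z \<in> unit_disc" for z
    using DERIV_imp_deriv[OF G[OF that]] by (simp add: Q_def P_def)
  moreover have "G holomorphic_on unit_disc" by (rule holomorphic_on_unit_discI, rule G)
  ultimately show ?thesis using P by (intro exI[of _ G] conjI exI[of _ P]) (auto simp: G_def P_def)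
qed

definition radial_solution :: "(complex \<Rightarrow> complex) \<Rightarrow> complex \<Rightarrow> complex" where
  "radial_solution g = (SOME G. G holomorphic_on unit_disc \<and> G 0 = 0 \<and>
     (\<exists>P. P 0 = 0 \<and> (\<forall>z\<in>unit_disc. (P has_field_derivative inner_weight z * g z) (at z)) \<and>
          (\<forall>z\<in>unit_disc. z * deriv G z = outer_weight z * P z)))"

lemma radial_solution:
  assumes "g holomorphic_on unit_disc"
  shows "radial_solution g holomorphic_on unit_disc" "radial_solution g 0 = 0"
    "\<exists>P. P 0 = 0 \<and> (\<forall>z\<in>unit_disc. (P has_field_derivative inner_weight z * g z) (at z)) \<and>
          (\<forall>z\<in>unit_disc. z * deriv (radial_solution g) z = outer_weight z * P z)"
  using someI_ex[OF ex_radial_solution[OF assms]] unfolding radial_solution_def by blast+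

lemma radial_solution_ode:
  assumes "g holomorphic_on unit_disc" "z \<in> unit_disc"
  defines "G \<equiv> radial_solution g"
  shows "z * deriv (deriv G) z + deriv G z + z * deriv G z * (1 / (2 * (1 - z)) + 1 / (1 + z))
           = g z / (4 * (1 + z)\<^sup>2)"
proof -
  obtain P where P: "\<And>z. z \<in> unit_disc \<Longrightarrow> (P has_field_derivative inner_weight z * g z) (at z)"
    and e: "\<And>z. z \<in> unit_disc \<Longrightarrow> z * deriv G z = outer_weight z * P z"
    using radial_solution(3)[OF assms(1)] unfolding G_def by blast
  have holG: "G holomorphic_on unit_disc" unfolding G_def by (rule radial_solution(1)[OF assms(1)])
  have dG: "(deriv G has_field_derivative deriv (deriv G) z) (at z)"
    using holomorphic_derivI[OF holomorphic_deriv[OF holG open_ball] open_ball assms(2)] .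
  have 1: "((\<lambda>z. z * deriv G z) has_field_derivative deriv G z + z * deriv (deriv G) z) (at z)"
    by (rule derivative_eq_intros dG refl | simp)+
  have "((\<lambda>z. outer_weight z * P z) has_field_derivative
     outer_weight z * (- 1 / (2 * (1 - z)) - 1 / (1 + z)) * P z + inner_weight z * g z * outer_weight z) (at z)"
    by (rule DERIV_mult outer_weight_deriv P assms(2))+
  then have "((\<lambda>z. z * deriv G z) has_field_derivative
     outer_weight z * (- 1 / (2 * (1 - z)) - 1 / (1 + z)) * P z + inner_weight z * g z * outer_weight z) (at z)"
    by (rule has_field_derivative_transform_within_open[OF _ open_ball assms(2)]) (simp add: e)
  from DERIV_unique[OF 1 this]
  have "deriv G z + z * deriv (deriv G) z =
     (- 1 / (2 * (1 - z)) - 1 / (1 + z)) * (outer_weight z * P z) + (outer_weight z * inner_weight z) * g z"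
    by (simp add: mult_ac)
  then show ?thesis
    unfolding e[OF assms(2), symmetric] weight_product[OF assms(2)] by (simp add: algebra_simps)
qed

lemma ray_integral_bound:
  fixes P :: "complex \<Rightarrow> complex"
  assumes d: "\<And>x. 0 \<le> x \<Longrightarrow> x \<le> 1 \<Longrightarrow>
      (P has_field_derivative P' (of_real x * z)) (at (of_real x * z))"
    and b: "\<And>x. 0 < x \<Longrightarrow> x < 1 \<Longrightarrow> norm (w * (z * P' (of_real x * z))) \<le> B * x ^ n"
  shows "norm (w * (P z - P 0)) \<le> B / real (Suc n)"
proof -
  have v: "((\<lambda>x. w * P (of_real x * z)) has_vector_derivative w * (z * P' (of_real x * z))) (at x within A)"
    if "0 \<le> x" "x \<le> 1" for x A
  proof -
    have 1: "((\<lambda>x. complex_of_real x * z) has_vector_derivative z) (at x within A)"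
      by (auto intro!: derivative_eq_intros simp: has_vector_derivative_def scaleR_conv_of_real)
    have "((P \<circ> (\<lambda>x. complex_of_real x * z)) has_vector_derivative z * P' (of_real x * z)) (at x within A)"
      using field_vector_diff_chain_within[OF 1] d[OF that] has_field_derivative_at_within by blast
    then show ?thesis unfolding o_def by (auto intro!: derivative_eq_intros)
  qed
  have p: "((\<lambda>x. B * x ^ Suc n / real (Suc n)) has_vector_derivative B * x ^ n) (at x)" for x :: real
    unfolding has_real_derivative_iff_has_vector_derivative[symmetric]
    by (rule derivative_eq_intros refl | simp)+
  have "norm (w * P (of_real 1 * z) - w * P (of_real 0 * z))
      \<le> B * 1 ^ Suc n / real (Suc n) - B * 0 ^ Suc n / real (Suc n)"
  proof (rule differentiable_bound_general[OF zero_less_one])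
    show "continuous_on {0..1} (\<lambda>x. w * P (complex_of_real x * z))"
      by (rule continuous_on_vector_derivative) (use v in auto)
    show "continuous_on {0..1} (\<lambda>x. B * x ^ Suc n / real (Suc n))"
      by (intro continuous_intros) auto
  qed (use v p b in auto)
  then show ?thesis by (simp add: algebra_simps)
qed

text \<open>The estimate gains a factor \<open>(n + 1)\<^sup>2\<close> because the solution is a double integral
  along the ray from the origin.\<close>

lemma radial_solution_bound:
  assumes g: "g holomorphic_on unit_disc"
    and S: "S \<subseteq> unit_disc" "\<And>z x. z \<in> S \<Longrightarrow> 0 \<le> x \<Longrightarrow> x \<le> 1 \<Longrightarrow> of_real x * z \<in> S"
    and C: "\<And>z x. z \<in> S \<Longrightarrow> 0 \<le> x \<Longrightarrow> x \<le> 1 \<Longrightarrow>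
              norm (outer_weight z * inner_weight (of_real x * z)) \<le> C"
    and K: "\<And>z. z \<in> S \<Longrightarrow> norm (g z) \<le> K * norm z ^ n"
    and z: "z \<in> S"
  shows "z \<noteq> 0 \<Longrightarrow> norm (deriv (radial_solution g) z) \<le> C * K * norm z ^ n / Suc n"
    and "norm (radial_solution g z) \<le> C * K * norm z ^ Suc n / (real (Suc n))\<^sup>2"
proof -
  let ?G = "radial_solution g"
  have C0: "C \<ge> 0" using C[OF z, of 0] norm_ge_zero by (smt (verit))
  obtain P where P0: "P 0 = 0"
    and P: "\<And>z. z \<in> unit_disc \<Longrightarrow> (P has_field_derivative inner_weight z * g z) (at z)"
    and e: "\<And>z. z \<in> unit_disc \<Longrightarrow> z * deriv ?G z = outer_weight z * P z"
    using radial_solution(3)[OF g] by blast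
  have holG: "?G holomorphic_on unit_disc" by (rule radial_solution(1)[OF g])
  have dG: "norm (deriv ?G z) \<le> C * K * norm z ^ n / Suc n" if z: "z \<in> S" "z \<noteq> 0" for z
  proof -
    have "norm (outer_weight z * (P z - P 0)) \<le> (C * K * norm z ^ Suc n) / real (Suc n)"
    proof (rule ray_integral_bound)
      fix x :: real assume "0 \<le> x" "x \<le> 1"
      then have "of_real x * z \<in> unit_disc" using S z by blast
      then show "(P has_field_derivative inner_weight (of_real x * z) * g (of_real x * z))
          (at (of_real x * z))" by (rule P)
    next
      fix x :: real assume x: "0 < x" "x < 1"
      have "norm (outer_weight z * (z * (inner_weight (of_real x * z) * g (of_real x * z))))
         = norm (outer_weight z * inner_weight (of_real x * z)) * (norm z * norm (g (of_real x * z)))"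
        by (simp add: norm_mult)
      also have "\<dots> \<le> C * (norm z * (K * norm (of_real x * z) ^ n))"
        using x z by (intro mult_mono C K S mult_left_mono C0) auto
      also have "\<dots> = C * K * norm z ^ Suc n * x ^ n"
        using x by (simp add: norm_mult power_mult_distrib)
      finally show "norm (outer_weight z * (z * (inner_weight (of_real x * z) * g (of_real x * z))))
         \<le> C * K * norm z ^ Suc n * x ^ n" .
    qed
    then have "norm (z * deriv ?G z) \<le> (C * K * norm z ^ Suc n) / real (Suc n)"
      using e S z P0 by auto
    then have "norm z * norm (deriv ?G z) \<le> norm z * (C * K * norm z ^ n / real (Suc n))"
      by (simp add: norm_mult mult_ac)
    then show ?thesis by (rule mult_left_le_imp_le) (use z in simp)
  qed
  then show "z \<noteq> 0 \<Longrightarrow> norm (deriv ?G z) \<le> C * K * norm z ^ n / Suc n" using z by blast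
  show "norm (?G z) \<le> C * K * norm z ^ Suc n / (real (Suc n))\<^sup>2"
  proof (cases "z = 0")
    case True
    then show ?thesis using radial_solution(2)[OF g] by simp
  next
    case False
    have "norm (1 * (?G z - ?G 0)) \<le> (C * K * norm z ^ Suc n / Suc n) / real (Suc n)"
    proof (rule ray_integral_bound)
      fix x :: real assume "0 \<le> x" "x \<le> 1"
      then have "of_real x * z \<in> unit_disc" using S z by blast
      then show "(?G has_field_derivative deriv ?G (of_real x * z)) (at (of_real x * z))"
        using holomorphic_derivI[OF holG open_ball] by blast
    next
      fix x :: real assume x: "0 < x" "x < 1"
      then have "of_real x * z \<in> S" "of_real x * z \<noteq> 0" using S z False by auto
      from dG[OF this] have "norm (deriv ?G (of_real x * z)) \<le> C * K * (x ^ n * norm z ^ n) / Suc n"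
        using x by (simp add: norm_mult power_mult_distrib)
      then have "norm z * norm (deriv ?G (of_real x * z)) \<le> norm z * (C * K * (x ^ n * norm z ^ n) / Suc n)"
        by (intro mult_left_mono) auto
      then show "norm (1 * (z * deriv ?G (of_real x * z))) \<le> C * K * norm z ^ Suc n / Suc n * x ^ n"
        by (simp add: norm_mult mult_ac)
    qed
    then show ?thesis using radial_solution(2)[OF g] by (simp add: power2_eq_square del: of_nat_Suc)
  qed
qed

fun radial_fun :: "nat \<Rightarrow> complex \<Rightarrow> complex" where
  "radial_fun 0 = (\<lambda>_. 1)"
| "radial_fun (Suc n) = radial_solution (radial_fun n)"

lemma radial_fun_holomorphic: "radial_fun n holomorphic_on unit_disc"
  by (induction n) (auto intro: radial_solution)

lemma radial_fun_bound:
  assumes S: "S \<subseteq> unit_disc" "\<And>z x. z \<in> S \<Longrightarrow> 0 \<le> x \<Longrightarrow> x \<le> 1 \<Longrightarrow> of_real x * z \<in> S"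
    and C: "\<And>z x. z \<in> S \<Longrightarrow> 0 \<le> x \<Longrightarrow> x \<le> 1 \<Longrightarrow>
              norm (outer_weight z * inner_weight (of_real x * z)) \<le> C"
    and z: "z \<in> S"
  shows "norm (radial_fun n z) \<le> C ^ n / (fact n)\<^sup>2 * norm z ^ n"
  using z
proof (induction n arbitrary: z)
  case (Suc n)
  have "norm (radial_fun (Suc n) z) \<le> C * (C ^ n / (fact n)\<^sup>2) * norm z ^ Suc n / (real (Suc n))\<^sup>2"
    unfolding radial_fun.simps
    by (rule radial_solution_bound(2)[OF radial_fun_holomorphic S C Suc.IH Suc.prems]) auto
  also have "\<dots> = C ^ Suc n / (fact (Suc n))\<^sup>2 * norm z ^ Suc n"
  proof -
    have "(fact (Suc n))\<^sup>2 = (real (Suc n))\<^sup>2 * (fact n)\<^sup>2"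
      by (simp add: power_mult_distrib[symmetric])
    then show ?thesis
      by (simp add: field_simps del: of_nat_Suc fact_Suc)
  qed
  finally show ?case .
qed simp

lemma radial_fun_deriv_bound:
  assumes S: "S \<subseteq> unit_disc" "\<And>z x. z \<in> S \<Longrightarrow> 0 \<le> x \<Longrightarrow> x \<le> 1 \<Longrightarrow> of_real x * z \<in> S"
    and C: "\<And>z x. z \<in> S \<Longrightarrow> 0 \<le> x \<Longrightarrow> x \<le> 1 \<Longrightarrow>
              norm (outer_weight z * inner_weight (of_real x * z)) \<le> C"
    and z: "z \<in> S" "z \<noteq> 0"
  shows "norm (deriv (radial_fun (Suc n)) z) \<le> C ^ Suc n * Suc n / (fact (Suc n))\<^sup>2"
proof -
  have C0: "C \<ge> 0" using C[OF z(1), of 0] norm_ge_zero by (smt (verit))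
  have "norm (deriv (radial_fun (Suc n)) z) \<le> C * (C ^ n / (fact n)\<^sup>2) * norm z ^ n / Suc n"
    unfolding radial_fun.simps
    by (rule radial_solution_bound(1)[OF radial_fun_holomorphic S C radial_fun_bound z(1) z(2)])
       (use S C in auto)
  also have "\<dots> \<le> C * (C ^ n / (fact n)\<^sup>2) * 1 / Suc n"
    using S(1) z C0 by (intro divide_right_mono mult_left_mono power_le_one) (auto simp: subset_iff)
  also have "\<dots> = C ^ Suc n * Suc n / (fact (Suc n))\<^sup>2"
  proof -
    have "fact (Suc n) = real (Suc n) * fact n" by simp
    then show ?thesis
      by (simp add: power_mult_distrib field_simps power2_eq_square del: of_nat_Suc fact_Suc)
  qed
  finally show ?thesis .
qed

lemma DERIV_Re_of_real:
  assumes "(f has_field_derivative f') (at (complex_of_real x))"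
  shows "((\<lambda>x. Re (f (of_real x))) has_field_derivative Re f') (at x)"
proof -
  have 1: "(complex_of_real has_vector_derivative 1) (at x)"
    using has_vector_derivative_of_real[of "\<lambda>x. x" 1 "at x"]
    by (simp add: has_vector_derivative_def has_derivative_of_real)
  have "((f \<circ> complex_of_real) has_vector_derivative f') (at x)"
    using field_vector_diff_chain_at[OF 1 assms] by simp
  then have "((\<lambda>x. Re ((f \<circ> complex_of_real) x)) has_vector_derivative Re f') (at x)"
    by (rule bounded_linear.has_vector_derivative[OF bounded_linear_Re])
  then show ?thesis by (simp add: has_real_derivative_iff_has_vector_derivative o_def)
qed

definition radial_deriv :: "nat \<Rightarrow> nat \<Rightarrow> real \<Rightarrow> real" where
  "radial_deriv n k x = Re ((deriv ^^ k) (radial_fun n) (of_real x))"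

lemma radial_deriv_DERIV:
  assumes "\<bar>x\<bar> < 1"
  shows "(radial_deriv n k has_field_derivative radial_deriv n (Suc k) x) (at x)"
proof -
  have "of_real x \<in> unit_disc" using assms by simp
  from DERIV_Re_of_real[OF has_field_derivative_higher_deriv[OF radial_fun_holomorphic open_ball this]]
  show ?thesis unfolding radial_deriv_def[abs_def] .
qed

lemma radial_deriv_0:
  "radial_deriv 0 0 x = 1" "\<bar>x\<bar> < 1 \<Longrightarrow> radial_deriv 0 (Suc k) x = 0" "radial_deriv (Suc n) 0 0 = 0"
proof -
  show "radial_deriv 0 0 x = 1" by (simp add: radial_deriv_def)
  have "(deriv ^^ Suc k) (\<lambda>_::complex. 1) = (\<lambda>_. 0)"
    by (induction k) auto
  then show "radial_deriv 0 (Suc k) x = 0" by (simp add: radial_deriv_def del: funpow.simps)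
  show "radial_deriv (Suc n) 0 0 = 0"
    using radial_solution(2)[OF radial_fun_holomorphic] by (simp add: radial_deriv_def)
qed

lemma Re_mult_of_real: "Re (complex_of_real a * z) = a * Re z"
  by simp

lemma radial_deriv_ode:
  assumes x: "\<bar>x\<bar> < 1"
  shows "x * radial_deriv (Suc n) 2 x + radial_deriv (Suc n) 1 x
           + x * radial_deriv (Suc n) 1 x * (1 / (2 * (1 - x)) + 1 / (1 + x))
         = radial_deriv n 0 x / (4 * (1 + x)\<^sup>2)"
proof -
  have "complex_of_real x \<in> unit_disc" using x by simp
  from radial_solution_ode[OF radial_fun_holomorphic this, of n]
  have "Re (of_real x * deriv (deriv (radial_fun (Suc n))) (of_real x) + deriv (radial_fun (Suc n)) (of_real x)
      + of_real (x * (1 / (2 * (1 - x)) + 1 / (1 + x))) * deriv (radial_fun (Suc n)) (of_real x))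
     = Re (of_real (1 / (4 * (1 + x)\<^sup>2)) * radial_fun n (of_real x))"
    by (simp add: mult_ac)
  then show ?thesis
    unfolding radial_deriv_def plus_complex.sel Re_mult_of_real numeral_2_eq_2
    by (simp add: mult_ac)
qed

lemma of_real_mult_in_ball:
  assumes "norm z \<le> R" "0 \<le> x" "x \<le> 1"
  shows "norm (of_real x * z :: complex) \<le> R"
proof -
  have "x * norm z \<le> 1 * norm z" using assms by (intro mult_right_mono) auto
  then show ?thesis using assms by (simp add: norm_mult)
qed

lemma weight_bound_disc:
  assumes "R < 1" and z: "norm z \<le> R" "0 \<le> x" "x \<le> 1"
  shows "norm (outer_weight z * inner_weight (of_real x * z)) \<le> 1 / ((1 - R) ^ 3)"
proof -
  let ?w = "of_real x * z"
  have R0: "R \<ge> 0" using z norm_ge_zero[of z] by linarith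
  have w: "norm ?w \<le> R" by (rule of_real_mult_in_ball[OF z])
  have b: "norm (1 + u) \<ge> 1 - R" "norm (1 - u) \<ge> 1 - R" "norm (1 - u) \<le> 2" if "norm u \<le> R" for u :: complex
    using norm_triangle_ineq2[of 1 "-u"] norm_triangle_ineq2[of 1 u] norm_triangle_ineq4[of 1 u] that assms(1) by auto
  have e: "norm (outer_weight z * inner_weight ?w)
     = sqrt (norm (1 - z)) / (4 * norm (1 + z) * norm (1 + ?w) * sqrt (norm (1 - ?w)))"
    by (simp add: outer_weight_def inner_weight_def norm_mult norm_divide norm_csqrt del: distrib_left_numeral)
  have "sqrt (norm (1 - z)) \<le> 2" using b(3)[OF z(1)] real_sqrt_le_mono[of "norm (1 - z)" 4] by simp
  moreover have "sqrt (norm (1 - ?w)) \<ge> 1 - R"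
  proof -
    have "(1 - R)\<^sup>2 \<le> 1 - R" using assms(1) R0 by (simp add: power2_eq_square mult_left_le)
    then show ?thesis using b(2)[OF w] assms(1) by (intro real_le_rsqrt) auto
  qed
  moreover have "4 * norm (1 + z) * norm (1 + ?w) * sqrt (norm (1 - ?w)) \<ge> 4 * (1 - R) * (1 - R) * (1 - R)"
    using b[OF w] b[OF z(1)] calculation(2) assms(1) by (intro mult_mono) auto
  ultimately have "norm (outer_weight z * inner_weight ?w) \<le> 2 / (4 * (1 - R) * (1 - R) * (1 - R))"
    unfolding e using assms(1) by (intro frac_le) auto
  also have "\<dots> \<le> 1 / (1 - R) ^ 3" using assms(1) by (simp add: power3_eq_cube divide_simps)
  finally show ?thesis .
qed

text \<open>The factor \<open>1 / \<surd>(1 - x)\<close> in the inner weight blows up at the boundary, but it is evaluated at a point below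
the one where the outer weight has the reciprocal factor.\<close>

lemma weight_bound_real:
  assumes z: "0 \<le> r" "r < 1" "0 \<le> x" "x \<le> 1"
  shows "norm (outer_weight (of_real r) * inner_weight (of_real x * of_real r)) \<le> 1"
proof -
  have xr: "x * r \<le> r" "0 \<le> x * r" using z by (auto simp: mult_left_le_one_le)
  have n: "norm (1 - complex_of_real u) = 1 - u" "norm (1 + complex_of_real u) = 1 + u" if "0 \<le> u" "u < 1" for u
    using that norm_of_real[of "1 - u", where 'a=complex] norm_of_real[of "1 + u", where 'a=complex]
    by (simp_all del: norm_of_real)
  have "norm (outer_weight (of_real r) * inner_weight (of_real x * of_real r))
     = sqrt (1 - r) / (4 * (1 + r) * (1 + x * r) * sqrt (1 - x * r))"
    using n[of r] n[of "x * r"] z xr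
    by (simp add: outer_weight_def inner_weight_def norm_mult norm_divide norm_csqrt del: distrib_left_numeral)
  also have "\<dots> \<le> sqrt (1 - x * r) / (1 * sqrt (1 - x * r))"
    using z xr mult_mono[of 1 "4 * (1 + r)" 1 "1 + x * r"]
    by (intro frac_le mult_right_mono) auto
  also have "\<dots> = 1" using z xr by simp
  finally show ?thesis .
qed

lemma radial_deriv_bound_disc:
  assumes "0 \<le> R" "R < 1"
  shows "\<exists>A C. 0 \<le> A \<and> 1 \<le> C \<and> (\<forall>n x. \<bar>x\<bar> \<le> R \<longrightarrow> \<bar>radial_deriv n k x\<bar> \<le> A * C ^ n / (fact n)\<^sup>2)"
proof -
  define R1 where "R1 = (1 + R) / 2"
  have R1: "R < R1" "R1 < 1" using assms by (auto simp: R1_def)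
  define C where "C = 1 / (1 - R1) ^ 3"
  have "(1 - R1) ^ 3 \<le> 1" using R1 assms by (intro power_le_one) auto
  then have C1: "C \<ge> 1" using R1 by (simp add: C_def)
  have *: "norm (radial_fun n z) \<le> C ^ n / (fact n)\<^sup>2" if "norm z \<le> R1" for n z
  proof -
    have "norm (radial_fun n z) \<le> C ^ n / (fact n)\<^sup>2 * norm z ^ n"
      by (rule radial_fun_bound[of "cball 0 R1"])
         (use R1 that of_real_mult_in_ball weight_bound_disc[OF R1(2)] in \<open>auto simp: C_def\<close>)
    also have "\<dots> \<le> C ^ n / (fact n)\<^sup>2 * 1"
      using C1 that R1 by (intro mult_left_mono power_le_one) auto
    finally show ?thesis by simp
  qed
  have "\<bar>radial_deriv n k x\<bar> \<le> (fact k / (R1 - R) ^ k) * C ^ n / (fact n)\<^sup>2" if x: "\<bar>x\<bar> \<le> R" for n x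
  proof -
    have sub: "cball (of_real x) (R1 - R) \<subseteq> cball (0::complex) R1"
      using x by (subst cball_subset_cball_iff) auto
    then have sub1: "cball (complex_of_real x) (R1 - R) \<subseteq> unit_disc" using R1 by auto
    have hol: "radial_fun n holomorphic_on cball (of_real x) (R1 - R)"
      by (rule holomorphic_on_subset[OF radial_fun_holomorphic sub1])
    have "norm ((deriv ^^ k) (radial_fun n) (of_real x)) \<le> fact k * (C ^ n / (fact n)\<^sup>2) / (R1 - R) ^ k"
    proof (rule Cauchy_inequality)
      show "radial_fun n holomorphic_on ball (of_real x) (R1 - R)"
        using hol ball_subset_cball holomorphic_on_subset by blast
      show "continuous_on (cball (of_real x) (R1 - R)) (radial_fun n)"
        using hol by (rule holomorphic_on_imp_continuous_on)
      fix y :: complex assume "norm (of_real x - y) = R1 - R"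
      then have "y \<in> cball (of_real x) (R1 - R)" by (simp add: dist_norm)
      then have "norm y \<le> R1" using sub by auto
      then show "norm (radial_fun n y) \<le> C ^ n / (fact n)\<^sup>2" by (rule *)
    qed (use R1 in auto)
    then show ?thesis unfolding radial_deriv_def
      using abs_Re_le_cmod[of "(deriv ^^ k) (radial_fun n) (of_real x)"] by (simp add: mult_ac)
  qed
  then show ?thesis using C1 R1 by (intro exI[of _ "fact k / (R1 - R) ^ k"] exI[of _ C]) auto
qed

lemma nat_square_le_power4: "(real n)\<^sup>2 \<le> 4 ^ n"
proof -
  have "real n \<le> 2 ^ n" by (simp add: less_imp_le of_nat_less_two_power)
  then have "(real n)\<^sup>2 \<le> (2 ^ n)\<^sup>2" by (intro power_mono) auto
  also have "\<dots> = (4::real) ^ n" by (simp flip: power_mult power_mult_distrib add: power2_eq_square)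
  finally show ?thesis .
qed

text \<open>For the second derivative the differential equation is multiplied by \<open>1 - x\<close>, which removes its singular
coefficient; division by \<open>x\<close> is harmless away from the axis.\<close>

lemma radial_deriv_bound_real:
  assumes x: "0 < x" "x < 1"
  shows "\<bar>radial_deriv n 0 x\<bar> \<le> 4 ^ n / (fact n)\<^sup>2" "\<bar>radial_deriv n 1 x\<bar> \<le> 4 ^ n / (fact n)\<^sup>2"
    "1/2 \<le> x \<Longrightarrow> (1 - x) * \<bar>radial_deriv n 2 x\<bar> \<le> 6 * 4 ^ n / (fact n)\<^sup>2"
proof -
  let ?S = "complex_of_real ` {0..<1}"
  have S: "?S \<subseteq> unit_disc" by auto
  have S2: "of_real y * z \<in> ?S" if "z \<in> ?S" "0 \<le> y" "y \<le> 1" for z :: complex and y :: real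
  proof -
    from that(1) obtain r where "z = of_real r" "r \<in> {0..<1}" by (rule imageE)
    then have r: "z = of_real r" "0 \<le> r" "r < 1" by auto
    have "y * r \<le> 1 * r" using r that by (intro mult_right_mono) auto
    then show ?thesis using r that by (intro image_eqI[of _ _ "y * r"]) auto
  qed
  have C: "norm (outer_weight z * inner_weight (of_real y * z)) \<le> 1" if "z \<in> ?S" "0 \<le> y" "y \<le> 1" for z :: complex and y :: real
    using weight_bound_real that by auto
  have xS: "complex_of_real x \<in> ?S" using x by auto
  have b0: "\<bar>radial_deriv n 0 x\<bar> \<le> 1 / (fact n)\<^sup>2" for n
  proof -
    have "norm (radial_fun n (of_real x)) \<le> 1 ^ n / (fact n)\<^sup>2 * norm (complex_of_real x) ^ n"
      by (rule radial_fun_bound[OF S S2 C xS])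
    also have "\<dots> \<le> 1 / (fact n)\<^sup>2 * 1"
      using x by (simp add: divide_right_mono power_le_one)
    finally show ?thesis unfolding radial_deriv_def
      using abs_Re_le_cmod[of "radial_fun n (of_real x)"] by simp
  qed
  have b1: "\<bar>radial_deriv (Suc m) 1 x\<bar> \<le> real (Suc m) / (fact (Suc m))\<^sup>2" for m
  proof -
    have "norm (deriv (radial_fun (Suc m)) (of_real x)) \<le> 1 ^ Suc m * real (Suc m) / (fact (Suc m))\<^sup>2"
      by (rule radial_fun_deriv_bound[OF S S2 C xS]) (use x in auto)
    then show ?thesis unfolding radial_deriv_def
      using abs_Re_le_cmod[of "deriv (radial_fun (Suc m)) (of_real x)"]
      by (simp del: radial_fun.simps fact_Suc of_nat_Suc)
  qed
  have le4: "1 / (fact n)\<^sup>2 \<le> 4 ^ n / (fact n :: real)\<^sup>2" for n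
    by (intro divide_right_mono) auto
  show "\<bar>radial_deriv n 0 x\<bar> \<le> 4 ^ n / (fact n)\<^sup>2" using b0[of n] le4[of n] by linarith
  have n4: "real (Suc m) \<le> (real (Suc m))\<^sup>2" for m by (simp add: power2_eq_square)
  have b1': "\<bar>radial_deriv n 1 x\<bar> \<le> 4 ^ n / (fact n)\<^sup>2" for n
  proof (cases n)
    case 0
    then show ?thesis using radial_deriv_0(2)[of x 0] x by simp
  next
    case (Suc m)
    have "real (Suc m) / (fact (Suc m))\<^sup>2 \<le> 4 ^ Suc m / (fact (Suc m))\<^sup>2"
      using nat_square_le_power4[of "Suc m"] n4[of m] by (intro divide_right_mono) auto
    then show ?thesis using b1[of m] Suc by simp
  qed
  then show "\<bar>radial_deriv n 1 x\<bar> \<le> 4 ^ n / (fact n)\<^sup>2" .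
  assume half: "1/2 \<le> x"
  show "(1 - x) * \<bar>radial_deriv n 2 x\<bar> \<le> 6 * 4 ^ n / (fact n)\<^sup>2"
  proof (cases n)
    case 0
    then show ?thesis using radial_deriv_0(2)[of x 1] x by (simp add: numeral_2_eq_2)
  next
    case (Suc m)
    define f0 f1 f2 where "f0 = radial_deriv m 0 x" and "f1 = radial_deriv (Suc m) 1 x"
      and "f2 = radial_deriv (Suc m) 2 x"
    have ode: "x * f2 + f1 + x * f1 * (1 / (2 * (1 - x)) + 1 / (1 + x)) = f0 / (4 * (1 + x)\<^sup>2)"
      using radial_deriv_ode[of x m] x by (simp add: f0_def f1_def f2_def)
    have "(1 - x) * (x * f2) = (1 - x) * (f0 / (4 * (1 + x)\<^sup>2) - f1 - x * f1 * (1 / (2 * (1 - x)) + 1 / (1 + x)))"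
      using ode by simp
    also have "\<dots> = f0 * ((1 - x) / (4 * (1 + x)\<^sup>2)) - f1 * ((1 - x) + x / 2 + x * (1 - x) / (1 + x))"
    proof -
      have "(1 - x) * (x * f1 * (1 / (2 * (1 - x)) + 1 / (1 + x))) = f1 * (x / 2 + x * (1 - x) / (1 + x))"
        using x by (simp add: divide_simps) (simp add: algebra_simps)
      moreover have "(1 - x) * (f0 / k - f1 - B) = f0 * ((1 - x) / k) - f1 * ((1 - x) + r + s)"
        if "(1 - x) * B = f1 * (r + s)" for B r s k
      proof -
        have "f0 * ((1 - x) / k) = (1 - x) * (f0 / k)" by simp
        then show ?thesis using that by algebra
      qed
      ultimately show ?thesis by blast
    qed
    finally have e: "(1 - x) * (x * f2) = f0 * ((1 - x) / (4 * (1 + x)\<^sup>2)) - f1 * ((1 - x) + x / 2 + x * (1 - x) / (1 + x))" .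
    have c1: "0 \<le> (1 - x) / (4 * (1 + x)\<^sup>2)" "(1 - x) / (4 * (1 + x)\<^sup>2) \<le> 1"
    proof -
      have "1 \<le> (1 + x)\<^sup>2" using x by (simp add: power2_eq_square algebra_simps)
      then have "1 - x \<le> 4 * (1 + x)\<^sup>2" "0 < 4 * (1 + x)\<^sup>2" using x by linarith+
      then show "(1 - x) / (4 * (1 + x)\<^sup>2) \<le> 1" by (simp only: pos_divide_le_eq mult_1_left)
    qed (use x in auto)
    have c2: "0 \<le> (1 - x) + x / 2 + x * (1 - x) / (1 + x)" "(1 - x) + x / 2 + x * (1 - x) / (1 + x) \<le> 2"
    proof -
      have "x * (1 - x) / (1 + x) \<le> 1" using x by (simp add: divide_simps algebra_simps)
      then show "(1 - x) + x / 2 + x * (1 - x) / (1 + x) \<le> 2" using x by linarith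
    qed (use x in auto)
    have "(1 - x) * \<bar>f2\<bar> * x = \<bar>(1 - x) * (x * f2)\<bar>" using x by (simp add: abs_mult)
    also have "\<dots> \<le> \<bar>f0\<bar> * 1 + \<bar>f1\<bar> * 2" unfolding e
    proof (rule order_trans[OF abs_triangle_ineq4 add_mono])
      show "\<bar>f0 * ((1 - x) / (4 * (1 + x)\<^sup>2))\<bar> \<le> \<bar>f0\<bar> * 1"
        unfolding abs_mult using c1 by (intro mult_left_mono) auto
      show "\<bar>f1 * ((1 - x) + x / 2 + x * (1 - x) / (1 + x))\<bar> \<le> \<bar>f1\<bar> * 2"
        unfolding abs_mult using c2 by (intro mult_left_mono) auto
    qed
    also have "\<bar>f0\<bar> \<le> 4 ^ n / (fact n)\<^sup>2"
    proof -
      have "\<bar>f0\<bar> \<le> 1 / (fact m)\<^sup>2" unfolding f0_def by (rule b0)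
      also have "\<dots> = (real n)\<^sup>2 / (fact n)\<^sup>2"
        using Suc by (simp add: power_mult_distrib del: of_nat_Suc)
      also have "\<dots> \<le> 4 ^ n / (fact n)\<^sup>2" by (intro divide_right_mono nat_square_le_power4) auto
      finally show ?thesis .
    qed
    also have "\<bar>f1\<bar> \<le> 4 ^ n / (fact n)\<^sup>2" unfolding f1_def using b1'[of n] Suc by simp
    finally have "(1 - x) * \<bar>f2\<bar> * x \<le> 3 * (4 ^ n / (fact n)\<^sup>2)" by simp
    moreover have "(1 - x) * \<bar>f2\<bar> * (1/2) \<le> (1 - x) * \<bar>f2\<bar> * x"
      using x half by (intro mult_left_mono) auto
    ultimately show ?thesis using Suc by (simp add: f2_def)
  qed
qed

text \<open>Up to \<open>x = 1/2\<close> by Cauchy's inequality on a disc, beyond it by the estimates on the real segment.\<close>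

lemma radial_deriv_bound:
  "\<exists>A C. 0 \<le> A \<and> 1 \<le> C \<and> (\<forall>n x. 0 \<le> x \<and> x < 1 \<longrightarrow>
     \<bar>radial_deriv n 0 x\<bar> \<le> A * C ^ n / (fact n)\<^sup>2 \<and> \<bar>radial_deriv n 1 x\<bar> \<le> A * C ^ n / (fact n)\<^sup>2 \<and>
     \<bar>(1 - x) * radial_deriv n 2 x\<bar> \<le> A * C ^ n / (fact n)\<^sup>2)"
proof -
  have "\<forall>k. \<exists>A C. 0 \<le> A \<and> 1 \<le> C \<and> (\<forall>n x. \<bar>x\<bar> \<le> 1/2 \<longrightarrow> \<bar>radial_deriv n k x\<bar> \<le> A * C ^ n / (fact n)\<^sup>2)"
    using radial_deriv_bound_disc[of "1/2"] by simp
  then obtain A C where A: "\<And>k. 0 \<le> A k" and C: "\<And>k. (1::real) \<le> C k"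
    and b: "\<And>k n x. \<bar>x\<bar> \<le> 1/2 \<Longrightarrow> \<bar>radial_deriv n k x\<bar> \<le> A k * C k ^ n / (fact n)\<^sup>2"
    by metis
  define A' where "A' = A 0 + A 1 + A 2 + 6"
  define C' where "C' = C 0 + C 1 + C 2 + 4"
  have le: "a * c ^ n / (fact n)\<^sup>2 \<le> A' * C' ^ n / (fact n)\<^sup>2"
    if "0 \<le> a" "a \<le> A'" "0 \<le> c" "c \<le> C'" for a c :: real and n
    using that by (intro divide_right_mono mult_mono power_mono) auto
  have small: "A k * C k ^ n / (fact n)\<^sup>2 \<le> A' * C' ^ n / (fact n)\<^sup>2" if "k < 3" for k n
  proof -
    have "k = 0 \<or> k = 1 \<or> k = 2" using that by auto
    then show ?thesis
      using A[of 0] A[of 1] A[of 2] C[of 0] C[of 1] C[of 2]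
      by (intro le) (auto simp: A'_def C'_def)
  qed
  have large: "1 * 4 ^ n / (fact n)\<^sup>2 \<le> A' * C' ^ n / (fact n)\<^sup>2" "6 * 4 ^ n / (fact n)\<^sup>2 \<le> A' * C' ^ n / (fact n)\<^sup>2" for n
    using A[of 0] A[of 1] A[of 2] C[of 0] C[of 1] C[of 2]
    by (intro le; simp add: A'_def C'_def)+
  have "\<bar>radial_deriv n 0 x\<bar> \<le> A' * C' ^ n / (fact n)\<^sup>2 \<and> \<bar>radial_deriv n 1 x\<bar> \<le> A' * C' ^ n / (fact n)\<^sup>2 \<and>
     \<bar>(1 - x) * radial_deriv n 2 x\<bar> \<le> A' * C' ^ n / (fact n)\<^sup>2" if x: "0 \<le> x" "x < 1" for n x
  proof (cases "x \<le> 1/2")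
    case True
    have "\<bar>(1 - x) * radial_deriv n 2 x\<bar> \<le> 1 * \<bar>radial_deriv n 2 x\<bar>"
      unfolding abs_mult using x by (intro mult_right_mono) auto
    then show ?thesis
      using b[of x n 0] b[of x n 1] b[of x n 2] small[of 0 n] small[of 1 n] small[of 2 n] x True by fastforce
  next
    case False
    then show ?thesis
      using radial_deriv_bound_real[of x n] large[of n] x by (auto simp: abs_mult)
  qed
  moreover have "0 \<le> A'" "1 \<le> C'"
    using A[of 0] A[of 1] A[of 2] C[of 0] C[of 1] C[of 2] by (auto simp: A'_def C'_def)
  ultimately show ?thesis by blast
qed

section \<open>Superposition of the separated solutions\<close>

definition gauss :: "real \<Rightarrow> complex \<Rightarrow> complex" where
  "gauss c z = exp (- (of_real c * z\<^sup>2))"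

definition gauss_deriv :: "real \<Rightarrow> nat \<Rightarrow> real \<Rightarrow> real" where
  "gauss_deriv c m t = Re ((deriv ^^ m) (gauss c) (of_real t))"

lemma gauss_holomorphic: "gauss c holomorphic_on S"
  unfolding gauss_def by (intro holomorphic_intros)

lemma gauss_deriv_DERIV:
  "(gauss_deriv c m has_field_derivative gauss_deriv c (Suc m) t) (at t)"
  using DERIV_Re_of_real[OF has_field_derivative_higher_deriv[OF gauss_holomorphic open_UNIV UNIV_I]]
  unfolding gauss_deriv_def[abs_def] .

lemma gauss_deriv_1: "gauss_deriv c 1 t = - 2 * c * t * exp (- c * t\<^sup>2)"
proof -
  have 0: "gauss_deriv c 0 = (\<lambda>t. exp (- c * t\<^sup>2))"
    by (simp add: gauss_deriv_def gauss_def fun_eq_iff exp_of_real flip: of_real_power of_real_mult of_real_minus)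
  have "((\<lambda>t. exp (- c * t\<^sup>2)) has_field_derivative - 2 * c * t * exp (- c * t\<^sup>2)) (at t)"
    by (auto intro!: derivative_eq_intros)
  with gauss_deriv_DERIV[of c 0 t] show ?thesis unfolding 0 by (auto dest: DERIV_unique)
qed

text \<open>A Gaussian on a circle of fixed radius around \<open>t\<close> is bounded by any exponential: complete the square in
\<open>K\<bar>Re z\<bar> \<le> c (Re z)\<^sup>2 + K\<^sup>2 / 4c\<close>.\<close>

lemma norm_gauss_le:
  assumes c: "c > 0" and K: "K \<ge> 0" and z: "norm (of_real t - z) = R"
  shows "norm (gauss c z) \<le> exp (c * R\<^sup>2 + K * R + K\<^sup>2 / (4 * c)) * exp (- K * \<bar>t\<bar>)"
proof -
  have im: "(Im z)\<^sup>2 \<le> R\<^sup>2"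
    using abs_Im_le_cmod[of "of_real t - z"] z by (simp add: abs_le_square_iff[symmetric]) 
  have re: "\<bar>t\<bar> \<le> R + \<bar>Re z\<bar>"
    using abs_Re_le_cmod[of "of_real t - z"] z by simp
  have "0 \<le> c * (\<bar>Re z\<bar> - K / (2 * c))\<^sup>2" using c by simp
  also have "\<dots> = c * (Re z)\<^sup>2 - K * \<bar>Re z\<bar> + K\<^sup>2 / (4 * c)"
    using c by (simp add: power2_diff power_divide field_simps power2_eq_square)
  finally have 1: "K * \<bar>Re z\<bar> \<le> c * (Re z)\<^sup>2 + K\<^sup>2 / (4 * c)" by simp
  have 2: "K * \<bar>t\<bar> \<le> K * R + K * \<bar>Re z\<bar>"
    using mult_left_mono[OF re K] by (simp add: distrib_left)
  have 3: "c * (Im z)\<^sup>2 \<le> c * R\<^sup>2" using im c by simp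
  have "norm (gauss c z) = exp (- c * (Re z)\<^sup>2 + c * (Im z)\<^sup>2)"
    by (simp add: gauss_def norm_exp_eq_Re power2_eq_square algebra_simps)
  also have "\<dots> \<le> exp (c * R\<^sup>2 + K * R + K\<^sup>2 / (4 * c) - K * \<bar>t\<bar>)"
    using 1 2 3 by simp
  finally show ?thesis by (simp add: exp_add[symmetric] algebra_simps)
qed

lemma gauss_deriv_bound:
  assumes "c > 0" "R > 0" "K \<ge> 0"
  shows "\<exists>M\<ge>0. \<forall>m t. \<bar>gauss_deriv c m t\<bar> \<le> M * fact m / R ^ m * exp (- K * \<bar>t\<bar>)"
proof -
  define M where "M = exp (c * R\<^sup>2 + K * R + K\<^sup>2 / (4 * c))"
  have "\<bar>gauss_deriv c m t\<bar> \<le> M * fact m / R ^ m * exp (- K * \<bar>t\<bar>)" for m t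
  proof -
    have "norm ((deriv ^^ m) (gauss c) (of_real t)) \<le> fact m * (M * exp (- K * \<bar>t\<bar>)) / R ^ m"
      by (rule Cauchy_inequality)
         (use norm_gauss_le[OF assms(1,3)] assms in \<open>auto simp: M_def intro: gauss_holomorphic
            holomorphic_on_imp_continuous_on\<close>)
    then show ?thesis
      using abs_Re_le_cmod[of "(deriv ^^ m) (gauss c) (of_real t)"]
      by (simp add: gauss_deriv_def mult_ac)
  qed
  moreover have "M \<ge> 0" by (simp add: M_def)
  ultimately show ?thesis by blast
qed

lemma fact_add_le: "fact (m + n) \<le> 2 ^ (m + n) * fact m * (fact n :: real)"
proof -
  have "fact m * fact n * ((m + n) choose m) = (fact (m + n) :: nat)"
    using binomial_fact_lemma[of m "m + n"] by simp
  then have "(fact (m + n) :: real) = real ((m + n) choose m) * (fact m * fact n)"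
    by (metis (mono_tags) mult.commute of_nat_fact of_nat_mult)
  also have "\<dots> \<le> 2 ^ (m + n) * (fact m * fact n)"
  proof (rule mult_right_mono)
    have "real ((m + n) choose m) \<le> real (2 ^ (m + n))"
      by (simp only: of_nat_le_iff) (rule binomial_le_pow2)
    then show "real ((m + n) choose m) \<le> 2 ^ (m + n)" by simp
  qed simp
  finally show ?thesis by (simp add: mult_ac)
qed

text \<open>The term of index \<open>n\<close> of the series for \<open>\<partial>\<^sub>t\<^sup>a u\<close>, with \<open>\<psi> n\<close> in place of \<open>\<phi>\<^sub>n\<close>: derivatives of \<open>\<phi>\<^sub>n\<close> and multiples of
them are inserted for \<open>\<psi>\<close>.\<close>

definition wave_term :: "real \<Rightarrow> nat \<Rightarrow> (nat \<Rightarrow> real) \<Rightarrow> real \<Rightarrow> nat \<Rightarrow> real" where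
  "wave_term c a \<psi> t n = (-1) ^ n * gauss_deriv c (2 * n + a) t * \<psi> n"

text \<open>\<open>(2n + a)!\<close> is at most \<open>(n!)\<^sup>2\<close> times a geometric factor, which is absorbed by a large Cauchy radius.\<close>

lemma wave_term_bound:
  assumes "c > 0" "K \<ge> 0" "C \<ge> 1" "A \<ge> 0"
  shows "\<exists>M\<ge>0. \<forall>\<psi> t n. (\<forall>n. \<bar>\<psi> n\<bar> \<le> A * C ^ n / (fact n)\<^sup>2) \<longrightarrow>
           \<bar>wave_term c a \<psi> t n\<bar> \<le> M * exp (- K * \<bar>t\<bar>) * (1/2) ^ n"
proof -
  \<comment> \<open>The ratio of the resulting geometric series is \<open>16 C / R\<^sup>2\<close>.\<close>
  define R where "R = sqrt (32 * C)"
  have R: "R > 0" "R\<^sup>2 = 32 * C" using assms by (auto simp: R_def)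
  obtain M where M: "M \<ge> 0" and b: "\<And>m t. \<bar>gauss_deriv c m t\<bar> \<le> M * fact m / R ^ m * exp (- K * \<bar>t\<bar>)"
    using gauss_deriv_bound[OF assms(1) R(1) assms(2)] by blast
  define M' where "M' = M * A * fact a * 2 ^ a / R ^ a"
  have "\<bar>wave_term c a \<psi> t n\<bar> \<le> M' * exp (- K * \<bar>t\<bar>) * (1/2) ^ n"
    if \<psi>: "\<forall>n. \<bar>\<psi> n\<bar> \<le> A * C ^ n / (fact n)\<^sup>2" for \<psi> t n
  proof -
    let ?e = "exp (- K * \<bar>t\<bar>)"
    have f: "fact (2 * n + a) \<le> 2 ^ (2 * n + a) * (2 ^ (2 * n) * (fact n)\<^sup>2) * (fact a :: real)"
    proof -
      have "fact (2 * n) \<le> 2 ^ (2 * n) * (fact n)\<^sup>2 * (1::real)"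
        using fact_add_le[of n n] by (simp add: power2_eq_square mult_2[symmetric])
      then have "2 ^ (2 * n + a) * fact (2 * n) * fact a \<le> 2 ^ (2 * n + a) * (2 ^ (2 * n) * (fact n)\<^sup>2) * (fact a :: real)"
        by (intro mult_right_mono mult_left_mono) auto
      then show ?thesis using fact_add_le[of "2 * n" a] by linarith
    qed
    have "\<bar>wave_term c a \<psi> t n\<bar> = \<bar>gauss_deriv c (2 * n + a) t\<bar> * \<bar>\<psi> n\<bar>"
      by (simp add: wave_term_def abs_mult)
    also have "\<dots> \<le> (M * fact (2 * n + a) / R ^ (2 * n + a) * ?e) * (A * C ^ n / (fact n)\<^sup>2)"
      using M R \<psi> b[of "2 * n + a" t] by (intro mult_mono) auto
    also have "\<dots> \<le> (M * (2 ^ (2 * n + a) * (2 ^ (2 * n) * (fact n)\<^sup>2) * fact a) / R ^ (2 * n + a) * ?e)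
        * (A * C ^ n / (fact n)\<^sup>2)"
      using M R assms f by (intro mult_right_mono divide_right_mono mult_left_mono) auto
    also have "\<dots> = M' * ?e * ((2 ^ (2 * n) * 2 ^ (2 * n) * C ^ n) / R ^ (2 * n))"
      using R by (simp add: M'_def power_add field_simps)
    also have "(2 ^ (2 * n) * 2 ^ (2 * n) * C ^ n) / R ^ (2 * n) = (1/2) ^ n"
    proof -
      have "(2 ^ (2 * n) * 2 ^ (2 * n) * C ^ n) / R ^ (2 * n) = ((2\<^sup>2 * 2\<^sup>2 * C) / R\<^sup>2) ^ n"
        by (simp only: power_mult power_mult_distrib power_divide)
      also have "(2\<^sup>2 * 2\<^sup>2 * C) / R\<^sup>2 = 1/2" using assms by (simp add: R)
      finally show ?thesis .
    qed
    finally show ?thesis .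
  qed
  moreover have "M' \<ge> 0" using M assms R by (simp add: M'_def)
  ultimately show ?thesis by blast
qed

lemma geometric_tail:
  fixes u :: "nat \<Rightarrow> real"
  assumes "\<And>n. \<bar>u n\<bar> \<le> M * (1/2) ^ n"
  shows "summable u" "\<bar>(\<Sum>i<n. u i) - suminf u\<bar> \<le> 2 * M * (1/2) ^ n"
proof -
  have p: "\<bar>u (i + n)\<bar> \<le> M * (1/2) ^ n * (1/2) ^ i" for i n
    using assms[of "i + n"] by (simp add: power_add mult_ac)
  have g: "(\<lambda>i. M * (1/2) ^ n * (1/2) ^ i) sums (M * (1/2) ^ n * (1 / (1 - 1/2)))" for n :: nat
    by (intro sums_mult geometric_sums) auto
  have s: "summable (\<lambda>i. \<bar>u (i + n)\<bar>)" for n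
    by (rule summable_comparison_test'[OF sums_summable[OF g[of n]], of 0])
       (use p in simp)
  then have su: "summable u" using summable_rabs_cancel[of u] s[of 0] by simp
  then show "summable u" .
  have "\<bar>(\<Sum>i<n. u i) - suminf u\<bar> = \<bar>\<Sum>i. u (i + n)\<bar>"
    using suminf_split_initial_segment[OF su, of n] by simp
  also have "\<dots> \<le> (\<Sum>i. \<bar>u (i + n)\<bar>)" by (rule summable_rabs[OF s])
  also have "\<dots> \<le> (\<Sum>i. M * (1/2) ^ n * (1/2) ^ i)"
    by (rule suminf_le[OF _ s sums_summable[OF g]]) (rule p)
  also have "\<dots> = 2 * M * (1/2) ^ n" using sums_unique[OF g[of n]] by simp
  finally show "\<bar>(\<Sum>i<n. u i) - suminf u\<bar> \<le> 2 * M * (1/2) ^ n" .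
qed

text \<open>\<open>wave c a b x t = \<partial>\<^sub>t\<^sup>a \<partial>\<^sub>x\<^sup>b u\<close>, where \<open>u\<close> is the solution with \<open>h = exp (- c t\<^sup>2)\<close> and \<open>x = tan\<^sup>2 s\<close>.\<close>

definition wave :: "real \<Rightarrow> nat \<Rightarrow> nat \<Rightarrow> real \<Rightarrow> real \<Rightarrow> real" where
  "wave c a b x t = (\<Sum>n. wave_term c a (\<lambda>n. radial_deriv n b x) t n)"

lemma wave_term_bound_disc:
  assumes "c > 0" "0 \<le> R" "R < 1"
  shows "\<exists>M. \<forall>x t n. \<bar>x\<bar> \<le> R \<longrightarrow> \<bar>wave_term c a (\<lambda>n. radial_deriv n b x) t n\<bar> \<le> M * (1/2) ^ n"
proof -
  obtain A C where AC: "0 \<le> A" "1 \<le> C"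
    and b: "\<And>n x. \<bar>x\<bar> \<le> R \<Longrightarrow> \<bar>radial_deriv n b x\<bar> \<le> A * C ^ n / (fact n)\<^sup>2"
    using radial_deriv_bound_disc[OF assms(2,3), of b] by blast
  obtain M where "\<And>\<psi> t n. (\<forall>n. \<bar>\<psi> n\<bar> \<le> A * C ^ n / (fact n)\<^sup>2) \<Longrightarrow>
           \<bar>wave_term c a \<psi> t n\<bar> \<le> M * exp (- 0 * \<bar>t\<bar>) * (1/2) ^ n"
    using wave_term_bound[OF assms(1) order_refl AC(2,1)] by blast
  then show ?thesis using b by (intro exI[of _ M]) auto
qed

lemma wave_summable:
  assumes "c > 0" "\<bar>x\<bar> < 1"
  shows "summable (wave_term c a (\<lambda>n. radial_deriv n b x) t)"
  using wave_term_bound_disc[OF assms(1) _ assms(2), of a b] geometric_tail(1) by fastforce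

lemma wave_has_derivative:
  assumes c: "c > 0" and x: "\<bar>x\<bar> < 1"
  shows "((\<lambda>p. wave c a b (fst p) (snd p)) has_derivative
           (\<lambda>v. wave c a (Suc b) x t * fst v + wave c (Suc a) b x t * snd v)) (at (x, t))"
proof -
  define R where "R = (1 + \<bar>x\<bar>) / 2"
  have R: "\<bar>x\<bar> < R" "R < 1" "0 \<le> R" using x by (auto simp: R_def)
  define S where "S = {-R<..<R} \<times> (UNIV :: real set)"
  have S: "convex S" "open S" "(x, t) \<in> S"
    using R by (auto simp: S_def intro!: convex_Times open_Times)
  have SR: "\<bar>fst p\<bar> \<le> R" "\<bar>fst p\<bar> < 1" if "p \<in> S" for p using that R by (auto simp: S_def)
  let ?f = "\<lambda>n p. wave_term c a (\<lambda>n. radial_deriv n b (fst p)) (snd p) n"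
  let ?f1 = "\<lambda>p n. wave_term c a (\<lambda>n. radial_deriv n (Suc b) (fst p)) (snd p) n"
  let ?f2 = "\<lambda>p n. wave_term c (Suc a) (\<lambda>n. radial_deriv n b (fst p)) (snd p) n"
  obtain M1 where M1: "\<And>x t n. \<bar>x\<bar> \<le> R \<Longrightarrow> \<bar>wave_term c a (\<lambda>n. radial_deriv n (Suc b) x) t n\<bar> \<le> M1 * (1/2) ^ n"
    using wave_term_bound_disc[OF c R(3,2)] by blast
  obtain M2 where M2: "\<And>x t n. \<bar>x\<bar> \<le> R \<Longrightarrow> \<bar>wave_term c (Suc a) (\<lambda>n. radial_deriv n b x) t n\<bar> \<le> M2 * (1/2) ^ n"
    using wave_term_bound_disc[OF c R(3,2)] by blast
  let ?g' = "\<lambda>p v. wave c a (Suc b) (fst p) (snd p) * fst v + wave c (Suc a) b (fst p) (snd p) * snd v"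
  have M0: "0 \<le> M1" "0 \<le> M2" using M1[of 0 _ 0] M2[of 0 _ 0] R abs_ge_zero by fastforce+
  \<comment> \<open>Termwise differentiation: the bounds \<open>M1\<close> and \<open>M2\<close> are uniform on the strip \<open>S\<close>.\<close>
  have "\<exists>g. \<forall>p\<in>S. (\<lambda>n. ?f n p) sums g p \<and> (g has_derivative ?g' p) (at p within S)"
  proof (rule has_derivative_series[OF S(1) _ _ S(3)])
    fix n and p :: "real \<times> real" assume p: "p \<in> S"
    have 1: "((\<lambda>p. radial_deriv n b (fst p)) has_derivative (\<lambda>v. radial_deriv n (Suc b) (fst p) * fst v)) (at p within S)"
      by (rule has_derivative_compose[of fst fst, OF _ radial_deriv_DERIV[OF SR(2)[OF p], unfolded has_field_derivative_def]])
         (auto intro!: derivative_eq_intros)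
    have 2: "((\<lambda>p. gauss_deriv c m (snd p)) has_derivative (\<lambda>v. gauss_deriv c (Suc m) (snd p) * snd v)) (at p within S)" for m
      by (rule has_derivative_compose[of snd snd, OF _ gauss_deriv_DERIV[unfolded has_field_derivative_def]])
         (auto intro!: derivative_eq_intros)
    show "(?f n has_derivative (\<lambda>v. ?f1 p n * fst v + ?f2 p n * snd v)) (at p within S)"
      unfolding wave_term_def
      by (rule derivative_eq_intros 1 2 refl)+ (simp add: fun_eq_iff algebra_simps)
  next
    fix e :: real assume e: "e > 0"
    have "(\<lambda>n. (2 * M1 + 2 * M2) * (1/2) ^ n) \<longlonglongrightarrow> (2 * M1 + 2 * M2) * 0"
      by (intro tendsto_intros LIMSEQ_realpow_zero) auto
    then have "\<forall>\<^sub>F n in sequentially. (2 * M1 + 2 * M2) * (1/2) ^ n < e"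
      using e by (intro order_tendstoD) auto
    then show "\<forall>\<^sub>F n in sequentially. \<forall>p\<in>S. \<forall>v.
        norm ((\<Sum>i<n. ?f1 p i * fst v + ?f2 p i * snd v) - ?g' p v) \<le> e * norm v"
    proof (eventually_elim, intro ballI allI)
      fix n and p v :: "real \<times> real"
      assume n: "(2 * M1 + 2 * M2) * (1/2) ^ n < e" and p: "p \<in> S"
      have 1: "\<bar>(\<Sum>i<n. ?f1 p i) - wave c a (Suc b) (fst p) (snd p)\<bar> \<le> 2 * M1 * (1/2) ^ n"
        unfolding wave_def by (rule geometric_tail) (rule M1[OF SR(1)[OF p]])
      have 2: "\<bar>(\<Sum>i<n. ?f2 p i) - wave c (Suc a) b (fst p) (snd p)\<bar> \<le> 2 * M2 * (1/2) ^ n"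
        unfolding wave_def by (rule geometric_tail) (rule M2[OF SR(1)[OF p]])
      have v: "\<bar>fst v\<bar> \<le> norm v" "\<bar>snd v\<bar> \<le> norm v"
        using norm_fst_le[of "fst v" "snd v"] norm_snd_le[of "snd v" "fst v"] by auto
      have "norm ((\<Sum>i<n. ?f1 p i * fst v + ?f2 p i * snd v) - ?g' p v)
          = \<bar>((\<Sum>i<n. ?f1 p i) - wave c a (Suc b) (fst p) (snd p)) * fst v
            + ((\<Sum>i<n. ?f2 p i) - wave c (Suc a) b (fst p) (snd p)) * snd v\<bar>"
        unfolding sum.distrib sum_distrib_right[symmetric] by (simp add: algebra_simps)
      also have "\<dots> \<le> (2 * M1 * (1/2) ^ n) * norm v + (2 * M2 * (1/2) ^ n) * norm v"
        by (rule order_trans[OF abs_triangle_ineq]) (intro add_mono; simp only: abs_mult; intro mult_mono 1 2 v; use M0 in simp)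
      also have "\<dots> = ((2 * M1 + 2 * M2) * (1/2) ^ n) * norm v" by (simp add: algebra_simps)
      also have "\<dots> \<le> e * norm v" using n by (intro mult_right_mono) auto
      finally show "norm ((\<Sum>i<n. ?f1 p i * fst v + ?f2 p i * snd v) - ?g' p v) \<le> e * norm v" .
    qed
  next
    show "(\<lambda>n. ?f n (x, t)) sums wave c a b x t"
      using wave_summable[OF c x] by (simp add: wave_def summable_sums)
  qed
  then obtain g where g: "\<And>p. p \<in> S \<Longrightarrow> (\<lambda>n. ?f n p) sums g p"
      "\<And>p. p \<in> S \<Longrightarrow> (g has_derivative ?g' p) (at p within S)" by blast
  have "(g has_derivative ?g' (x, t)) (at (x, t))"
    using g(2)[OF S(3)] at_within_open[OF S(3,2)] by simp
  then have "((\<lambda>p. wave c a b (fst p) (snd p)) has_derivative ?g' (x, t)) (at (x, t))"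
    by (rule has_derivative_transform_within_open[OF _ S(2,3)]) (use g(1) sums_unique in \<open>auto simp: wave_def\<close>)
  then show ?thesis by simp
qed

text \<open>The radial functions satisfy \<open>L \<phi>\<^sub>n\<^sub>+\<^sub>1 = \<phi>\<^sub>n\<close> for the radial operator \<open>L\<close>, so applying
  \<open>L\<close> to the series shifts its index by one, as \<open>- \<partial>\<^sub>t\<^sup>2\<close> does.\<close>

lemma wave_equation:
  assumes c: "c > 0" and x: "\<bar>x\<bar> < 1"
  shows "wave c 2 0 x t + 4 * (1 + x)\<^sup>2 * (x * wave c 0 2 x t
      + (1 + x * (1 / (2 * (1 - x)) + 1 / (1 + x))) * wave c 0 1 x t) = 0"
proof -
  let ?q = "1 + x * (1 / (2 * (1 - x)) + 1 / (1 + x))"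
  let ?s = "\<lambda>n. wave_term c 0 (\<lambda>n. 4 * (1 + x)\<^sup>2 * (x * radial_deriv n 2 x + ?q * radial_deriv n 1 x)) t n"
  have 2: "wave_term c 0 (\<lambda>n. radial_deriv n 2 x) t sums wave c 0 2 x t"
    and 1: "wave_term c 0 (\<lambda>n. radial_deriv n 1 x) t sums wave c 0 1 x t"
    and 0: "wave_term c 2 (\<lambda>n. radial_deriv n 0 x) t sums wave c 2 0 x t"
    unfolding wave_def using wave_summable[OF c x] by (auto intro: summable_sums)
  have "(\<lambda>n. 4 * (1 + x)\<^sup>2 * (x * wave_term c 0 (\<lambda>n. radial_deriv n 2 x) t n + ?q * wave_term c 0 (\<lambda>n. radial_deriv n 1 x) t n))
      sums (4 * (1 + x)\<^sup>2 * (x * wave c 0 2 x t + ?q * wave c 0 1 x t))"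
    by (intro sums_mult sums_add 1 2)
  then have S: "?s sums (4 * (1 + x)\<^sup>2 * (x * wave c 0 2 x t + ?q * wave c 0 1 x t))"
    by (simp add: wave_term_def algebra_simps)
  have s0: "?s 0 = 0"
    using radial_deriv_0(2)[OF x, of 0] radial_deriv_0(2)[OF x, of 1] by (simp add: wave_term_def numeral_2_eq_2)
  have "?s (Suc n) = - wave_term c 2 (\<lambda>n. radial_deriv n 0 x) t n" for n
  proof -
    have nz: "(1 + x)\<^sup>2 \<noteq> 0" using x by auto
    have "x * radial_deriv (Suc n) 2 x + ?q * radial_deriv (Suc n) 1 x = radial_deriv n 0 x / (4 * (1 + x)\<^sup>2)"
      using radial_deriv_ode[OF x, of n] by (simp add: algebra_simps)
    then have "4 * (1 + x)\<^sup>2 * (x * radial_deriv (Suc n) 2 x + ?q * radial_deriv (Suc n) 1 x) = radial_deriv n 0 x"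
      using nz by simp
    then show ?thesis by (simp add: wave_term_def)
  qed
  then have "(\<lambda>n. ?s (Suc n)) sums (- wave c 2 0 x t)"
    using sums_minus[OF 0] by simp
  then have "?s sums (- wave c 2 0 x t + ?s 0)" by (rule sums_Suc)
  then have "4 * (1 + x)\<^sup>2 * (x * wave c 0 2 x t + ?q * wave c 0 1 x t) = - wave c 2 0 x t"
    using sums_unique2[OF S] s0 by simp
  then show ?thesis by simp
qed

lemma wave_bound:
  assumes c: "c > 0" and K: "K \<ge> 0"
  shows "\<exists>M\<ge>0. \<forall>x t. 0 \<le> x \<and> x < 1 \<longrightarrow> \<bar>wave c a 0 x t\<bar> \<le> M * exp (- K * \<bar>t\<bar>) \<and>
     \<bar>wave c a 1 x t\<bar> \<le> M * exp (- K * \<bar>t\<bar>) \<and> \<bar>(1 - x) * wave c a 2 x t\<bar> \<le> M * exp (- K * \<bar>t\<bar>)"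
proof -
  obtain A C where AC: "0 \<le> A" "1 \<le> C"
    and b: "\<And>n x. 0 \<le> x \<Longrightarrow> x < 1 \<Longrightarrow> \<bar>radial_deriv n 0 x\<bar> \<le> A * C ^ n / (fact n)\<^sup>2"
      "\<And>n x. 0 \<le> x \<Longrightarrow> x < 1 \<Longrightarrow> \<bar>radial_deriv n 1 x\<bar> \<le> A * C ^ n / (fact n)\<^sup>2"
      "\<And>n x. 0 \<le> x \<Longrightarrow> x < 1 \<Longrightarrow> \<bar>(1 - x) * radial_deriv n 2 x\<bar> \<le> A * C ^ n / (fact n)\<^sup>2"
    using radial_deriv_bound by blast
  obtain M where M: "M \<ge> 0" "\<And>\<psi> t n. (\<forall>n. \<bar>\<psi> n\<bar> \<le> A * C ^ n / (fact n)\<^sup>2) \<Longrightarrow>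
           \<bar>wave_term c a \<psi> t n\<bar> \<le> M * exp (- K * \<bar>t\<bar>) * (1/2) ^ n"
    using wave_term_bound[OF c K AC(2,1)] by blast
  have sb: "\<bar>suminf (wave_term c a \<psi> t)\<bar> \<le> 2 * M * exp (- K * \<bar>t\<bar>)"
    if "\<forall>n. \<bar>\<psi> n\<bar> \<le> A * C ^ n / (fact n)\<^sup>2" for \<psi> t
    using geometric_tail(2)[OF M(2)[OF that, of t], of 0] by simp
  have "\<bar>wave c a 0 x t\<bar> \<le> 2 * M * exp (- K * \<bar>t\<bar>) \<and> \<bar>wave c a 1 x t\<bar> \<le> 2 * M * exp (- K * \<bar>t\<bar>) \<and>
     \<bar>(1 - x) * wave c a 2 x t\<bar> \<le> 2 * M * exp (- K * \<bar>t\<bar>)" if x: "0 \<le> x" "x < 1" for x t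
  proof -
    have "(\<lambda>n. (1 - x) * wave_term c a (\<lambda>n. radial_deriv n 2 x) t n)
        = wave_term c a (\<lambda>n. (1 - x) * radial_deriv n 2 x) t"
      by (simp add: fun_eq_iff wave_term_def)
    then have "(1 - x) * wave c a 2 x t = suminf (wave_term c a (\<lambda>n. (1 - x) * radial_deriv n 2 x) t)"
      unfolding wave_def using suminf_mult[OF wave_summable[OF c], of x "1 - x" a 2 t] x by simp
    then show ?thesis
      using sb[of "\<lambda>n. radial_deriv n 0 x" t] sb[of "\<lambda>n. radial_deriv n 1 x" t]
        sb[of "\<lambda>n. (1 - x) * radial_deriv n 2 x" t] b[OF x] by (simp add: wave_def)
  qed
  then show ?thesis using M(1) by (intro exI[of _ "2 * M"]) auto
qed

lemma wave_axis: "wave c a 0 0 t = gauss_deriv c a t"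
proof -
  have "wave_term c a (\<lambda>n. radial_deriv n 0 0) t n = 0" if "n \<notin> {0}" for n
    using radial_deriv_0(3)[of "n - 1"] that by (cases n) (auto simp: wave_term_def)
  then have "wave c a 0 0 t = (\<Sum>n\<in>{0}. wave_term c a (\<lambda>n. radial_deriv n 0 0) t n)"
    unfolding wave_def by (intro suminf_finite) auto
  then show ?thesis by (simp add: wave_term_def radial_deriv_0)
qed

section \<open>Coordinates on the ball\<close>

lemma open_ball3: "open ball3" by (simp add: ball3_def)

definition axis_sq :: "real^3 \<Rightarrow> real" where
  "axis_sq p = (p $ 1)\<^sup>2 + (p $ 2)\<^sup>2"

text \<open>Write \<open>E, D, S\<close> for \<open>bdry\<close>, \<open>pole_dist\<close>, \<open>hsum\<close>. \<open>E\<close> vanishes on the sphere, and \<open>1 / E\<^sup>2\<close> is the conformal factor.\<close>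

definition bdry :: "real^3 \<Rightarrow> real" where
  "bdry p = 1 - axis_sq p - (p $ 3)\<^sup>2"

text \<open>The product of the distances to the two poles, the ends of the axis (see \<open>pole_factors_pos\<close>).\<close>

definition pole_dist :: "real^3 \<Rightarrow> real" where
  "pole_dist p = sqrt ((bdry p)\<^sup>2 + 4 * axis_sq p)"

definition hsum :: "real^3 \<Rightarrow> real" where
  "hsum p = pole_dist p + bdry p"

text \<open>\<open>tan\<^sup>2 s\<close> and \<open>t\<close> for \<open>t + is = artanh (y + ix)\<close>. Here \<open>cos (2s) = E / D\<close>, whence \<open>tan\<^sup>2 s = (D - E) / (D + E)\<close>, which
is smooth across the axis.\<close>

definition radial_var :: "real^3 \<Rightarrow> real" where
  "radial_var p = 1 - 2 * bdry p / hsum p"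

definition axial_var :: "real^3 \<Rightarrow> real" where
  "axial_var p = ln (((1 + p $ 3)\<^sup>2 + axis_sq p) / ((1 - p $ 3)\<^sup>2 + axis_sq p)) / 4"

definition rot :: "real^3 \<Rightarrow> real^3" where
  "rot p = vector [- p $ 2, p $ 1, 0]"

lemma norm_sq_3: "(norm (p :: real^3))\<^sup>2 = axis_sq p + (p $ 3)\<^sup>2"
  by (simp add: axis_sq_def power2_norm_eq_inner inner_vec_def sum_3 flip: power2_eq_square)

lemma bdry_eq: "bdry p = 1 - (norm p)\<^sup>2"
  by (simp add: bdry_def norm_sq_3)

lemma axis_sq_nonneg: "axis_sq p \<ge> 0" by (simp add: axis_sq_def)

lemma rot_nth [simp]: "rot p $ 1 = - p $ 2" "rot p $ 2 = p $ 1" "rot p $ 3 = 0"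
  by (simp_all add: rot_def)

lemma ball3_facts:
  assumes "p \<in> ball3"
  shows "0 < bdry p" "bdry p \<le> 1" "0 < pole_dist p" "0 < hsum p" "bdry p \<le> pole_dist p"
    "hsum p = pole_dist p + bdry p" "4 * axis_sq p = hsum p * (pole_dist p - bdry p)"
    "(p $ 3)\<^sup>2 = 1 - axis_sq p - bdry p" "0 \<le> axis_sq p" "axis_sq p \<le> 1" "(p $ 3)\<^sup>2 \<le> 1" "pole_dist p \<le> 2"
    "(pole_dist p)\<^sup>2 = (bdry p)\<^sup>2 + 4 * axis_sq p"
proof -
  have "norm p < 1" using assms by (simp add: ball3_def)
  then have "(norm p)\<^sup>2 < 1" by (simp add: power_less_one_iff)
  then show E: "0 < bdry p" by (simp add: bdry_eq)
  show E1: "bdry p \<le> 1" by (simp add: bdry_eq)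
  have pos: "0 < (bdry p)\<^sup>2 + 4 * axis_sq p" using E axis_sq_nonneg[of p] by (simp add: add_pos_nonneg)
  then show D: "0 < pole_dist p" by (simp add: pole_dist_def)
  show "0 < hsum p" using E D by (simp add: hsum_def)
  show "hsum p = pole_dist p + bdry p" by (simp add: hsum_def)
  show D2: "(pole_dist p)\<^sup>2 = (bdry p)\<^sup>2 + 4 * axis_sq p" using pos by (simp add: pole_dist_def)
  then show "4 * axis_sq p = hsum p * (pole_dist p - bdry p)"
    by (simp add: hsum_def power2_eq_square algebra_simps)
  have "(bdry p)\<^sup>2 \<le> (pole_dist p)\<^sup>2" using D2 axis_sq_nonneg[of p] by linarith
  then show "bdry p \<le> pole_dist p" by (rule power2_le_imp_le) (use D in linarith)
  show "(p $ 3)\<^sup>2 = 1 - axis_sq p - bdry p" by (simp add: bdry_def)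
  show "0 \<le> axis_sq p" by (rule axis_sq_nonneg)
  show a1: "axis_sq p \<le> 1" using E zero_le_power2[of "p $ 3"] unfolding bdry_def by linarith
  show "(p $ 3)\<^sup>2 \<le> 1" using E axis_sq_nonneg[of p] by (simp add: bdry_def)
  have "(pole_dist p)\<^sup>2 \<le> (2 - bdry p)\<^sup>2"
  proof -
    have "4 * axis_sq p \<le> 4 - 4 * bdry p" by (simp add: bdry_def)
    then show ?thesis unfolding D2 power2_diff by simp
  qed
  then have "pole_dist p \<le> 2 - bdry p" by (rule power2_le_imp_le) (use E1 in linarith)
  then show "pole_dist p \<le> 2" using E by simp
qed

lemma ball3_nz:
  assumes "p \<in> ball3"
  shows "bdry p \<noteq> 0" "pole_dist p \<noteq> 0" "hsum p \<noteq> 0"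
  using ball3_facts[OF assms] by auto

lemma radial_var_range: "p \<in> ball3 \<Longrightarrow> 0 \<le> radial_var p" "p \<in> ball3 \<Longrightarrow> radial_var p < 1"
  using ball3_facts[of p] by (auto simp: radial_var_def divide_simps)

section \<open>Calculus of functions invariant under rotation\<close>

text \<open>\<open>a\<close> and \<open>b\<close> are the partial derivatives of \<open>f\<close> at \<open>p\<close> when \<open>f\<close> is expressed through \<open>axis_sq\<close> and the third
coordinate. Working with the square of the distance to the axis avoids any singularity there.\<close>

definition axial_deriv :: "(real^3 \<Rightarrow> real) \<Rightarrow> real \<Rightarrow> real \<Rightarrow> real^3 \<Rightarrow> bool" where
  "axial_deriv f a b p \<longleftrightarrow>
     (f has_derivative (\<lambda>v. a * (2 * (p $ 1 * v $ 1 + p $ 2 * v $ 2)) + b * v $ 3)) (at p)"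

lemma axial_deriv_partial:
  assumes "axial_deriv f a b p"
  shows "partial 1 f p = 2 * p $ 1 * a" "partial 2 f p = 2 * p $ 2 * a" "partial 3 f p = b"
  using assms unfolding axial_deriv_def
  by (subst partial_eq_derivative, assumption, simp add: axis_def)+

lemma axial_deriv_eq: "axial_deriv f a b p \<Longrightarrow> a = a' \<Longrightarrow> b = b' \<Longrightarrow> axial_deriv f a' b' p"
  by simp

lemma nth_has_derivative: "((\<lambda>p::real^'n. p $ i) has_derivative (\<lambda>v. v $ i)) F"
  by (intro bounded_linear_imp_has_derivative bounded_linear_vec_nth)

lemma axial_deriv_const: "axial_deriv (\<lambda>_. c) 0 0 p"
  by (simp add: axial_deriv_def)

lemma axial_deriv_axis_sq: "axial_deriv axis_sq 1 0 p"
  unfolding axial_deriv_def axis_sq_def[abs_def] power2_eq_square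
  by (rule derivative_eq_intros nth_has_derivative refl | simp add: fun_eq_iff algebra_simps)+

lemma axial_deriv_nth3: "axial_deriv (\<lambda>p. p $ 3) 0 1 p"
  unfolding axial_deriv_def using nth_has_derivative by simp

lemma axial_deriv_add:
  "axial_deriv f a b p \<Longrightarrow> axial_deriv g c d p \<Longrightarrow> axial_deriv (\<lambda>p. f p + g p) (a + c) (b + d) p"
  unfolding axial_deriv_def
  by (rule derivative_eq_intros refl | assumption | simp add: fun_eq_iff algebra_simps)+

lemma axial_deriv_mult:
  "axial_deriv f a b p \<Longrightarrow> axial_deriv g c d p \<Longrightarrow>
    axial_deriv (\<lambda>p. f p * g p) (a * g p + f p * c) (b * g p + f p * d) p"
  unfolding axial_deriv_def
  by (rule derivative_eq_intros refl | assumption | simp add: fun_eq_iff algebra_simps)+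

lemma axial_deriv_cmult: "axial_deriv f a b p \<Longrightarrow> axial_deriv (\<lambda>p. k * f p) (k * a) (k * b) p"
  using axial_deriv_mult[OF axial_deriv_const] by fastforce

lemma axial_deriv_minus: "axial_deriv f a b p \<Longrightarrow> axial_deriv (\<lambda>p. - f p) (- a) (- b) p"
  using axial_deriv_cmult[of f a b p "-1"] by simp

lemma axial_deriv_diff:
  "axial_deriv f a b p \<Longrightarrow> axial_deriv g c d p \<Longrightarrow> axial_deriv (\<lambda>p. f p - g p) (a - c) (b - d) p"
  using axial_deriv_add[of f a b p "\<lambda>p. - g p" "- c" "- d"] axial_deriv_minus by simp

lemma axial_deriv_chain:
  assumes "axial_deriv f a b p" "(h has_field_derivative h') (at (f p))"
  shows "axial_deriv (\<lambda>p. h (f p)) (h' * a) (h' * b) p"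
  using has_derivative_compose[OF assms(1)[unfolded axial_deriv_def] assms(2)[unfolded has_field_derivative_def]]
  unfolding axial_deriv_def by (simp add: distrib_left mult.assoc)

lemma axial_deriv_inverse:
  "axial_deriv f a b p \<Longrightarrow> f p \<noteq> 0 \<Longrightarrow>
    axial_deriv (\<lambda>p. 1 / f p) (- a / (f p)\<^sup>2) (- b / (f p)\<^sup>2) p"
  by (rule axial_deriv_eq[OF axial_deriv_chain[of f a b p "\<lambda>x. 1 / x" "- 1 / (f p)\<^sup>2"]])
     (auto intro!: derivative_eq_intros simp: power2_eq_square)

lemma axial_deriv_transform:
  "axial_deriv f a b p \<Longrightarrow> p \<in> ball3 \<Longrightarrow> (\<And>q. q \<in> ball3 \<Longrightarrow> f q = g q) \<Longrightarrow> axial_deriv g a b p"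
  unfolding axial_deriv_def by (rule has_derivative_transform_within_open[OF _ open_ball3])

lemma axial_deriv_bdry: "axial_deriv bdry (- 1) (- 2 * p $ 3) p"
  unfolding bdry_def[abs_def] power2_eq_square
  by (rule axial_deriv_eq[OF axial_deriv_diff[OF axial_deriv_diff[OF axial_deriv_const[of 1] axial_deriv_axis_sq]
        axial_deriv_mult[OF axial_deriv_nth3 axial_deriv_nth3]]]) auto

lemma axial_deriv_pole_dist:
  assumes "p \<in> ball3"
  shows "axial_deriv pole_dist ((2 - bdry p) / pole_dist p) (- 2 * p $ 3 * bdry p / pole_dist p) p"
proof -
  have pos: "(bdry p)\<^sup>2 + 4 * axis_sq p > 0" using ball3_facts(3,13)[OF assms] by (metis zero_less_power)
  define w where "w = (\<lambda>p. bdry p * bdry p + 4 * axis_sq p)"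
  have 1: "axial_deriv w (4 - 2 * bdry p) (- 4 * p $ 3 * bdry p) p"
    unfolding w_def
    by (rule axial_deriv_eq[OF axial_deriv_add[OF axial_deriv_mult[OF axial_deriv_bdry axial_deriv_bdry]
        axial_deriv_cmult[OF axial_deriv_axis_sq]]]) auto
  have e: "pole_dist = (\<lambda>p. sqrt (w p))" by (simp add: fun_eq_iff pole_dist_def w_def power2_eq_square)
  have wp: "0 < w p" using pos by (simp add: w_def power2_eq_square)
  then have "axial_deriv (\<lambda>p. sqrt (w p)) (inverse (sqrt (w p)) / 2 * (4 - 2 * bdry p))
      (inverse (sqrt (w p)) / 2 * (- 4 * p $ 3 * bdry p)) p"
    by (intro axial_deriv_chain[OF 1] DERIV_real_sqrt)
  then show ?thesis unfolding e by (rule axial_deriv_eq) (use wp in \<open>simp_all add: divide_simps\<close>)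
qed

lemma axial_deriv_hsum:
  assumes "p \<in> ball3"
  shows "axial_deriv hsum ((2 - hsum p) / pole_dist p) (- 2 * p $ 3 * hsum p / pole_dist p) p"
  unfolding hsum_def[abs_def]
  by (rule axial_deriv_eq[OF axial_deriv_add[OF axial_deriv_pole_dist[OF assms] axial_deriv_bdry]])
     (use ball3_nz[OF assms] in \<open>simp_all add: field_simps\<close>)

definition axis_slope :: "real^3 \<Rightarrow> real" where
  "axis_slope p = bdry p + 2 * axis_sq p"

lemma axial_deriv_axis_slope: "axial_deriv axis_slope 1 (- 2 * p $ 3) p"
  unfolding axis_slope_def[abs_def]
  by (rule axial_deriv_eq[OF axial_deriv_add[OF axial_deriv_bdry axial_deriv_cmult[OF axial_deriv_axis_sq]]]) auto

text \<open>The derivatives of \<open>radial_var\<close> (\<open>rad\<close>) and \<open>axial_var\<close> (\<open>ax\<close>) with respect to \<open>axis_sq\<close> (index 1) and the third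
coordinate (index 3); two indices below denote second derivatives.\<close>

definition rad1 where "rad1 p = 4 * axis_slope p / (pole_dist p * (hsum p)\<^sup>2)"
definition rad3 where "rad3 p = 16 * p $ 3 * axis_sq p / (pole_dist p * (hsum p)\<^sup>2)"
definition ax1 where "ax1 p = - p $ 3 / (pole_dist p)\<^sup>2"
definition ax3 where "ax3 p = axis_slope p / (pole_dist p)\<^sup>2"

lemma axial_deriv_radial_var:
  assumes "p \<in> ball3"
  shows "axial_deriv radial_var (rad1 p) (rad3 p) p"
proof -
  note nz = ball3_nz[OF assms]
  have "axial_deriv radial_var
     (0 - 2 * (- 1 * (1 / hsum p) + bdry p * (- ((2 - hsum p) / pole_dist p) / (hsum p)\<^sup>2)))
     (0 - 2 * (- 2 * p $ 3 * (1 / hsum p) + bdry p * (- (- 2 * p $ 3 * hsum p / pole_dist p) / (hsum p)\<^sup>2))) p"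
    using axial_deriv_diff[OF axial_deriv_const[of 1] axial_deriv_cmult[OF
        axial_deriv_mult[OF axial_deriv_bdry axial_deriv_inverse[OF axial_deriv_hsum[OF assms] nz(3)]], of 2]]
    unfolding radial_var_def[abs_def] by simp
  then show ?thesis
  proof (rule axial_deriv_eq)
    have *: "0 - 2 * (- 1 * (1 / S) + E * (- ((2 - S) / D) / S\<^sup>2)) = 4 * (E + 2 * al) / (D * S\<^sup>2)"
      "0 - 2 * (- 2 * z * (1 / S) + E * (- (- 2 * z * S / D) / S\<^sup>2)) = 16 * z * al / (D * S\<^sup>2)"
      if "S \<noteq> 0" "D \<noteq> 0" "S = D + E" "4 * al = S * (D - E)" for S D E al z :: real
      using that by (simp_all add: divide_simps; algebra)+
    show "0 - 2 * (- 1 * (1 / hsum p) + bdry p * (- ((2 - hsum p) / pole_dist p) / (hsum p)\<^sup>2)) = rad1 p"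
      unfolding rad1_def axis_slope_def by (rule *(1)[OF nz(3,2) ball3_facts(6,7)[OF assms]])
    show "0 - 2 * (- 2 * p $ 3 * (1 / hsum p) + bdry p * (- (- 2 * p $ 3 * hsum p / pole_dist p) / (hsum p)\<^sup>2)) = rad3 p"
      unfolding rad3_def by (rule *(2)[OF nz(3,2) ball3_facts(6,7)[OF assms]])
  qed
qed

lemma pole_factors_pos:
  assumes "p \<in> ball3"
  shows "(1 + p $ 3)\<^sup>2 + axis_sq p > 0" "(1 - p $ 3)\<^sup>2 + axis_sq p > 0"
    "((1 + p $ 3)\<^sup>2 + axis_sq p) * ((1 - p $ 3)\<^sup>2 + axis_sq p) = (pole_dist p)\<^sup>2"
proof -
  have e: "((1 + p $ 3)\<^sup>2 + axis_sq p) * ((1 - p $ 3)\<^sup>2 + axis_sq p) = (pole_dist p)\<^sup>2"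
    unfolding ball3_facts(13)[OF assms] bdry_def by algebra
  moreover have "(pole_dist p)\<^sup>2 \<noteq> 0" using ball3_nz[OF assms] by simp
  ultimately have "(1 + p $ 3)\<^sup>2 + axis_sq p \<noteq> 0" "(1 - p $ 3)\<^sup>2 + axis_sq p \<noteq> 0" by auto
  then show "(1 + p $ 3)\<^sup>2 + axis_sq p > 0" "(1 - p $ 3)\<^sup>2 + axis_sq p > 0"
    using axis_sq_nonneg[of p] by (smt (verit) zero_le_power2)+
  show "((1 + p $ 3)\<^sup>2 + axis_sq p) * ((1 - p $ 3)\<^sup>2 + axis_sq p) = (pole_dist p)\<^sup>2" by (rule e)
qed

lemma axial_deriv_axial_var:
  assumes "p \<in> ball3"
  shows "axial_deriv axial_var (ax1 p) (ax3 p) p"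
proof -
  define u v where "u = (\<lambda>p::real^3. (1 + p $ 3)\<^sup>2 + axis_sq p)" and "v = (\<lambda>p::real^3. (1 - p $ 3)\<^sup>2 + axis_sq p)"
  have pos: "u p > 0" "v p > 0" and uv: "u p * v p = (pole_dist p)\<^sup>2"
    using pole_factors_pos[OF assms] by (auto simp: u_def v_def)
  have u: "axial_deriv u 1 (2 * (1 + p $ 3)) p"
    unfolding u_def power2_eq_square
    by (rule axial_deriv_eq[OF axial_deriv_add[OF axial_deriv_mult[OF
            axial_deriv_add[OF axial_deriv_const axial_deriv_nth3] axial_deriv_add[OF axial_deriv_const axial_deriv_nth3]] axial_deriv_axis_sq]]) auto
  have v: "axial_deriv v 1 (- 2 * (1 - p $ 3)) p"
    unfolding v_def power2_eq_square
    by (rule axial_deriv_eq[OF axial_deriv_add[OF axial_deriv_mult[OF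
            axial_deriv_diff[OF axial_deriv_const axial_deriv_nth3] axial_deriv_diff[OF axial_deriv_const axial_deriv_nth3]] axial_deriv_axis_sq]]) auto
  have "axial_deriv (\<lambda>p. 1/4 * (ln (u p) - ln (v p))) (1/4 * (1 / u p * 1 - 1 / v p * 1))
      (1/4 * (1 / u p * (2 * (1 + p $ 3)) - 1 / v p * (- 2 * (1 - p $ 3)))) p"
    by (intro axial_deriv_cmult axial_deriv_diff axial_deriv_chain[OF u] axial_deriv_chain[OF v] DERIV_ln_divide pos)
  then have 1: "axial_deriv axial_var (1/4 * (1 / u p * 1 - 1 / v p * 1))
      (1/4 * (1 / u p * (2 * (1 + p $ 3)) - 1 / v p * (- 2 * (1 - p $ 3)))) p"
    by (rule axial_deriv_transform[OF _ assms])
       (simp add: axial_var_def u_def v_def ln_divide_pos pole_factors_pos(1,2))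
  show ?thesis
  proof (rule axial_deriv_eq[OF 1])
    show "1/4 * (1 / u p * 1 - 1 / v p * 1) = ax1 p"
      unfolding ax1_def uv[symmetric] using pos
      by (simp add: divide_simps) (simp add: u_def v_def power2_eq_square algebra_simps)
    show "1/4 * (1 / u p * (2 * (1 + p $ 3)) - 1 / v p * (- 2 * (1 - p $ 3))) = ax3 p"
      unfolding ax3_def uv[symmetric] axis_slope_def bdry_def using pos
      by (simp add: divide_simps) (simp add: u_def v_def power2_eq_square algebra_simps)
  qed
qed

section \<open>Smoothness of the coordinate functions\<close>

lemma smooth_axis_sq [smooth_rules]: "smooth_on ball3 axis_sq"
  unfolding axis_sq_def[abs_def] by (intro smooth_rules open_ball3)

lemma smooth_bdry [smooth_rules]: "smooth_on ball3 bdry"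
  unfolding bdry_def[abs_def] by (intro smooth_rules open_ball3)

lemma smooth_pole_dist [smooth_rules]: "smooth_on ball3 pole_dist"
  unfolding pole_dist_def[abs_def]
  by (intro smooth_rules open_ball3) (metis ball3_facts(3,13) zero_less_power)

lemma smooth_hsum [smooth_rules]: "smooth_on ball3 hsum"
  unfolding hsum_def[abs_def] by (intro smooth_rules open_ball3)

lemma smooth_axis_slope [smooth_rules]: "smooth_on ball3 axis_slope"
  unfolding axis_slope_def[abs_def] by (intro smooth_rules open_ball3)

lemma smooth_slopes [smooth_rules]:
  "smooth_on ball3 rad1" "smooth_on ball3 rad3" "smooth_on ball3 ax1" "smooth_on ball3 ax3"
  unfolding rad1_def[abs_def] rad3_def[abs_def] ax1_def[abs_def] ax3_def[abs_def]
  by (intro smooth_rules open_ball3; simp add: ball3_nz)+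

definition lifted_wave :: "real \<Rightarrow> nat \<Rightarrow> nat \<Rightarrow> real^3 \<Rightarrow> real" where
  "lifted_wave c a b p = wave c a b (radial_var p) (axial_var p)"

lemma lifted_wave_has_derivative:
  assumes "c > 0" "p \<in> ball3"
  shows "(lifted_wave c a b has_derivative
     (\<lambda>v. lifted_wave c a (Suc b) p * (rad1 p * (2 * (p $ 1 * v $ 1 + p $ 2 * v $ 2)) + rad3 p * v $ 3)
        + lifted_wave c (Suc a) b p * (ax1 p * (2 * (p $ 1 * v $ 1 + p $ 2 * v $ 2)) + ax3 p * v $ 3))) (at p)"
proof -
  have x: "\<bar>radial_var p\<bar> < 1" using radial_var_range[OF assms(2)] by simp
  have 1: "((\<lambda>p. (radial_var p, axial_var p)) has_derivative
      (\<lambda>v. (rad1 p * (2 * (p $ 1 * v $ 1 + p $ 2 * v $ 2)) + rad3 p * v $ 3,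
            ax1 p * (2 * (p $ 1 * v $ 1 + p $ 2 * v $ 2)) + ax3 p * v $ 3))) (at p)"
    using axial_deriv_radial_var[OF assms(2)] axial_deriv_axial_var[OF assms(2)]
    unfolding axial_deriv_def by (intro has_derivative_Pair)
  show ?thesis
    using has_derivative_compose[OF 1 wave_has_derivative[OF assms(1) x]]
    unfolding lifted_wave_def[abs_def] by simp
qed

lemma axial_deriv_lifted_wave:
  assumes "c > 0" "p \<in> ball3"
  shows "axial_deriv (lifted_wave c a b)
     (lifted_wave c a (Suc b) p * rad1 p + lifted_wave c (Suc a) b p * ax1 p)
     (lifted_wave c a (Suc b) p * rad3 p + lifted_wave c (Suc a) b p * ax3 p) p"
  using lifted_wave_has_derivative[OF assms] unfolding axial_deriv_def by (simp add: algebra_simps)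

lemma smooth_lifted_wave [smooth_rules]:
  assumes "c > 0" shows "smooth_on ball3 (lifted_wave c a b)"
proof (rule smooth_on_jet_family[where \<Phi> = "lifted_wave c"
      and X' = "\<lambda>p v. rad1 p * (2 * (p $ 1 * v $ 1 + p $ 2 * v $ 2)) + rad3 p * v $ 3"
      and Y' = "\<lambda>p v. ax1 p * (2 * (p $ 1 * v $ 1 + p $ 2 * v $ 2)) + ax3 p * v $ 3",
      OF open_ball3], rule lifted_wave_has_derivative[OF assms], assumption)
  show "smooth_on ball3 (\<lambda>p. rad1 p * (2 * (p $ 1 * axis i 1 $ 1 + p $ 2 * axis i 1 $ 2)) + rad3 p * axis i 1 $ 3)"
    "smooth_on ball3 (\<lambda>p. ax1 p * (2 * (p $ 1 * axis i 1 $ 1 + p $ 2 * axis i 1 $ 2)) + ax3 p * axis i 1 $ 3)"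
    for i :: 3
    by (intro smooth_rules open_ball3)+
qed

section \<open>The metric and its inverse\<close>

lemma metric_entry:
  assumes "p \<in> ball3"
  shows "anderson_metric 2 p $ i $ j =
     (if i = j then 1 / (bdry p)\<^sup>2 else 0) - 4 / ((bdry p)\<^sup>2 * (hsum p)\<^sup>2) * (rot p $ i * rot p $ j)"
proof -
  note nz = ball3_nz[OF assms] and f = ball3_facts[OF assms]
  let ?m = "1 / (1 - (norm p)\<^sup>2)\<^sup>2"
  have m: "?m = 1 / (bdry p)\<^sup>2" by (simp add: bdry_eq)
  have "1 + 4 * ?m * ((p $ 1)\<^sup>2 + (p $ 2)\<^sup>2) = (pole_dist p / bdry p)\<^sup>2"
    unfolding m axis_sq_def[symmetric] power_divide f(13) using nz by (simp add: field_simps)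
  then have w: "sqrt (1 + 4 * ?m * ((p $ 1)\<^sup>2 + (p $ 2)\<^sup>2)) = pole_dist p / bdry p"
    using f(1,3) by simp
  have "1 + pole_dist p / bdry p = hsum p / bdry p"
    using nz by (simp add: f(6) field_simps)
  then have "4 * ?m\<^sup>2 / (1 + sqrt (1 + 4 * ?m * ((p $ 1)\<^sup>2 + (p $ 2)\<^sup>2)))\<^sup>2 = 4 / ((bdry p)\<^sup>2 * (hsum p)\<^sup>2)"
    unfolding w by (simp only: m) (use nz in \<open>simp add: divide_simps power2_eq_square\<close>)
  then show ?thesis
    unfolding anderson_metric_smooth_form[OF assms] rot_def[symmetric] m by simp
qed

lemma rot_inner_rot: "rot p \<bullet> rot p = axis_sq p"
  by (simp add: inner_vec_def sum_3 axis_sq_def power2_eq_square)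

lemma metric_mult:
  assumes "p \<in> ball3"
  shows "anderson_metric 2 p *v v = (1 / (bdry p)\<^sup>2) *\<^sub>R v - (4 / ((bdry p)\<^sup>2 * (hsum p)\<^sup>2) * (rot p \<bullet> v)) *\<^sub>R rot p"
proof -
  have *: "(\<Sum>j\<in>UNIV. ((if i = j then a else 0) - b * (r i * r j)) * v j) = a * v i - b * (\<Sum>j\<in>UNIV. r j * v j) * r i"
    for a b :: real and r v :: "3 \<Rightarrow> real" and i
    using exhaust_3[of i] by (auto simp: sum_3 algebra_simps)
  define b where "b = 4 / ((bdry p)\<^sup>2 * (hsum p)\<^sup>2)"
  show ?thesis
    unfolding b_def[symmetric]
    by (simp add: vec_eq_iff matrix_vector_mult_def metric_entry[OF assms, folded b_def] * inner_vec_def)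
qed

definition metric_inv :: "real^3 \<Rightarrow> real^3^3" where
  "metric_inv p = (\<chi> i j. (if i = j then (bdry p)\<^sup>2 else 0) + 2 * bdry p / hsum p * (rot p $ i * rot p $ j))"

lemma metric_inv_mult:
  "metric_inv p *v v = (bdry p)\<^sup>2 *\<^sub>R v + (2 * bdry p / hsum p * (rot p \<bullet> v)) *\<^sub>R rot p"
proof -
  have *: "(\<Sum>j\<in>UNIV. ((if i = j then a else 0) + b * (r i * r j)) * v j) = a * v i + b * (\<Sum>j\<in>UNIV. r j * v j) * r i"
    for a b :: real and r v :: "3 \<Rightarrow> real" and i
    using exhaust_3[of i] by (auto simp: sum_3 algebra_simps)
  define b where "b = 2 * bdry p / hsum p"
  show ?thesis
    unfolding b_def[symmetric] metric_inv_def
    by (simp add: vec_eq_iff matrix_vector_mult_def * inner_vec_def)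
qed

lemma metric_metric_inv:
  assumes "p \<in> ball3"
  shows "anderson_metric 2 p *v (metric_inv p *v v) = v"
proof -
  note nz = ball3_nz[OF assms] and f = ball3_facts[OF assms]
  have *: "1 / E\<^sup>2 * (E\<^sup>2 * u + 2 * E / S * k * r) - 4 / (E\<^sup>2 * S\<^sup>2) * (E\<^sup>2 * k + 2 * E / S * k * al) * r = u"
    if "E \<noteq> 0" "S \<noteq> 0" "S = D + E" "4 * al = S * (D - E)" for E S D al k r u :: real
    using that(1,2) by (simp add: divide_simps) (use that(3,4) in algebra)
  show ?thesis
    unfolding vec_eq_iff metric_mult[OF assms] metric_inv_mult inner_add_right inner_scaleR_right rot_inner_rot
      vector_minus_component vector_add_component vector_scaleR_component real_scaleR_def
    using *[OF nz(1,3) f(6,7)] by blast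
qed

lemma matrix_inv_eqI:
  fixes A B :: "real^'n^'n"
  assumes "A ** B = mat 1"
  shows "matrix_inv A = B"
proof -
  have BA: "B ** A = mat 1" using assms matrix_left_right_inverse by blast
  then have "A ** matrix_inv A = mat 1 \<and> matrix_inv A ** A = mat 1"
    unfolding matrix_inv_def using assms
    by (intro someI[where P = "\<lambda>A'. A ** A' = mat 1 \<and> A' ** A = mat 1" and x = B]) simp
  then have "B ** (A ** matrix_inv A) = B" by (simp only: matrix_mul_rid)
  then show ?thesis by (simp only: matrix_mul_assoc BA matrix_mul_lid)
qed

lemma matrix_inv_metric: "p \<in> ball3 \<Longrightarrow> matrix_inv (anderson_metric 2 p) = metric_inv p"
  by (rule matrix_inv_eqI) (simp add: matrix_eq metric_metric_inv flip: matrix_vector_mul_assoc)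

lemma metric_metric_inv':
  assumes "p \<in> ball3"
  shows "metric_inv p *v (anderson_metric 2 p *v v) = v"
proof -
  have "anderson_metric 2 p ** metric_inv p = mat 1"
    using metric_metric_inv[OF assms] by (simp add: matrix_eq flip: matrix_vector_mul_assoc)
  then have "metric_inv p ** anderson_metric 2 p = mat 1" using matrix_left_right_inverse by blast
  then show ?thesis by (simp add: matrix_vector_mul_assoc)
qed

lemma det_metric:
  assumes "p \<in> ball3"
  shows "det (anderson_metric 2 p) = 2 / ((bdry p)^5 * hsum p)"
proof -
  note nz = ball3_nz[OF assms] and f = ball3_facts[OF assms]
  define x y where "x = p $ 1" and "y = p $ 2"
  have *: "(1 / E\<^sup>2 - 4 / (E\<^sup>2 * S\<^sup>2) * (y * y)) * (1 / E\<^sup>2 - 4 / (E\<^sup>2 * S\<^sup>2) * (x * x)) * (1 / E\<^sup>2)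
      - (4 / (E\<^sup>2 * S\<^sup>2) * (x * y)) * (4 / (E\<^sup>2 * S\<^sup>2) * (x * y)) * (1 / E\<^sup>2) = 2 / (E^5 * S)"
    if "E \<noteq> 0" "S \<noteq> 0" "S = D + E" "4 * (x\<^sup>2 + y\<^sup>2) = S * (D - E)" for E S D :: real
  proof -
    have "(1 / E\<^sup>2 - 4 / (E\<^sup>2 * S\<^sup>2) * (y * y)) * (1 / E\<^sup>2 - 4 / (E\<^sup>2 * S\<^sup>2) * (x * x)) * (1 / E\<^sup>2)
      - (4 / (E\<^sup>2 * S\<^sup>2) * (x * y)) * (4 / (E\<^sup>2 * S\<^sup>2) * (x * y)) * (1 / E\<^sup>2)
      = 1 / E^6 * (1 - (4 * (x\<^sup>2 + y\<^sup>2)) / S\<^sup>2)"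
      using that(1,2) by (simp add: field_simps eval_nat_numeral)
    also have "1 - (4 * (x\<^sup>2 + y\<^sup>2)) / S\<^sup>2 = 2 * E / S"
      unfolding that(4) using that(2) by (simp add: divide_simps power2_eq_square) (use that(3) in algebra)
    also have "1 / E^6 * (2 * E / S) = 2 / (E^5 * S)" using that(1,2) by (simp add: field_simps eval_nat_numeral)
    finally show ?thesis .
  qed
  have "det (anderson_metric 2 p) = (1 / (bdry p)\<^sup>2 - 4 / ((bdry p)\<^sup>2 * (hsum p)\<^sup>2) * (y * y)) * (1 / (bdry p)\<^sup>2 - 4 / ((bdry p)\<^sup>2 * (hsum p)\<^sup>2) * (x * x)) * (1 / (bdry p)\<^sup>2)
      - (4 / ((bdry p)\<^sup>2 * (hsum p)\<^sup>2) * (x * y)) * (4 / ((bdry p)\<^sup>2 * (hsum p)\<^sup>2) * (x * y)) * (1 / (bdry p)\<^sup>2)"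
    by (simp add: det_3 metric_entry[OF assms] x_def y_def)
  also have "\<dots> = 2 / ((bdry p)^5 * hsum p)"
    by (rule *[OF nz(1,3) f(6)]) (use f(7) in \<open>simp add: axis_sq_def x_def y_def\<close>)
  finally show ?thesis .
qed

lemma vol_density_metric:
  "p \<in> ball3 \<Longrightarrow> vol_density (anderson_metric 2) p = sqrt (2 / ((bdry p)^5 * hsum p))"
  by (simp add: vol_density_def det_metric)

lemma smooth_metric [smooth_rules]: "smooth_on ball3 (\<lambda>p. anderson_metric 2 p $ i $ j)"
proof -
  have "smooth_on ball3 (\<lambda>p. (if i = j then 1 / (bdry p)\<^sup>2 else 0)
      - 4 / ((bdry p)\<^sup>2 * (hsum p)\<^sup>2) * (rot p $ i * rot p $ j))"
    unfolding rot_def using exhaust_3[of i] exhaust_3[of j]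
    by (cases "i = j"; simp; elim disjE; simp; intro smooth_rules open_ball3; simp add: ball3_nz)
  then show ?thesis
    by (subst smooth_on_cong[OF open_ball3 metric_entry])
qed

lemma smooth_rot [smooth_rules]: "smooth_on ball3 (\<lambda>p. rot p $ i)"
  unfolding rot_def using exhaust_3[of i]
  by (elim disjE; simp; intro smooth_rules open_ball3)

lemma smooth_metric_inv [smooth_rules]:
  "smooth_on ball3 (\<lambda>p. matrix_inv (anderson_metric 2 p) $ i $ j)"
proof -
  have "smooth_on ball3 (\<lambda>p. metric_inv p $ i $ j)"
    unfolding metric_inv_def
    by (cases "i = j"; simp; intro smooth_rules open_ball3; simp add: ball3_nz)
  then show ?thesis
    by (subst smooth_on_cong[OF open_ball3, where g = "\<lambda>p. metric_inv p $ i $ j"]) (simp_all add: matrix_inv_metric)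
qed

lemma smooth_vol_density [smooth_rules]: "smooth_on ball3 (vol_density (anderson_metric 2))"
proof -
  have "smooth_on ball3 (\<lambda>p. sqrt (2 / ((bdry p)^5 * hsum p)))"
    by (intro smooth_rules open_ball3) (use ball3_nz ball3_facts in auto)
  then show ?thesis
    by (subst smooth_on_cong[OF open_ball3 vol_density_metric])
qed

section \<open>Second derivatives\<close>

definition rad11 where "rad11 p = 4 * (1 / (pole_dist p * (hsum p)\<^sup>2)
   + axis_slope p * (- (2 - bdry p) / ((pole_dist p)^3 * (hsum p)\<^sup>2) - 2 * (2 - hsum p) / ((pole_dist p)\<^sup>2 * (hsum p)^3)))"
definition rad13 where "rad13 p = 4 * (- 2 * p $ 3 / (pole_dist p * (hsum p)\<^sup>2)
   + axis_slope p * (2 * p $ 3 * bdry p / ((pole_dist p)^3 * (hsum p)\<^sup>2) + 4 * p $ 3 / ((pole_dist p)\<^sup>2 * (hsum p)\<^sup>2)))"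
definition rad33 where "rad33 p = 16 * axis_sq p / (pole_dist p * (hsum p)\<^sup>2)
   + 16 * p $ 3 * axis_sq p * (2 * p $ 3 * bdry p / ((pole_dist p)^3 * (hsum p)\<^sup>2) + 4 * p $ 3 / ((pole_dist p)\<^sup>2 * (hsum p)\<^sup>2))"
definition ax11 where "ax11 p = 2 * p $ 3 * (2 - bdry p) / (pole_dist p)^4"
definition ax13 where "ax13 p = - 1 / (pole_dist p)\<^sup>2 - 4 * (p $ 3)\<^sup>2 * bdry p / (pole_dist p)^4"
definition ax33 where "ax33 p = - 2 * p $ 3 / (pole_dist p)\<^sup>2 + 4 * axis_slope p * p $ 3 * bdry p / (pole_dist p)^4"

lemma axial_deriv_rad:
  assumes "p \<in> ball3"
  shows "axial_deriv rad1 (rad11 p) (rad13 p) p" "axial_deriv rad3 (rad13 p) (rad33 p) p"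
proof -
  note nz = ball3_nz[OF assms] and f = ball3_facts[OF assms]
  let ?E = "bdry p" and ?D = "pole_dist p" and ?S = "hsum p" and ?z = "p $ 3"
  have i: "axial_deriv (\<lambda>p. 1 / (pole_dist p * (hsum p * hsum p)))
     (- ((2 - ?E) / ?D * (?S * ?S) + ?D * ((2 - ?S) / ?D * ?S + ?S * ((2 - ?S) / ?D))) / (?D * (?S * ?S))\<^sup>2)
     (- (- 2 * ?z * ?E / ?D * (?S * ?S) + ?D * (- 2 * ?z * ?S / ?D * ?S + ?S * (- 2 * ?z * ?S / ?D))) / (?D * (?S * ?S))\<^sup>2) p"
    by (rule axial_deriv_inverse[OF axial_deriv_mult[OF axial_deriv_pole_dist[OF assms]
        axial_deriv_mult[OF axial_deriv_hsum[OF assms] axial_deriv_hsum[OF assms]]]]) (use nz in simp)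
  have i': "axial_deriv (\<lambda>p. 1 / (pole_dist p * (hsum p * hsum p)))
     (- (2 - ?E) / (?D^3 * ?S\<^sup>2) - 2 * (2 - ?S) / (?D\<^sup>2 * ?S^3))
     (2 * ?z * ?E / (?D^3 * ?S\<^sup>2) + 4 * ?z / (?D\<^sup>2 * ?S\<^sup>2)) p"
    by (rule axial_deriv_eq[OF i]; use nz in \<open>simp add: divide_simps\<close>; algebra?)
  show "axial_deriv rad1 (rad11 p) (rad13 p) p"
    using axial_deriv_cmult[OF axial_deriv_mult[OF axial_deriv_axis_slope i'], of 4]
    unfolding rad1_def[abs_def] rad11_def rad13_def power2_eq_square by (simp add: mult_ac)
  have 3: "axial_deriv rad3
     (16 * ?z * (1 / (?D * ?S\<^sup>2) + axis_sq p * (- (2 - ?E) / (?D^3 * ?S\<^sup>2) - 2 * (2 - ?S) / (?D\<^sup>2 * ?S^3)))) (rad33 p) p"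
    using axial_deriv_cmult[OF axial_deriv_mult[OF axial_deriv_mult[OF axial_deriv_nth3 axial_deriv_axis_sq] i'], of 16]
    unfolding rad3_def[abs_def] rad33_def power2_eq_square by (simp add: algebra_simps)
  have *: "16 * z * (1 / (D * S\<^sup>2) + al * (- (2 - E) / (D^3 * S\<^sup>2) - 2 * (2 - S) / (D\<^sup>2 * S^3)))
      = 4 * (- 2 * z / (D * S\<^sup>2) + (E + 2 * al) * (2 * z * E / (D^3 * S\<^sup>2) + 4 * z / (D\<^sup>2 * S\<^sup>2)))"
    if "D \<noteq> 0" "S \<noteq> 0" "S = D + E" "4 * al = S * (D - E)" for D S E al z :: real
    using that(1,2) by (simp add: divide_simps) (use that(3,4) in algebra)
  show "axial_deriv rad3 (rad13 p) (rad33 p) p"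
    using *[OF nz(2,3) f(6,7), of ?z] 3 unfolding rad13_def axis_slope_def by simp
qed

lemma axial_deriv_ax:
  assumes "p \<in> ball3"
  shows "axial_deriv ax1 (ax11 p) (ax13 p) p" "axial_deriv ax3 (ax13 p) (ax33 p) p"
proof -
  note nz = ball3_nz[OF assms] and f = ball3_facts[OF assms]
  let ?E = "bdry p" and ?D = "pole_dist p" and ?z = "p $ 3"
  have i: "axial_deriv (\<lambda>p. 1 / (pole_dist p * pole_dist p))
     (- ((2 - ?E) / ?D * ?D + ?D * ((2 - ?E) / ?D)) / (?D * ?D)\<^sup>2)
     (- (- 2 * ?z * ?E / ?D * ?D + ?D * (- 2 * ?z * ?E / ?D)) / (?D * ?D)\<^sup>2) p"
    by (rule axial_deriv_inverse[OF axial_deriv_mult[OF axial_deriv_pole_dist[OF assms] axial_deriv_pole_dist[OF assms]]])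
       (use nz in simp)
  have i': "axial_deriv (\<lambda>p. 1 / (pole_dist p * pole_dist p)) (- 2 * (2 - ?E) / ?D^4) (4 * ?z * ?E / ?D^4) p"
    by (rule axial_deriv_eq[OF i]; use nz in \<open>simp add: divide_simps\<close>; algebra?)
  show "axial_deriv ax1 (ax11 p) (ax13 p) p"
    using axial_deriv_cmult[OF axial_deriv_mult[OF axial_deriv_nth3 i'], of "-1"]
    unfolding ax1_def[abs_def] ax11_def ax13_def power2_eq_square by (simp add: algebra_simps)
  have 3: "axial_deriv ax3 (1 / ?D\<^sup>2 - 2 * axis_slope p * (2 - ?E) / ?D^4) (ax33 p) p"
    using axial_deriv_mult[OF axial_deriv_axis_slope i']
    unfolding ax3_def[abs_def] ax33_def power2_eq_square
    by (simp add: algebra_simps diff_divide_distrib add_divide_distrib)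
  have *: "1 / D\<^sup>2 - 2 * (E + 2 * al) * (2 - E) / D^4 = - 1 / D\<^sup>2 - 4 * z\<^sup>2 * E / D^4"
    if "D \<noteq> 0" "4 * al = (D + E) * (D - E)" "z\<^sup>2 = 1 - al - E" for D E al z :: real
    using that(1) by (simp add: divide_simps) (use that(2,3) in algebra)
  show "axial_deriv ax3 (ax13 p) (ax33 p) p"
    using 3 unfolding ax13_def axis_slope_def *[OF nz(2) f(7)[unfolded f(6)] f(8)] .
qed

text \<open>The first three identities express that \<open>artanh\<close> is conformal with derivative \<open>1 / D\<close> in absolute value. The last
two compute the weighted Laplacian of the coordinates \<open>tan\<^sup>2 s\<close> and \<open>t\<close>; \<open>la\<close> and \<open>lz\<close> are the derivatives of the
logarithm of \<open>1 / \<surd>(E S)\<close>, which is proportional to \<open>f / x\<close> with \<open>x\<close> the distance to the axis.\<close>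

lemma axial_laplace_identities:
  assumes "p \<in> ball3"
  defines "la \<equiv> (1 / bdry p - (2 - hsum p) / (pole_dist p * hsum p)) / 2"
    and "lz \<equiv> p $ 3 * (1 / bdry p + 1 / pole_dist p)"
  shows "4 * axis_sq p * (rad1 p)\<^sup>2 + (rad3 p)\<^sup>2 = 64 * axis_sq p / (hsum p)^4"
    "4 * axis_sq p * (rad1 p * ax1 p) + rad3 p * ax3 p = 0"
    "4 * axis_sq p * (ax1 p)\<^sup>2 + (ax3 p)\<^sup>2 = 1 / (pole_dist p)\<^sup>2"
    "4 * rad1 p + 4 * axis_sq p * rad11 p + rad33 p + 4 * axis_sq p * la * rad1 p + lz * rad3 p
       = 16 / (hsum p)\<^sup>2 * (1 + 2 * axis_sq p / (pole_dist p * hsum p) + axis_sq p / (bdry p * hsum p))"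
    "4 * ax1 p + 4 * axis_sq p * ax11 p + ax33 p + 4 * axis_sq p * la * ax1 p + lz * ax3 p = 0"
proof -
  note nz = ball3_nz[OF assms(1)] and f = ball3_facts[OF assms(1)]
  show "4 * axis_sq p * (rad1 p)\<^sup>2 + (rad3 p)\<^sup>2 = 64 * axis_sq p / (hsum p)^4"
    unfolding rad1_def rad3_def axis_slope_def using nz
    by (simp add: divide_simps) (use f(6,7,8) in algebra)
  show "4 * axis_sq p * (rad1 p * ax1 p) + rad3 p * ax3 p = 0"
    unfolding rad1_def rad3_def ax1_def ax3_def using nz by (simp add: divide_simps)
  show "4 * axis_sq p * (ax1 p)\<^sup>2 + (ax3 p)\<^sup>2 = 1 / (pole_dist p)\<^sup>2"
    unfolding ax1_def ax3_def axis_slope_def using nz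
    by (simp add: divide_simps) (use f(6,7,8) in algebra)
  show "4 * rad1 p + 4 * axis_sq p * rad11 p + rad33 p + 4 * axis_sq p * la * rad1 p + lz * rad3 p
       = 16 / (hsum p)\<^sup>2 * (1 + 2 * axis_sq p / (pole_dist p * hsum p) + axis_sq p / (bdry p * hsum p))"
    unfolding rad1_def rad3_def rad11_def rad33_def axis_slope_def la_def lz_def using nz
    by (simp add: divide_simps) (use f(6,7,8) in algebra)
  show "4 * ax1 p + 4 * axis_sq p * ax11 p + ax33 p + 4 * axis_sq p * la * ax1 p + lz * ax3 p = 0"
    unfolding ax1_def ax3_def ax11_def ax33_def axis_slope_def la_def lz_def using nz
    by (simp add: divide_simps) (use f(6,7,8) in algebra)
qed

section \<open>The harmonic fields\<close>

text \<open>The potential is \<open>lifted_wave c 0 0\<close>; \<open>pot1\<close> and \<open>pot3\<close> are its derivatives with respect to \<open>axis_sq\<close> and the third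
coordinate. The dual vector field is \<open>E\<^sup>2\<close> times the Euclidean gradient: it is orthogonal to the rotation field, so
only the conformal part of the metric enters.\<close>

definition pot1 :: "real \<Rightarrow> real^3 \<Rightarrow> real" where
  "pot1 c p = lifted_wave c 0 1 p * rad1 p + lifted_wave c 1 0 p * ax1 p"
definition pot3 :: "real \<Rightarrow> real^3 \<Rightarrow> real" where
  "pot3 c p = lifted_wave c 0 1 p * rad3 p + lifted_wave c 1 0 p * ax3 p"

definition pot_grad :: "real \<Rightarrow> real^3 \<Rightarrow> real^3" where
  "pot_grad c p = vector [2 * p $ 1 * pot1 c p, 2 * p $ 2 * pot1 c p, pot3 c p]"

definition harm_field :: "real \<Rightarrow> real^3 \<Rightarrow> real^3" where
  "harm_field c p = (if p \<in> ball3 then (bdry p)\<^sup>2 *\<^sub>R pot_grad c p else 0)"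

definition pot11 where "pot11 c p =
    (lifted_wave c 0 2 p * rad1 p + lifted_wave c 1 1 p * ax1 p) * rad1 p + lifted_wave c 0 1 p * rad11 p
  + (lifted_wave c 1 1 p * rad1 p + lifted_wave c 2 0 p * ax1 p) * ax1 p + lifted_wave c 1 0 p * ax11 p"
definition pot13 where "pot13 c p =
    (lifted_wave c 0 2 p * rad3 p + lifted_wave c 1 1 p * ax3 p) * rad1 p + lifted_wave c 0 1 p * rad13 p
  + (lifted_wave c 1 1 p * rad3 p + lifted_wave c 2 0 p * ax3 p) * ax1 p + lifted_wave c 1 0 p * ax13 p"
definition pot33 where "pot33 c p =
    (lifted_wave c 0 2 p * rad3 p + lifted_wave c 1 1 p * ax3 p) * rad3 p + lifted_wave c 0 1 p * rad33 p
  + (lifted_wave c 1 1 p * rad3 p + lifted_wave c 2 0 p * ax3 p) * ax3 p + lifted_wave c 1 0 p * ax33 p"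

lemma axial_deriv_pot:
  assumes "c > 0" "p \<in> ball3"
  shows "axial_deriv (pot1 c) (pot11 c p) (pot13 c p) p" "axial_deriv (pot3 c) (pot13 c p) (pot33 c p) p"
proof -
  have 01: "axial_deriv (lifted_wave c 0 1) (lifted_wave c 0 2 p * rad1 p + lifted_wave c 1 1 p * ax1 p)
      (lifted_wave c 0 2 p * rad3 p + lifted_wave c 1 1 p * ax3 p) p"
    using axial_deriv_lifted_wave[OF assms, of 0 1] by (simp add: numeral_2_eq_2)
  have 10: "axial_deriv (lifted_wave c 1 0) (lifted_wave c 1 1 p * rad1 p + lifted_wave c 2 0 p * ax1 p)
      (lifted_wave c 1 1 p * rad3 p + lifted_wave c 2 0 p * ax3 p) p"
    using axial_deriv_lifted_wave[OF assms, of 1 0] by (simp add: numeral_2_eq_2)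
  show "axial_deriv (pot1 c) (pot11 c p) (pot13 c p) p"
    unfolding pot1_def[abs_def] pot11_def pot13_def
    by (rule axial_deriv_eq[OF axial_deriv_add[OF axial_deriv_mult[OF 01 axial_deriv_rad(1)[OF assms(2)]]
          axial_deriv_mult[OF 10 axial_deriv_ax(1)[OF assms(2)]]]]) simp_all
  show "axial_deriv (pot3 c) (pot13 c p) (pot33 c p) p"
    unfolding pot3_def[abs_def] pot33_def pot13_def
    by (rule axial_deriv_eq[OF axial_deriv_add[OF axial_deriv_mult[OF 01 axial_deriv_rad(2)[OF assms(2)]]
          axial_deriv_mult[OF 10 axial_deriv_ax(2)[OF assms(2)]]]]) (simp_all add: algebra_simps)
qed

lemma smooth_pot [smooth_rules]:
  "c > 0 \<Longrightarrow> smooth_on ball3 (pot1 c)" "c > 0 \<Longrightarrow> smooth_on ball3 (pot3 c)"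
  unfolding pot1_def[abs_def] pot3_def[abs_def] by (intro smooth_rules open_ball3; simp)+

lemma pot_grad_nth: "pot_grad c p $ 1 = 2 * p $ 1 * pot1 c p" "pot_grad c p $ 2 = 2 * p $ 2 * pot1 c p"
  "pot_grad c p $ 3 = pot3 c p"
  by (simp_all add: pot_grad_def)

lemma smooth_pot_grad [smooth_rules]:
  assumes "c > 0" shows "smooth_on ball3 (\<lambda>p. pot_grad c p $ i)"
  using exhaust_3[of i] by (elim disjE; simp add: pot_grad_nth; intro smooth_rules open_ball3 assms)

definition pot_hess :: "real \<Rightarrow> real^3 \<Rightarrow> real^3^3" where
  "pot_hess c p = vector
    [vector [2 * pot1 c p + 4 * (p $ 1)\<^sup>2 * pot11 c p, 4 * p $ 1 * p $ 2 * pot11 c p, 2 * p $ 1 * pot13 c p],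
     vector [4 * p $ 1 * p $ 2 * pot11 c p, 2 * pot1 c p + 4 * (p $ 2)\<^sup>2 * pot11 c p, 2 * p $ 2 * pot13 c p],
     vector [2 * p $ 1 * pot13 c p, 2 * p $ 2 * pot13 c p, pot33 c p]]"

lemma partial_nth: "partial i (\<lambda>p. p $ j) p = (if i = j then 1 else 0)"
  using partial_eq_derivative[OF nth_has_derivative, of i j p] by (simp add: axis_def)

lemma partial_pot_grad:
  assumes "c > 0" "p \<in> ball3"
  shows "partial i (\<lambda>q. pot_grad c q $ j) p = pot_hess c p $ i $ j"
proof -
  note a = axial_deriv_pot[OF assms]
  have d: "pot1 c differentiable (at p)"
    by (intro smooth_on_imp_differentiable[OF _ open_ball3] smooth_pot assms)
  have dn: "(\<lambda>p::real^3. 2 * p $ k) differentiable (at p)" for k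
    by (intro smooth_on_imp_differentiable[OF _ open_UNIV] smooth_rules open_UNIV) simp
  have n: "partial i (\<lambda>p. 2 * p $ k) p = (if i = k then 2 else 0)" for i k :: 3
    by (subst partial_cmult) (auto simp: partial_nth intro!: smooth_on_imp_differentiable[OF _ open_UNIV] smooth_rules)
  show ?thesis
    using exhaust_3[of i] exhaust_3[of j]
    by (elim disjE; simp add: pot_grad_nth pot_hess_def partial_mult[OF dn d] n axial_deriv_partial[OF a(1)]
        axial_deriv_partial[OF a(2)] power2_eq_square)
qed

lemma pot_hess_sym: "pot_hess c p $ i $ j = pot_hess c p $ j $ i"
  using exhaust_3[of i] exhaust_3[of j] by (elim disjE; simp add: pot_hess_def)

definition flux_density :: "real^3 \<Rightarrow> real" where
  "flux_density p = sqrt (2 / (bdry p * hsum p))"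

lemma axial_deriv_flux_density:
  assumes "p \<in> ball3"
  shows "axial_deriv flux_density
    (flux_density p * ((1 / bdry p - (2 - hsum p) / (pole_dist p * hsum p)) / 2))
    (flux_density p * (p $ 3 * (1 / bdry p + 1 / pole_dist p))) p"
proof -
  note nz = ball3_nz[OF assms] and f = ball3_facts[OF assms]
  let ?E = "bdry p" and ?D = "pole_dist p" and ?S = "hsum p" and ?z = "p $ 3"
  define w where "w = (\<lambda>p. 2 * (1 / (bdry p * hsum p)))"
  have wp: "w p > 0" using f(1,4) by (simp add: w_def)
  have e: "flux_density = (\<lambda>p. sqrt (w p))" by (simp add: fun_eq_iff flux_density_def w_def)
  have "axial_deriv w
     (2 * (- (- 1 * ?S + ?E * ((2 - ?S) / ?D)) / (?E * ?S)\<^sup>2))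
     (2 * (- (- 2 * ?z * ?S + ?E * (- 2 * ?z * ?S / ?D)) / (?E * ?S)\<^sup>2)) p"
    unfolding w_def
    by (intro axial_deriv_cmult axial_deriv_inverse axial_deriv_mult axial_deriv_bdry axial_deriv_hsum assms)
       (use nz in simp)
  then have 1: "axial_deriv w (w p * (1 / ?E - (2 - ?S) / (?D * ?S))) (w p * (2 * ?z * (1 / ?E + 1 / ?D))) p"
    by (rule axial_deriv_eq; use nz in \<open>simp add: w_def divide_simps\<close>; algebra?)
  have "axial_deriv (\<lambda>p. sqrt (w p)) (inverse (sqrt (w p)) / 2 * (w p * (1 / ?E - (2 - ?S) / (?D * ?S))))
      (inverse (sqrt (w p)) / 2 * (w p * (2 * ?z * (1 / ?E + 1 / ?D)))) p"
    by (intro axial_deriv_chain[OF 1] DERIV_real_sqrt wp)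
  moreover have "inverse (sqrt (w p)) / 2 * (w p * k) = sqrt (w p) * (k / 2)" for k
    using wp real_sqrt_mult_self[of "w p"] by (simp add: field_simps)
  ultimately show ?thesis unfolding e by (simp only:) simp
qed

lemma smooth_flux_density [smooth_rules]: "smooth_on ball3 flux_density"
  unfolding flux_density_def[abs_def] by (intro smooth_rules open_ball3) (use ball3_nz ball3_facts in auto)

text \<open>In the variables \<open>tan\<^sup>2 s\<close> and \<open>t\<close> the Laplace equation of the potential is \<open>wave_equation\<close>.\<close>

lemma pot_laplace:
  assumes c: "c > 0" and p: "p \<in> ball3"
  defines "la \<equiv> (1 / bdry p - (2 - hsum p) / (pole_dist p * hsum p)) / 2"
    and "lz \<equiv> p $ 3 * (1 / bdry p + 1 / pole_dist p)"
  shows "4 * pot1 c p + 4 * axis_sq p * pot11 c p + pot33 c p + 4 * axis_sq p * la * pot1 c p + lz * pot3 c p = 0"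
proof -
  note nz = ball3_nz[OF p] and f = ball3_facts[OF p]
  note id = axial_laplace_identities[OF p, folded la_def lz_def]
  let ?E = "bdry p" and ?D = "pole_dist p" and ?S = "hsum p" and ?x = "radial_var p"
  define w01 w10 w02 w11 w20 where "w01 = lifted_wave c 0 1 p" and "w10 = lifted_wave c 1 0 p"
    and "w02 = lifted_wave c 0 2 p" and "w11 = lifted_wave c 1 1 p" and "w20 = lifted_wave c 2 0 p"
  have x: "\<bar>?x\<bar> < 1" using radial_var_range[OF p] by simp
  have w: "w20 + 4 * (1 + ?x)\<^sup>2 * (?x * w02 + (1 + ?x * (1 / (2 * (1 - ?x)) + 1 / (1 + ?x))) * w01) = 0"
    using wave_equation[OF c x, of "axial_var p"] by (simp add: lifted_wave_def w20_def w02_def w01_def)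
  have x1: "1 + ?x = 2 * ?D / ?S" "1 - ?x = 2 * ?E / ?S" "?x = 4 * axis_sq p / ?S\<^sup>2"
    unfolding radial_var_def using nz f(6,7) by (simp_all add: divide_simps power2_eq_square)
  have q: "1 + ?x * (1 / (2 * (1 - ?x)) + 1 / (1 + ?x)) = 1 + axis_sq p / (?E * ?S) + 2 * axis_sq p / (?D * ?S)"
    unfolding x1(1,2) unfolding x1(3) using nz
    by (simp add: divide_simps power2_eq_square) algebra
  have w1: "w20 + 16 * ?D\<^sup>2 / ?S\<^sup>2 * (4 * axis_sq p / ?S\<^sup>2 * w02 + (1 + axis_sq p / (?E * ?S) + 2 * axis_sq p / (?D * ?S)) * w01) = 0"
    using w unfolding q unfolding x1(1) unfolding x1(3) by (simp add: power_mult_distrib power_divide)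
  then have w': "w02 * (64 * axis_sq p / ?S^4) + w20 * (1 / ?D\<^sup>2)
      + w01 * (16 / ?S\<^sup>2 * (1 + 2 * axis_sq p / (?D * ?S) + axis_sq p / (?E * ?S))) = 0"
  proof -
    have "w02 * (64 * al / S^4) + w20 * (1 / D\<^sup>2) + w01 * (16 / S\<^sup>2 * (1 + u + v))
       = (w20 + 16 * D\<^sup>2 / S\<^sup>2 * (4 * al / S\<^sup>2 * w02 + (1 + v + u) * w01)) * (1 / D\<^sup>2)"
      if "D \<noteq> 0" "S \<noteq> 0" for D S al u v :: real
      using that by (simp add: divide_simps) algebra
    from this[OF nz(2,3)] show ?thesis
      by (simp only: w1 mult_zero_left)
  qed
  have "4 * pot1 c p + 4 * axis_sq p * pot11 c p + pot33 c p + 4 * axis_sq p * la * pot1 c p + lz * pot3 c p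
    = w02 * (4 * axis_sq p * (rad1 p)\<^sup>2 + (rad3 p)\<^sup>2)
    + 2 * w11 * (4 * axis_sq p * (rad1 p * ax1 p) + rad3 p * ax3 p)
    + w20 * (4 * axis_sq p * (ax1 p)\<^sup>2 + (ax3 p)\<^sup>2)
    + w01 * (4 * rad1 p + 4 * axis_sq p * rad11 p + rad33 p + 4 * axis_sq p * la * rad1 p + lz * rad3 p)
    + w10 * (4 * ax1 p + 4 * axis_sq p * ax11 p + ax33 p + 4 * axis_sq p * la * ax1 p + lz * ax3 p)"
    unfolding pot1_def pot3_def pot11_def pot33_def w01_def[symmetric] w10_def[symmetric]
      w02_def[symmetric] w11_def[symmetric] w20_def[symmetric]
    by (simp add: algebra_simps power2_eq_square)
  also have "\<dots> = 0" unfolding id using w' by simp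
  finally show ?thesis .
qed

lemma rot_pot_grad: "rot p \<bullet> pot_grad c p = 0"
  by (simp add: inner_vec_def sum_3 pot_grad_nth)

lemma flat_harm_field: "p \<in> ball3 \<Longrightarrow> flat (anderson_metric 2) (harm_field c) p = pot_grad c p"
  using ball3_nz[of p] by (simp add: flat_def harm_field_def metric_mult rot_pot_grad)

text \<open>The volume density times \<open>E\<^sup>2\<close> is \<open>flux_density\<close>, so coclosedness is the weighted Laplace equation in Cartesian
coordinates.\<close>

lemma codiff1_pot_grad:
  assumes c: "c > 0" and p: "p \<in> ball3" and \<omega>: "\<And>q. q \<in> ball3 \<Longrightarrow> \<omega> q = pot_grad c q"
  shows "codiff1 (anderson_metric 2) \<omega> p = 0"
proof -
  let ?G = "anderson_metric 2"
  have e: "vol_density ?G q * (matrix_inv (?G q) *v \<omega> q) $ i = flux_density q * pot_grad c q $ i"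
    if q: "q \<in> ball3" for q i
  proof -
    note f = ball3_facts[OF q]
    have "sqrt (2 / ((bdry q)^5 * hsum q)) * (bdry q)\<^sup>2 = sqrt (2 / ((bdry q)^5 * hsum q) * ((bdry q)\<^sup>2)\<^sup>2)"
      by (simp only: real_sqrt_mult real_sqrt_abs) simp
    also have "2 / ((bdry q)^5 * hsum q) * ((bdry q)\<^sup>2)\<^sup>2 = 2 / (bdry q * hsum q)"
      using ball3_nz[OF q] by (simp add: field_simps eval_nat_numeral)
    finally show ?thesis
      by (simp add: vol_density_metric[OF q] matrix_inv_metric[OF q] metric_inv_mult \<omega>[OF q] rot_pot_grad
          flux_density_def flip: mult.assoc)
  qed
  have d: "flux_density differentiable (at p)" "(\<lambda>q. pot_grad c q $ i) differentiable (at p)" for i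
    using smooth_on_imp_differentiable[OF _ open_ball3 p] smooth_flux_density smooth_pot_grad[OF c] by auto
  have "partial i (\<lambda>q. vol_density ?G q * (matrix_inv (?G q) *v \<omega> q) $ i) p
      = flux_density p * pot_hess c p $ i $ i + partial i flux_density p * pot_grad c p $ i" for i
  proof -
    have "partial i (\<lambda>q. vol_density ?G q * (matrix_inv (?G q) *v \<omega> q) $ i) p
        = partial i (\<lambda>q. flux_density q * pot_grad c q $ i) p"
      by (rule partial_cong[OF open_ball3 p]) (rule e)
    then show ?thesis by (simp only: partial_mult[OF d] partial_pot_grad[OF c p])
  qed
  then have "(\<Sum>i\<in>UNIV. partial i (\<lambda>q. vol_density ?G q * (matrix_inv (?G q) *v \<omega> q) $ i) p) =
    flux_density p * (4 * pot1 c p + 4 * axis_sq p * pot11 c p + pot33 c p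
      + 4 * axis_sq p * ((1 / bdry p - (2 - hsum p) / (pole_dist p * hsum p)) / 2) * pot1 c p
      + (p $ 3 * (1 / bdry p + 1 / pole_dist p)) * pot3 c p)"
    by (simp only: sum_3 axial_deriv_partial[OF axial_deriv_flux_density[OF p]] pot_grad_nth)
       (simp add: pot_hess_def axis_sq_def power2_eq_square algebra_simps)
  then show ?thesis unfolding codiff1_def pot_laplace[OF c p] by simp
qed

lemma harm_field_harmonic:
  assumes c: "c > 0"
  shows "harm_field c \<in> harmonic_vec_fields (anderson_metric 2) ball3"
proof -
  let ?G = "anderson_metric 2" and ?\<omega> = "flat (anderson_metric 2) (harm_field c)"
  have s: "smooth_on ball3 (\<lambda>p. harm_field c p $ i)" for i
  proof -
    have "smooth_on ball3 (\<lambda>p. (bdry p)\<^sup>2 * pot_grad c p $ i)"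
      by (intro smooth_rules open_ball3 c)
    then show ?thesis
      by (subst smooth_on_cong[OF open_ball3, where g = "\<lambda>p. (bdry p)\<^sup>2 * pot_grad c p $ i"])
         (simp_all add: harm_field_def)
  qed
  have d1: "ext_d1 ?\<omega> p = 0" if p: "p \<in> ball3" for p
  proof -
    have "partial i (\<lambda>q. ?\<omega> q $ j) p = pot_hess c p $ i $ j" for i j
      using partial_cong[OF open_ball3 p, of "\<lambda>q. ?\<omega> q $ j" "\<lambda>q. pot_grad c q $ j" i] flat_harm_field
        partial_pot_grad[OF c p] by simp
    then show ?thesis by (simp add: ext_d1_def vec_eq_iff pot_hess_sym)
  qed
  have "hodge_laplacian ?G ?\<omega> p = 0" if p: "p \<in> ball3" for p
  proof -
    have "ext_d0 (codiff1 ?G ?\<omega>) p = 0"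
      unfolding ext_d0_def
      using partial_zero_on[OF open_ball3 p, of "codiff1 ?G ?\<omega>"] codiff1_pot_grad[OF c _ flat_harm_field]
      by (simp add: vec_eq_iff)
    moreover have "partial i (\<lambda>q. vol_density ?G q * (matrix_inv (?G q) ** ext_d1 ?\<omega> q ** matrix_inv (?G q)) $ i $ l) p = 0" for i l
      by (rule partial_zero_on[OF open_ball3 p]) (simp add: d1)
    ultimately show ?thesis by (simp add: hodge_laplacian_def codiff2_def vec_eq_iff matrix_vector_mult_def)
  qed
  then show ?thesis using s by (auto simp: harmonic_vec_fields_def harm_field_def)
qed

text \<open>Only the term of index \<open>0\<close> of the series survives on the axis, where \<open>t = artanh y\<close>.\<close>

lemma harm_field_axis:
  assumes "c > 0"
  shows "harm_field c (vector [0, 0, tanh t]) $ 3 = - 2 * c * t * exp (- c * t\<^sup>2) * (1 - (tanh t)\<^sup>2)"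
proof -
  let ?p = "vector [0, 0, tanh t] :: real^3" and ?z = "tanh t"
  have z: "-1 < ?z" "?z < 1" using tanh_real_gt_neg1 tanh_real_lt_1 by auto
  have zz: "?z\<^sup>2 < 1" using z by (simp add: abs_square_less_1)
  have a: "axis_sq ?p = 0" by (simp add: axis_sq_def)
  have E: "bdry ?p = 1 - ?z\<^sup>2" by (simp add: bdry_def a)
  have p: "?p \<in> ball3"
    using E zz bdry_eq[of ?p] by (simp add: ball3_def) (smt (verit) one_le_power)
  have D: "pole_dist ?p = bdry ?p" using E zz by (simp add: pole_dist_def a)
  have S: "hsum ?p = 2 * bdry ?p" by (simp add: hsum_def D)
  have "radial_var ?p = 0" using ball3_nz[OF p] by (simp add: radial_var_def S)
  moreover have "axial_var ?p = t"
  proof -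
    have "axial_var ?p = ln (((1 + ?z) / (1 - ?z))\<^sup>2) / 4"
      by (simp add: axial_var_def a power_divide)
    also have "\<dots> = artanh ?z"
      using z by (simp add: artanh_def ln_realpow)
    finally show ?thesis by (simp add: artanh_tanh_real)
  qed
  ultimately have w: "lifted_wave c 1 0 ?p = - 2 * c * t * exp (- c * t\<^sup>2)"
    by (simp add: lifted_wave_def wave_axis gauss_deriv_1[unfolded One_nat_def])
  have "rad3 ?p = 0" "ax3 ?p = 1 / bdry ?p"
    using ball3_nz[OF p] by (simp_all add: rad3_def a ax3_def axis_slope_def D power2_eq_square)
  then show ?thesis
    using p ball3_nz[OF p] w E by (simp add: harm_field_def pot_grad_nth pot3_def power2_eq_square)
qed

section \<open>The covariant derivative\<close>

definition cov_deriv :: "'n::finite metric_field \<Rightarrow> 'n vec_field \<Rightarrow> real^'n \<Rightarrow> real^'n^'n" where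
  "cov_deriv G X p = (\<chi> i k. partial i (\<lambda>q. X q $ k) p + (\<Sum>j\<in>UNIV. christoffel G k i j p * X p $ j))"

definition rot_coeff :: "real^3 \<Rightarrow> real" where
  "rot_coeff p = 4 / ((bdry p)\<^sup>2 * (hsum p)\<^sup>2)"

definition rot_coeff1 where
  "rot_coeff1 p = 8 / ((bdry p)^3 * (hsum p)\<^sup>2) - 8 * (2 - hsum p) / ((bdry p)\<^sup>2 * (hsum p)^3 * pole_dist p)"
definition rot_coeff3 where
  "rot_coeff3 p = 16 * p $ 3 / ((bdry p)^3 * (hsum p)\<^sup>2) + 16 * p $ 3 / ((bdry p)\<^sup>2 * (hsum p)\<^sup>2 * pole_dist p)"

lemma axial_deriv_rot_coeff:
  assumes "p \<in> ball3"
  shows "axial_deriv rot_coeff (rot_coeff1 p) (rot_coeff3 p) p"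
proof -
  note nz = ball3_nz[OF assms]
  let ?E = "bdry p" and ?D = "pole_dist p" and ?S = "hsum p" and ?z = "p $ 3"
  have 1: "axial_deriv (\<lambda>p. 1 / (bdry p * hsum p))
     (- (- 1 * ?S + ?E * ((2 - ?S) / ?D)) / (?E * ?S)\<^sup>2)
     (- (- 2 * ?z * ?S + ?E * (- 2 * ?z * ?S / ?D)) / (?E * ?S)\<^sup>2) p"
    by (intro axial_deriv_inverse axial_deriv_mult axial_deriv_bdry axial_deriv_hsum assms) (use nz in simp)
  have e: "rot_coeff = (\<lambda>p. 4 * (1 / (bdry p * hsum p) * (1 / (bdry p * hsum p))))"
    by (simp add: fun_eq_iff rot_coeff_def power2_eq_square mult_ac)
  show ?thesis unfolding e
    by (rule axial_deriv_eq[OF axial_deriv_cmult[OF axial_deriv_mult[OF 1 1]]];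
        use nz in \<open>simp add: rot_coeff1_def rot_coeff3_def divide_simps\<close>; algebra?)
qed

lemma axial_deriv_conf:
  assumes "p \<in> ball3"
  shows "axial_deriv (\<lambda>p. 1 / (bdry p)\<^sup>2) (2 / (bdry p)^3) (4 * p $ 3 / (bdry p)^3) p"
proof -
  note nz = ball3_nz[OF assms]
  have "axial_deriv (\<lambda>p. 1 / (bdry p * bdry p)) 
     (- (- 1 * bdry p + bdry p * (- 1)) / (bdry p * bdry p)\<^sup>2)
     (- (- 2 * p $ 3 * bdry p + bdry p * (- 2 * p $ 3)) / (bdry p * bdry p)\<^sup>2) p"
    by (intro axial_deriv_inverse axial_deriv_mult axial_deriv_bdry) (use nz in simp)
  then show ?thesis unfolding power2_eq_square[symmetric]
    by (rule axial_deriv_eq; use nz in \<open>simp add: divide_simps\<close>; algebra?)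
qed

definition rot_jac :: "3 \<Rightarrow> 3 \<Rightarrow> real" where
  "rot_jac i j = (if i = 1 \<and> j = 2 then 1 else if i = 2 \<and> j = 1 then -1 else 0)"

lemma index_3_neq: "(1::3) \<noteq> 2" "(1::3) \<noteq> 3" "(2::3) \<noteq> 1" "(2::3) \<noteq> 3" "(3::3) \<noteq> 1" "(3::3) \<noteq> 2"
  by simp_all

lemma rot_jac_nth: "rot_jac 1 1 = 0" "rot_jac 1 2 = 1" "rot_jac 1 3 = 0" "rot_jac 2 1 = -1" "rot_jac 2 2 = 0"
  "rot_jac 2 3 = 0" "rot_jac 3 1 = 0" "rot_jac 3 2 = 0" "rot_jac 3 3 = 0"
  by (simp_all add: rot_jac_def)

lemma partial_rot: "partial i (\<lambda>p. rot p $ j) p = rot_jac i j"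
proof -
  have "(\<lambda>p. rot p $ 1) = (\<lambda>p. (-1) * p $ 2)" "(\<lambda>p. rot p $ 2) = (\<lambda>p. p $ 1)" "(\<lambda>p. rot p $ 3) = (\<lambda>p. 0)"
    by auto
  moreover have "partial i (\<lambda>p. (-1) * p $ 2) p = (-1) * (if i = 2 then 1 else 0)"
    by (subst partial_cmult) (auto simp: partial_nth differentiable_def intro: nth_has_derivative)
  moreover have "partial i (\<lambda>p. 0) p = 0" by (simp add: partial_def)
  ultimately show ?thesis
    using exhaust_3[of i] exhaust_3[of j]
    by (elim disjE; simp only: partial_nth; simp add: rot_jac_def)
qed

definition metric_deriv :: "3 \<Rightarrow> 3 \<Rightarrow> 3 \<Rightarrow> real^3 \<Rightarrow> real" where
  "metric_deriv i j k p = (if j = k then 4 * p $ i / (bdry p)^3 else 0)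
     - (rot_coeff p * (rot p $ j * rot_jac i k + rot_jac i j * rot p $ k)
        + (vector [2 * p $ 1 * rot_coeff1 p, 2 * p $ 2 * rot_coeff1 p, rot_coeff3 p] :: real^3) $ i * (rot p $ j * rot p $ k))"

lemma partial_metric:
  assumes p: "p \<in> ball3"
  shows "partial i (\<lambda>q. anderson_metric 2 q $ j $ k) p = metric_deriv i j k p"
proof -
  have s: "smooth_on ball3 rot_coeff"
    unfolding rot_coeff_def[abs_def] by (intro smooth_rules open_ball3) (simp add: ball3_nz)
  have sc: "smooth_on ball3 (\<lambda>q. if j = k then 1 / (bdry q)\<^sup>2 else 0)"
    by (cases "j = k"; simp; intro smooth_rules open_ball3; simp add: ball3_nz)
  note d = smooth_on_imp_differentiable[OF _ open_ball3 p]
  have "partial i (\<lambda>q. anderson_metric 2 q $ j $ k) p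
      = partial i (\<lambda>q. (if j = k then 1 / (bdry q)\<^sup>2 else 0) + (-1) * (rot_coeff q * (rot q $ j * rot q $ k))) p"
    by (rule partial_cong[OF open_ball3 p]) (simp add: metric_entry rot_coeff_def)
  also have "\<dots> = partial i (\<lambda>q. if j = k then 1 / (bdry q)\<^sup>2 else 0) p
      + (-1) * (rot_coeff p * (rot p $ j * partial i (\<lambda>q. rot q $ k) p + partial i (\<lambda>q. rot q $ j) p * rot p $ k)
         + partial i rot_coeff p * (rot p $ j * rot p $ k))"
    by (subst partial_add partial_cmult partial_mult; (intro d smooth_rules open_ball3 s sc)?)+ simp
  also have "partial i (\<lambda>q. if j = k then 1 / (bdry q)\<^sup>2 else 0) p = (if j = k then 4 * p $ i / (bdry p)^3 else 0)"
    using exhaust_3[of i] axial_deriv_partial[OF axial_deriv_conf[OF p]]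
    by (cases "j = k") (auto simp: partial_def)
  also have "partial i rot_coeff p = (vector [2 * p $ 1 * rot_coeff1 p, 2 * p $ 2 * rot_coeff1 p, rot_coeff3 p] :: real^3) $ i"
    using exhaust_3[of i] axial_deriv_partial[OF axial_deriv_rot_coeff[OF p]] by auto
  finally show ?thesis by (simp add: metric_deriv_def partial_rot)
qed

text \<open>Up to the factor \<open>- 1/2\<close>, the coefficient of \<open>r r\<^sup>T\<close>, \<open>r = rot p\<close>, that the part \<open>- rot_coeff \<cdot> r r\<^sup>T\<close> of the metric
contributes to the Hessian: the derivative of \<open>rot_coeff\<close> along the field, and a term from the derivatives of \<open>r\<close>.\<close>

definition rot_weight where
  "rot_weight c p = (bdry p)\<^sup>2 * (4 * axis_sq p * rot_coeff1 p * pot1 c p + rot_coeff3 p * pot3 c p + 8 * rot_coeff p * pot1 c p)"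

text \<open>The covariant Hessian of the potential, that is, the covariant derivative of its gradient
  with both indices lowered.\<close>

definition cov_hess :: "real \<Rightarrow> real^3 \<Rightarrow> real^3^3" where
  "cov_hess c p = (\<chi> i k. pot_hess c p $ i $ k
     - 2 / bdry p * (pot_grad c p $ k * p $ i + pot_grad c p $ i * p $ k)
     + (if i = k then 2 / bdry p * (p \<bullet> pot_grad c p) else 0)
     - rot_weight c p / 2 * (rot p $ i * rot p $ k))"

lemma cov_hess_sym: "cov_hess c p $ i $ k = cov_hess c p $ k $ i"
  by (simp add: cov_hess_def pot_hess_sym[of c p i k] algebra_simps)

lemma lower_christoffel:
  assumes p: "p \<in> ball3"
  shows "(\<Sum>l\<in>UNIV. anderson_metric 2 p $ k $ l * christoffel (anderson_metric 2) l i j p)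
    = (metric_deriv i j k p + metric_deriv j i k p - metric_deriv k i j p) / 2"
proof -
  define v :: "real^3" where "v = (\<chi> m. (metric_deriv i j m p + metric_deriv j i m p - metric_deriv m i j p) / 2)"
  have "(\<chi> l. christoffel (anderson_metric 2) l i j p) = metric_inv p *v v"
    unfolding christoffel_def partial_metric[OF p] matrix_inv_metric[OF p]
    by (simp add: vec_eq_iff matrix_vector_mult_def v_def sum_divide_distrib)
  then have "anderson_metric 2 p *v (\<chi> l. christoffel (anderson_metric 2) l i j p) = v"
    by (simp add: metric_metric_inv[OF p])
  then have "(anderson_metric 2 p *v (\<chi> l. christoffel (anderson_metric 2) l i j p)) $ k = v $ k" by simp
  then show ?thesis by (simp add: matrix_vector_mult_def v_def)
qed

lemma metric_deriv_sym: "metric_deriv i j k p = metric_deriv i k j p"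
  by (simp add: metric_deriv_def mult_ac add_ac)

text \<open>Lowering the index in the formula for the covariant derivative turns it into \<open>\<partial>\<^sub>i \<omega>\<^sub>k - \<Gamma>\<^sub>j\<^sub>i\<^sub>k X\<^sup>j\<close>, where \<open>\<Gamma>\<^sub>j\<^sub>i\<^sub>k\<close> is
the Christoffel symbol of the first kind, half a combination of derivatives of the metric.\<close>

lemma metric_deriv_field:
  assumes p: "p \<in> ball3"
  shows "pot_hess c p $ i $ k - (\<Sum>j\<in>UNIV. (metric_deriv i k j p - metric_deriv j i k p + metric_deriv k i j p) / 2
      * ((bdry p)\<^sup>2 * pot_grad c p $ j)) = cov_hess c p $ i $ k"
proof -
  have nz: "bdry p \<noteq> 0" by (rule ball3_nz[OF p])
  have q: "4 * x / (bdry p)^3 * (bdry p)\<^sup>2 = 4 * x / bdry p" for x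
    using nz by (simp add: power2_eq_square power3_eq_cube)
  \<comment> \<open>In terms of \<open>m\<close> and \<open>E2\<close> no quotients are left, and the claim is an identity of polynomials.\<close>
  define m b b1 b3 A Z E2 where "m = 1 / (bdry p)^3" and "b = rot_coeff p" and "b1 = rot_coeff1 p" and "b3 = rot_coeff3 p"
    and "A = pot1 c p" and "Z = pot3 c p" and "E2 = (bdry p)\<^sup>2"
  define x y z where "x = p $ 1" and "y = p $ 2" and "z = p $ 3"
  have e3: "4 * v / (bdry p)^3 = 4 * v * m" "2 / bdry p = 2 * (m * E2)" for v
    using nz by (simp_all add: m_def E2_def eval_nat_numeral)
  show ?thesis
    unfolding cov_hess_def rot_weight_def metric_deriv_def axis_sq_def sum_3 e3 inner_vec_def
      pot_grad_nth rot_nth b_def[symmetric] b1_def[symmetric] b3_def[symmetric] A_def[symmetric]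
      Z_def[symmetric] E2_def[symmetric] x_def[symmetric] y_def[symmetric] z_def[symmetric]
    using exhaust_3[of i] exhaust_3[of k]
    by (elim disjE; simp only: rot_jac_nth index_3_neq simp_thms if_True if_False vec_lambda_beta vector_3
        rot_nth pot_grad_nth inner_real_def A_def[symmetric] Z_def[symmetric]
        x_def[symmetric] y_def[symmetric] z_def[symmetric]; simp add: field_simps power2_eq_square)
qed

lemma lower_cov_deriv:
  assumes c: "c > 0" and p: "p \<in> ball3"
  shows "anderson_metric 2 p *v (cov_deriv (anderson_metric 2) (harm_field c) p $ i) = cov_hess c p $ i"
proof -
  let ?G = "anderson_metric 2" and ?X = "harm_field c"
  have X: "?X p $ j = (bdry p)\<^sup>2 * pot_grad c p $ j" for j using p by (simp add: harm_field_def)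
  have "(?G p *v (cov_deriv ?G ?X p $ i)) $ k = cov_hess c p $ i $ k" for k
  proof -
    have sX: "smooth_on ball3 (\<lambda>p. ?X p $ l)" for l
      using harm_field_harmonic[OF c] by (simp add: harmonic_vec_fields_def)
    note d = smooth_on_imp_differentiable[OF _ open_ball3 p]
    have "pot_hess c p $ i $ k = partial i (\<lambda>q. \<Sum>l\<in>UNIV. ?G q $ k $ l * ?X q $ l) p"
      using partial_cong[OF open_ball3 p, of "\<lambda>q. \<Sum>l\<in>UNIV. ?G q $ k $ l * ?X q $ l" "\<lambda>q. pot_grad c q $ k" i]
        flat_harm_field[of _ c] partial_pot_grad[OF c p] by (simp add: flat_def vec_eq_iff matrix_vector_mult_def)
    also have "\<dots> = (\<Sum>l\<in>UNIV. ?G p $ k $ l * partial i (\<lambda>q. ?X q $ l) p + metric_deriv i k l p * ?X p $ l)"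
      by (subst partial_sum, intro d smooth_rules open_ball3 sX, subst partial_mult)
         (auto intro!: d smooth_rules open_ball3 sX simp: partial_metric[OF p])
    finally have h: "pot_hess c p $ i $ k = (\<Sum>l\<in>UNIV. ?G p $ k $ l * partial i (\<lambda>q. ?X q $ l) p) + (\<Sum>l\<in>UNIV. metric_deriv i k l p * ?X p $ l)"
      by (simp add: sum.distrib)
    have "(\<Sum>l\<in>UNIV. ?G p $ k $ l * (\<Sum>j\<in>UNIV. christoffel ?G l i j p * ?X p $ j))
        = (\<Sum>j\<in>UNIV. (\<Sum>l\<in>UNIV. ?G p $ k $ l * christoffel ?G l i j p) * ?X p $ j)"
      unfolding sum_distrib_left sum_distrib_right by (subst sum.swap) (simp add: mult_ac)
    also have "\<dots> = (\<Sum>j\<in>UNIV. (metric_deriv i j k p + metric_deriv j i k p - metric_deriv k i j p) / 2 * ?X p $ j)"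
      by (simp add: lower_christoffel[OF p])
    finally have "(?G p *v (cov_deriv ?G ?X p $ i)) $ k = pot_hess c p $ i $ k
       - (\<Sum>l\<in>UNIV. metric_deriv i k l p * ?X p $ l)
       + (\<Sum>j\<in>UNIV. (metric_deriv i j k p + metric_deriv j i k p - metric_deriv k i j p) / 2 * ?X p $ j)"
      by (simp add: matrix_vector_mult_def cov_deriv_def distrib_left sum.distrib h)
    also have "\<dots> = pot_hess c p $ i $ k - (\<Sum>j\<in>UNIV. (metric_deriv i k j p - metric_deriv j i k p + metric_deriv k i j p) / 2 * ?X p $ j)"
      unfolding diff_add_eq[symmetric] diff_diff_eq2[symmetric]
      by (simp add: sum_subtractf[symmetric] metric_deriv_sym[of i _ k] sum_3 field_simps)
    also have "\<dots> = cov_hess c p $ i $ k" unfolding X by (rule metric_deriv_field[OF p])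
    finally show ?thesis .
  qed
  then show ?thesis by (simp add: vec_eq_iff)
qed

text \<open>The eigenvalue of the Hessian on the rotation field, after cancellation of two terms of order \<open>1 / E\<close>, one from the
conformal factor and one from \<open>rot_weight\<close>. The cancellation is essential, because the inverse metric is larger by a factor of order
\<open>1 / E\<close> in that direction.\<close>

definition ang_hess where
  "ang_hess c p = pot1 c p * (2 * axis_sq p * (2 / hsum p - 2 * bdry p * (2 - hsum p) / ((hsum p)\<^sup>2 * pole_dist p)) + 4 * bdry p / hsum p)
     + pot3 c p * (2 * p $ 3 / hsum p + 2 * p $ 3 * bdry p / (hsum p * pole_dist p))"

lemma rot_cov_hess:
  assumes p: "p \<in> ball3"
  shows "rot p \<bullet> cov_hess c p $ i = ang_hess c p * rot p $ i"
proof -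
  note nz = ball3_nz[OF p] and f = ball3_facts[OF p]
  have *: "2 * A + 2 / E * (2 * al * A + z * Z) - E\<^sup>2 * (4 * al * (8 / (E^3 * S\<^sup>2) - 8 * (2 - S) / (E\<^sup>2 * S^3 * D)) * A
        + (16 * z / (E^3 * S\<^sup>2) + 16 * z / (E\<^sup>2 * S\<^sup>2 * D)) * Z + 8 * (4 / (E\<^sup>2 * S\<^sup>2)) * A) / 2 * al
      = A * (2 * al * (2 / S - 2 * E * (2 - S) / (S\<^sup>2 * D)) + 4 * E / S) + Z * (2 * z / S + 2 * z * E / (S * D))"
    if "E \<noteq> 0" "D \<noteq> 0" "S \<noteq> 0" "S = D + E" "4 * al = S * (D - E)" for A Z E S D al z :: real
    using that(1-3) by (simp add: divide_simps) (use that(4,5) in algebra)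
  have k: "ang_hess c p = 2 * pot1 c p + 2 / bdry p * (2 * axis_sq p * pot1 c p + p $ 3 * pot3 c p) - rot_weight c p / 2 * axis_sq p"
    unfolding rot_weight_def rot_coeff_def rot_coeff1_def rot_coeff3_def ang_hess_def
    by (rule *[OF nz f(6,7), symmetric])
  have pg: "p \<bullet> pot_grad c p = 2 * axis_sq p * pot1 c p + p $ 3 * pot3 c p"
    by (simp add: inner_vec_def sum_3 pot_grad_nth axis_sq_def power2_eq_square algebra_simps)
  define x y where "x = p $ 1" and "y = p $ 2"
  show ?thesis
    unfolding k inner_vec_def[of "rot p"] sum_3 cov_hess_def pg
    using exhaust_3[of i]
    by (elim disjE; simp add: pot_hess_def pot_grad_nth axis_sq_def power2_eq_square algebra_simps)
qed

lemma vec_norm_harm_field: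
  assumes p: "p \<in> ball3"
  shows "vec_norm (anderson_metric 2) (harm_field c) p = bdry p * norm (pot_grad c p)"
proof -
  have "harm_field c p \<bullet> (anderson_metric 2 p *v harm_field c p) = (bdry p)\<^sup>2 * (norm (pot_grad c p))\<^sup>2"
    using flat_harm_field[OF p, of c] p by (simp add: flat_def harm_field_def power2_norm_eq_inner)
  then show ?thesis using ball3_facts(1)[OF p] by (simp add: vec_norm_def real_sqrt_mult)
qed

text \<open>The inverse metric is \<open>E\<^sup>2\<close> times the identity plus a multiple of \<open>r r\<^sup>T\<close>, and \<open>r\<close> is an eigenvector of the symmetric
matrix \<open>cov_hess\<close>, so the norm only involves the entries of that matrix and its eigenvalue on \<open>r\<close>.\<close>

lemma endo_norm_harm_field:
  assumes c: "c > 0" and p: "p \<in> ball3"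
  shows "endo_norm (anderson_metric 2) (cov_deriv (anderson_metric 2) (harm_field c)) p
    = bdry p * sqrt ((\<Sum>i\<in>UNIV. \<Sum>k\<in>UNIV. (bdry p * cov_hess c p $ i $ k)\<^sup>2)
        + (4 * bdry p * axis_sq p / hsum p + 4 * (axis_sq p)\<^sup>2 / (hsum p)\<^sup>2) * (ang_hess c p)\<^sup>2)"
proof -
  let ?G = "anderson_metric 2 p" and ?T = "cov_deriv (anderson_metric 2) (harm_field c) p"
  define H where "H = cov_hess c p"
  define E where "E = bdry p"
  define h where "h = ang_hess c p"
  define r where "r = rot p"
  define g where "g = 2 * bdry p / hsum p"
  have GT: "?G *v ?T $ j = H $ j" for j using lower_cov_deriv[OF c p] by (simp add: H_def)
  have T: "?T $ i = E\<^sup>2 *\<^sub>R H $ i + (g * (r \<bullet> H $ i)) *\<^sub>R r" for i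
    using metric_metric_inv'[OF p, of "?T $ i"] unfolding GT metric_inv_mult by (simp add: E_def g_def r_def)
  have rH: "r \<bullet> H $ i = h * r $ i" for i using rot_cov_hess[OF p] by (simp add: r_def H_def h_def)
  have TH: "?T $ i \<bullet> H $ j = E\<^sup>2 * (H $ i \<bullet> H $ j) + g * h\<^sup>2 * (r $ i * r $ j)" for i j
    unfolding T inner_add_left inner_scaleR_left rH by (simp add: power2_eq_square)
  have rr: "(\<Sum>i\<in>UNIV. r $ i * r $ i) = axis_sq p" using rot_inner_rot[of p] by (simp add: r_def inner_vec_def)
  have "(\<Sum>i\<in>UNIV. r $ i *\<^sub>R H $ i) = h *\<^sub>R r"
  proof -
    have "(\<Sum>i\<in>UNIV. r $ i *\<^sub>R H $ i) $ k = h * r $ k" for k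
      using rH[of k] cov_hess_sym[of c p _ k] by (simp add: inner_vec_def H_def)
    then show ?thesis by (simp add: vec_eq_iff)
  qed
  then have rrH: "(\<Sum>i\<in>UNIV. \<Sum>j\<in>UNIV. r $ i * r $ j * (H $ i \<bullet> H $ j)) = h\<^sup>2 * axis_sq p"
  proof -
    have "(\<Sum>i\<in>UNIV. \<Sum>j\<in>UNIV. r $ i * r $ j * (H $ i \<bullet> H $ j)) = (\<Sum>i\<in>UNIV. r $ i *\<^sub>R H $ i) \<bullet> (\<Sum>j\<in>UNIV. r $ j *\<^sub>R H $ j)"
      by (simp only: inner_sum_left) (simp add: inner_sum_right sum_distrib_left mult_ac)
    also have "\<dots> = h\<^sup>2 * (r \<bullet> r)"
      unfolding \<open>(\<Sum>i\<in>UNIV. r $ i *\<^sub>R H $ i) = h *\<^sub>R r\<close> by (simp add: power2_eq_square)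
    finally show ?thesis by (simp add: r_def rot_inner_rot)
  qed
  have inv: "matrix_inv ?G $ i $ j = (if i = j then E\<^sup>2 else 0) + g * (r $ i * r $ j)" for i j
    by (simp add: matrix_inv_metric[OF p] metric_inv_def E_def g_def r_def)
  have "(\<Sum>i\<in>UNIV. \<Sum>j\<in>UNIV. matrix_inv ?G $ i $ j * (?T $ i \<bullet> (?G *v ?T $ j)))
    = (\<Sum>i\<in>UNIV. \<Sum>j\<in>UNIV. (if i = j then E\<^sup>2 else 0) * (?T $ i \<bullet> H $ j))
      + g * (E\<^sup>2 * (\<Sum>i\<in>UNIV. \<Sum>j\<in>UNIV. r $ i * r $ j * (H $ i \<bullet> H $ j))
             + g * h\<^sup>2 * (\<Sum>i\<in>UNIV. \<Sum>j\<in>UNIV. r $ i * r $ j * (r $ i * r $ j)))"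
    unfolding inv GT distrib_right sum.distrib
    by (simp add: TH sum_distrib_left sum.distrib algebra_simps)
  also have "(\<Sum>i\<in>UNIV. \<Sum>j\<in>UNIV. r $ i * r $ j * (r $ i * r $ j)) = (axis_sq p)\<^sup>2"
    unfolding rr[symmetric] power2_eq_square sum_product by (simp add: mult_ac)
  also have "(\<Sum>i\<in>UNIV. \<Sum>j\<in>UNIV. (if i = j then E\<^sup>2 else 0) * (?T $ i \<bullet> H $ j))
     = E\<^sup>2 * (E\<^sup>2 * (\<Sum>i\<in>UNIV. H $ i \<bullet> H $ i) + g * h\<^sup>2 * axis_sq p)"
  proof -
    have "(\<Sum>j\<in>UNIV. (if i = j then E\<^sup>2 else 0) * (?T $ i \<bullet> H $ j)) = E\<^sup>2 * (?T $ i \<bullet> H $ i)" for i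
      using exhaust_3[of i] by (auto simp: sum_3)
    then show ?thesis unfolding rr[symmetric] by (simp add: TH sum.distrib sum_distrib_left algebra_simps)
  qed
  also have "E\<^sup>2 * (E\<^sup>2 * (\<Sum>i\<in>UNIV. H $ i \<bullet> H $ i) + g * h\<^sup>2 * axis_sq p)
      + g * (E\<^sup>2 * (\<Sum>i\<in>UNIV. \<Sum>j\<in>UNIV. r $ i * r $ j * (H $ i \<bullet> H $ j)) + g * h\<^sup>2 * (axis_sq p)\<^sup>2)
    = E\<^sup>2 * (E\<^sup>2 * (\<Sum>i\<in>UNIV. H $ i \<bullet> H $ i)) + (2 * E\<^sup>2 * g * axis_sq p + g\<^sup>2 * (axis_sq p)\<^sup>2) * h\<^sup>2"
    unfolding rrH by (simp add: power2_eq_square algebra_simps)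
  also have "E\<^sup>2 * (\<Sum>i\<in>UNIV. H $ i \<bullet> H $ i) = (\<Sum>i\<in>UNIV. \<Sum>k\<in>UNIV. (E * H $ i $ k)\<^sup>2)"
    by (simp add: inner_vec_def sum_distrib_left power_mult_distrib power2_eq_square mult_ac)
  also have "2 * E\<^sup>2 * g * axis_sq p + g\<^sup>2 * (axis_sq p)\<^sup>2 = E\<^sup>2 * (4 * E * axis_sq p / hsum p + 4 * (axis_sq p)\<^sup>2 / (hsum p)\<^sup>2)"
    using ball3_nz[OF p] by (simp add: g_def E_def power_divide power_mult_distrib algebra_simps power2_eq_square)
  finally have "(\<Sum>i\<in>UNIV. \<Sum>j\<in>UNIV. matrix_inv ?G $ i $ j * (?T $ i \<bullet> (?G *v ?T $ j)))
    = E\<^sup>2 * ((\<Sum>i\<in>UNIV. \<Sum>k\<in>UNIV. (E * H $ i $ k)\<^sup>2)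
        + (4 * E * axis_sq p / hsum p + 4 * (axis_sq p)\<^sup>2 / (hsum p)\<^sup>2) * h\<^sup>2)"
    by (simp add: algebra_simps)
  then show ?thesis
    using ball3_facts(1)[OF p] by (simp add: endo_norm_def real_sqrt_mult E_def H_def h_def)
qed

section \<open>Growth at the poles\<close>

text \<open>Near the poles the geometric quantities blow up at most like a power of the distance, whereas the potential and its
derivatives decay faster than any power. A product of the two kinds is of the second kind, so that no power needs to be
tracked.\<close>

definition moderate :: "(real^3 \<Rightarrow> real) \<Rightarrow> bool" where
  "moderate f \<longleftrightarrow> (\<exists>C k. 0 \<le> C \<and> (\<forall>p\<in>ball3. \<bar>f p\<bar> \<le> C / pole_dist p ^ k))"

text \<open>Kept apart from \<open>moderate\<close> so that the rules below are syntax-directed on quotients.\<close>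

definition moderate_recip :: "(real^3 \<Rightarrow> real) \<Rightarrow> bool" where
  "moderate_recip f \<longleftrightarrow> moderate (\<lambda>p. 1 / f p)"

definition rapid :: "(real^3 \<Rightarrow> real) \<Rightarrow> bool" where
  "rapid f \<longleftrightarrow> (\<forall>k. \<exists>C\<ge>0. \<forall>p\<in>ball3. \<bar>f p\<bar> \<le> C * pole_dist p ^ k)"

lemma moderate_bounded: "(\<And>p. p \<in> ball3 \<Longrightarrow> \<bar>f p\<bar> \<le> C) \<Longrightarrow> moderate f"
proof -
  assume b: "\<And>p. p \<in> ball3 \<Longrightarrow> \<bar>f p\<bar> \<le> C"
  have "(0::real^3) \<in> ball3" by (simp add: ball3_def)
  from b[OF this] have "0 \<le> C" by linarith
  then show "moderate f" unfolding moderate_def using b by (intro exI[of _ C] exI[of _ 0]) auto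
qed

lemma moderate_raise:
  assumes "p \<in> ball3" "0 \<le> C"
  shows "C / pole_dist p ^ k \<le> C * 2 ^ l / pole_dist p ^ (k + l)"
proof -
  note f = ball3_facts[OF assms(1)]
  have "C / pole_dist p ^ k = C * pole_dist p ^ l / pole_dist p ^ (k + l)"
    using f(3) by (simp add: power_add)
  also have "\<dots> \<le> C * 2 ^ l / pole_dist p ^ (k + l)"
    using f(3,12) assms(2) by (intro divide_right_mono mult_left_mono power_mono) auto
  finally show ?thesis .
qed

lemma moderate_const: "moderate (\<lambda>_. c)" by (rule moderate_bounded[of _ "\<bar>c\<bar>"]) simp

lemma moderate_minus: "moderate f \<Longrightarrow> moderate (\<lambda>p. - f p)" by (simp add: moderate_def)

lemma moderate_add:
  assumes "moderate f" "moderate g" shows "moderate (\<lambda>p. f p + g p)"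
proof -
  obtain C k where C: "0 \<le> C" "\<And>p. p \<in> ball3 \<Longrightarrow> \<bar>f p\<bar> \<le> C / pole_dist p ^ k"
    using assms(1) unfolding moderate_def by blast
  obtain C' k' where C': "0 \<le> C'" "\<And>p. p \<in> ball3 \<Longrightarrow> \<bar>g p\<bar> \<le> C' / pole_dist p ^ k'"
    using assms(2) unfolding moderate_def by blast
  have "\<bar>f p + g p\<bar> \<le> (C * 2 ^ k' + C' * 2 ^ k) / pole_dist p ^ (k + k')" if p: "p \<in> ball3" for p
    using C(2)[OF p] C'(2)[OF p] moderate_raise[OF p C(1), of k k'] moderate_raise[OF p C'(1), of k' k]
    by (simp add: add_divide_distrib add.commute[of k' k])
  then show ?thesis unfolding moderate_def using C(1) C'(1)
    by (intro exI[of _ "C * 2 ^ k' + C' * 2 ^ k"] exI[of _ "k + k'"]) auto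
qed

lemma moderate_diff: "moderate f \<Longrightarrow> moderate g \<Longrightarrow> moderate (\<lambda>p. f p - g p)"
  using moderate_add[of f "\<lambda>p. - g p"] moderate_minus by simp

lemma moderate_mult:
  assumes "moderate f" "moderate g" shows "moderate (\<lambda>p. f p * g p)"
proof -
  obtain C k where C: "0 \<le> C" "\<And>p. p \<in> ball3 \<Longrightarrow> \<bar>f p\<bar> \<le> C / pole_dist p ^ k"
    using assms(1) unfolding moderate_def by blast
  obtain C' k' where C': "0 \<le> C'" "\<And>p. p \<in> ball3 \<Longrightarrow> \<bar>g p\<bar> \<le> C' / pole_dist p ^ k'"
    using assms(2) unfolding moderate_def by blast
  have "\<bar>f p * g p\<bar> \<le> (C * C') / pole_dist p ^ (k + k')" if p: "p \<in> ball3" for p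
  proof -
    have "\<bar>f p * g p\<bar> \<le> (C / pole_dist p ^ k) * (C' / pole_dist p ^ k')"
      unfolding abs_mult using C(1) ball3_facts(3)[OF p] by (intro mult_mono C(2) C'(2) p) auto
    then show ?thesis by (simp add: power_add)
  qed
  then show ?thesis unfolding moderate_def using C(1) C'(1)
    by (intro exI[of _ "C * C'"] exI[of _ "k + k'"]) auto
qed

lemma moderate_power: "moderate f \<Longrightarrow> moderate (\<lambda>p. f p ^ n)"
  by (induction n) (auto intro: moderate_const moderate_mult)

lemma moderate_divide: "moderate f \<Longrightarrow> moderate_recip g \<Longrightarrow> moderate (\<lambda>p. f p / g p)"
  using moderate_mult[of f "\<lambda>p. 1 / g p"] by (simp add: moderate_recip_def)

lemma moderate_recip_mult: "moderate_recip f \<Longrightarrow> moderate_recip g \<Longrightarrow> moderate_recip (\<lambda>p. f p * g p)"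
  using moderate_mult[of "\<lambda>p. 1 / f p" "\<lambda>p. 1 / g p"] by (simp add: moderate_recip_def)

lemma moderate_recip_power: "moderate_recip f \<Longrightarrow> moderate_recip (\<lambda>p. f p ^ n)"
  using moderate_power[of "\<lambda>p. 1 / f p" n] by (simp add: moderate_recip_def power_one_over)

lemma moderate_recip_pole: "moderate_recip pole_dist"
  unfolding moderate_recip_def moderate_def using ball3_facts(3)
  by (intro exI[of _ 1] exI[of _ "1::nat"]) (simp add: abs_of_pos)

lemma moderate_recip_hsum: "moderate_recip hsum"
  unfolding moderate_recip_def moderate_def
proof (intro exI[of _ 1] exI[of _ "1::nat"] conjI ballI)
  fix p :: "real^3" assume "p \<in> ball3"
  note f = ball3_facts[OF this]
  show "\<bar>1 / hsum p\<bar> \<le> 1 / pole_dist p ^ 1"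
    using f(1,3,4,6) by (simp add: frac_le)
qed simp

lemma moderate_nth: "moderate (\<lambda>p. p $ i)"
proof (rule moderate_bounded[of _ 1])
  fix p :: "real^3" assume "p \<in> ball3"
  then show "\<bar>p $ i\<bar> \<le> 1" using component_le_norm_cart[of p i] by (simp add: ball3_def)
qed

lemma moderate_basic: "moderate axis_sq" "moderate bdry" "moderate pole_dist" "moderate hsum"
proof -
  show "moderate axis_sq" by (rule moderate_bounded[of _ 1]) (simp add: axis_sq_nonneg ball3_facts(10))
  show "moderate bdry" by (rule moderate_bounded[of _ 1]) (simp add: abs_of_pos ball3_facts(1,2))
  show "moderate pole_dist" by (rule moderate_bounded[of _ 2]) (simp add: abs_of_pos ball3_facts(3,12))
  show "moderate hsum"
  proof (rule moderate_bounded[of _ 3])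
    fix p assume "p \<in> ball3"
    then show "\<bar>hsum p\<bar> \<le> 3" using ball3_facts(2,4,6,12)[of p] by linarith
  qed
qed

lemma moderate_axis_slope: "moderate axis_slope"
  unfolding axis_slope_def[abs_def] by (intro moderate_add moderate_mult moderate_const moderate_basic)

lemmas moderate_rules = moderate_add moderate_diff moderate_minus moderate_mult moderate_power moderate_divide
  moderate_const moderate_nth moderate_basic moderate_axis_slope
  moderate_recip_mult moderate_recip_power moderate_recip_pole moderate_recip_hsum

lemma moderate_slopes: "moderate rad1" "moderate rad3" "moderate ax1" "moderate ax3"
  "moderate rad11" "moderate rad13" "moderate rad33" "moderate ax11" "moderate ax13" "moderate ax33"
  unfolding rad1_def[abs_def] rad3_def[abs_def] ax1_def[abs_def] ax3_def[abs_def] rad11_def[abs_def]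
    rad13_def[abs_def] rad33_def[abs_def] ax11_def[abs_def] ax13_def[abs_def] ax33_def[abs_def]
  by (intro moderate_rules)+

lemma rapid_cong: "rapid f \<Longrightarrow> (\<And>p. p \<in> ball3 \<Longrightarrow> \<bar>g p\<bar> \<le> \<bar>f p\<bar>) \<Longrightarrow> rapid g"
  unfolding rapid_def by (meson order_trans)

lemma rapid_eqI: "rapid f \<Longrightarrow> (\<And>p. p \<in> ball3 \<Longrightarrow> g p = f p) \<Longrightarrow> rapid g"
  by (erule rapid_cong) simp

lemma rapid_add:
  assumes "rapid f" "rapid g" shows "rapid (\<lambda>p. f p + g p)"
  unfolding rapid_def
proof
  fix k
  obtain C C' where C: "0 \<le> C" "\<And>p. p \<in> ball3 \<Longrightarrow> \<bar>f p\<bar> \<le> C * pole_dist p ^ k"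
    and C': "0 \<le> C'" "\<And>p. p \<in> ball3 \<Longrightarrow> \<bar>g p\<bar> \<le> C' * pole_dist p ^ k"
    using assms unfolding rapid_def by meson
  have "\<bar>f p + g p\<bar> \<le> (C + C') * pole_dist p ^ k" if "p \<in> ball3" for p
    using C(2)[OF that] C'(2)[OF that] by (simp add: distrib_right)
  then show "\<exists>C\<ge>0. \<forall>p\<in>ball3. \<bar>f p + g p\<bar> \<le> C * pole_dist p ^ k" using C(1) C'(1) by (intro exI[of _ "C + C'"]) auto
qed

lemma rapid_minus: "rapid f \<Longrightarrow> rapid (\<lambda>p. - f p)" by (simp add: rapid_def)

lemma rapid_abs: "rapid f \<Longrightarrow> rapid (\<lambda>p. \<bar>f p\<bar>)" by (simp add: rapid_def)

lemma rapid_diff: "rapid f \<Longrightarrow> rapid g \<Longrightarrow> rapid (\<lambda>p. f p - g p)"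
  using rapid_add[of f "\<lambda>p. - g p"] rapid_minus by simp

lemma rapid_mult:
  assumes "rapid f" "moderate g" shows "rapid (\<lambda>p. f p * g p)"
  unfolding rapid_def
proof
  fix k
  obtain C l where C: "0 \<le> C" "\<And>p. p \<in> ball3 \<Longrightarrow> \<bar>g p\<bar> \<le> C / pole_dist p ^ l"
    using assms(2) unfolding moderate_def by blast
  obtain C' where C': "0 \<le> C'" "\<And>p. p \<in> ball3 \<Longrightarrow> \<bar>f p\<bar> \<le> C' * pole_dist p ^ (k + l)"
    using assms(1) unfolding rapid_def by meson
  have "\<bar>f p * g p\<bar> \<le> (C' * C) * pole_dist p ^ k" if p: "p \<in> ball3" for p
  proof -
    have D: "pole_dist p > 0" by (rule ball3_facts[OF p])
    have "\<bar>f p * g p\<bar> \<le> (C' * pole_dist p ^ (k + l)) * (C / pole_dist p ^ l)"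
      unfolding abs_mult using C' D by (intro mult_mono C(2) C'(2) p) auto
    then show ?thesis using D by (simp add: power_add mult_ac)
  qed
  then show "\<exists>C\<ge>0. \<forall>p\<in>ball3. \<bar>f p * g p\<bar> \<le> C * pole_dist p ^ k" using C(1) C'(1) by (intro exI[of _ "C' * C"]) auto
qed

lemma rapid_imp_moderate: "rapid f \<Longrightarrow> moderate f"
  unfolding rapid_def moderate_def by (metis div_by_1 mult.right_neutral power_0)

lemma rapid_power: "rapid f \<Longrightarrow> n > 0 \<Longrightarrow> rapid (\<lambda>p. f p ^ n)"
  using rapid_mult[of f "\<lambda>p. f p ^ (n - 1)"] moderate_power[OF rapid_imp_moderate]
  by (cases n) auto

lemma rapid_sqrt:
  assumes "rapid f" shows "rapid (\<lambda>p. sqrt (f p))"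
  unfolding rapid_def
proof
  fix k
  obtain C where C: "0 \<le> C" "\<And>p. p \<in> ball3 \<Longrightarrow> \<bar>f p\<bar> \<le> C * pole_dist p ^ (2 * k)"
    using assms unfolding rapid_def by meson
  have "\<bar>sqrt (f p)\<bar> \<le> sqrt C * pole_dist p ^ k" if p: "p \<in> ball3" for p
  proof -
    have "\<bar>sqrt (f p)\<bar> = sqrt \<bar>f p\<bar>" by (simp add: abs_if real_sqrt_minus)
    also have "\<dots> \<le> sqrt (C * pole_dist p ^ (2 * k))" using C(2)[OF p] by simp
    also have "\<dots> = sqrt C * pole_dist p ^ k"
      using ball3_facts(3)[OF p] by (simp add: real_sqrt_mult power_even_eq)
    finally show ?thesis .
  qed
  then show "\<exists>C\<ge>0. \<forall>p\<in>ball3. \<bar>sqrt (f p)\<bar> \<le> C * pole_dist p ^ k" using C(1) by (intro exI[of _ "sqrt C"]) auto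
qed

text \<open>\<open>exp (4t)\<close> is the quotient of the squared distances to the poles. The larger of the two is at least \<open>1\<close>.\<close>

lemma exp_axial_var_le:
  assumes p: "p \<in> ball3"
  shows "exp (- (2 * real k) * \<bar>axial_var p\<bar>) \<le> pole_dist p ^ k"
proof -
  define u v where "u = (1 + p $ 3)\<^sup>2 + axis_sq p" and "v = (1 - p $ 3)\<^sup>2 + axis_sq p"
  have pos: "u > 0" "v > 0" and uv: "u * v = (pole_dist p)\<^sup>2"
    using pole_factors_pos[OF p] by (auto simp: u_def v_def)
  have t: "4 * axial_var p = ln (u / v)" by (simp add: axial_var_def u_def v_def)
  have *: "exp (- 4 * \<bar>axial_var p\<bar>) \<le> (pole_dist p)\<^sup>2"
  proof (cases "p $ 3 \<ge> 0")
    case True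
    then have u1: "u \<ge> 1" using axis_sq_nonneg[of p] by (simp add: u_def power2_eq_square algebra_simps)
    have "exp (- 4 * \<bar>axial_var p\<bar>) \<le> exp (- (4 * axial_var p))" by simp
    also have "\<dots> = v / u" unfolding t using pos by (simp add: exp_minus)
    also have "\<dots> \<le> u * v" 
    proof -
      have "v * 1 \<le> v * (u * u)" using u1 pos by (intro mult_left_mono) (auto intro: mult_ge1_I)
      then show ?thesis using pos by (simp add: divide_le_eq mult_ac)
    qed
    finally show ?thesis by (simp add: uv)
  next
    case False
    then have v1: "v \<ge> 1" using axis_sq_nonneg[of p] by (simp add: v_def power2_eq_square algebra_simps)
      (smt (verit) mult_nonneg_nonneg mult_minus_right zero_le_square)
    have "exp (- 4 * \<bar>axial_var p\<bar>) \<le> exp (4 * axial_var p)" by simp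
    also have "\<dots> = u / v" unfolding t using pos by simp
    also have "\<dots> \<le> u * v" 
    proof -
      have "u * 1 \<le> u * (v * v)" using v1 pos by (intro mult_left_mono) (auto intro: mult_ge1_I)
      then show ?thesis using pos by (simp add: divide_le_eq mult_ac)
    qed
    finally show ?thesis by (simp add: uv)
  qed
  have "(exp (- 2 * \<bar>axial_var p\<bar>))\<^sup>2 = exp (- 4 * \<bar>axial_var p\<bar>)" by (simp flip: exp_of_nat_mult)
  then have "exp (- 2 * \<bar>axial_var p\<bar>) \<le> pole_dist p"
    using * ball3_facts(3)[OF p] power2_le_imp_le[of "exp (- 2 * \<bar>axial_var p\<bar>)" "pole_dist p"] by linarith
  then have "exp (- 2 * \<bar>axial_var p\<bar>) ^ k \<le> pole_dist p ^ k" by (intro power_mono) auto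
  moreover have "exp (- 2 * \<bar>axial_var p\<bar>) ^ k = exp (- (2 * real k) * \<bar>axial_var p\<bar>)"
    unfolding exp_of_nat_mult[symmetric] by simp
  ultimately show ?thesis by simp
qed

lemma rapid_lifted_wave:
  assumes c: "c > 0"
  shows "rapid (lifted_wave c a 0)" "rapid (lifted_wave c a 1)" "rapid (\<lambda>p. bdry p * lifted_wave c a 2 p)"
proof -
  have "\<exists>M\<ge>0. \<forall>p\<in>ball3. \<bar>lifted_wave c a 0 p\<bar> \<le> M * pole_dist p ^ k \<and> \<bar>lifted_wave c a 1 p\<bar> \<le> M * pole_dist p ^ k \<and>
     \<bar>bdry p * lifted_wave c a 2 p\<bar> \<le> (2 * M) * pole_dist p ^ k" for k
  proof -
    obtain M where M: "M \<ge> 0" and b: "\<And>x t. 0 \<le> x \<Longrightarrow> x < 1 \<Longrightarrow> \<bar>wave c a 0 x t\<bar> \<le> M * exp (- (2 * real k) * \<bar>t\<bar>) \<and>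
     \<bar>wave c a 1 x t\<bar> \<le> M * exp (- (2 * real k) * \<bar>t\<bar>) \<and> \<bar>(1 - x) * wave c a 2 x t\<bar> \<le> M * exp (- (2 * real k) * \<bar>t\<bar>)"
      using wave_bound[OF c, of "2 * real k" a] by auto
    have "\<bar>lifted_wave c a 0 p\<bar> \<le> M * pole_dist p ^ k \<and> \<bar>lifted_wave c a 1 p\<bar> \<le> M * pole_dist p ^ k \<and>
     \<bar>bdry p * lifted_wave c a 2 p\<bar> \<le> (2 * M) * pole_dist p ^ k" if p: "p \<in> ball3" for p
    proof -
      note f = ball3_facts[OF p]
      have e: "M * exp (- (2 * real k) * \<bar>axial_var p\<bar>) \<le> M * pole_dist p ^ k"
        using M exp_axial_var_le[OF p] by (intro mult_left_mono) auto
      have x: "bdry p = (1 - radial_var p) * (hsum p / 2)" using f(4) by (simp add: radial_var_def)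
      have "hsum p / 2 \<le> 2" using f(2,6,12) by simp
      have "\<bar>bdry p * lifted_wave c a 2 p\<bar> = \<bar>(1 - radial_var p) * wave c a 2 (radial_var p) (axial_var p)\<bar> * (hsum p / 2)"
        unfolding x lifted_wave_def using f(4) by (simp add: abs_mult)
      also have "\<dots> \<le> (M * pole_dist p ^ k) * 2"
      proof (rule mult_mono)
        show "\<bar>(1 - radial_var p) * wave c a 2 (radial_var p) (axial_var p)\<bar> \<le> M * pole_dist p ^ k"
          using b[OF radial_var_range[OF p], of "axial_var p"] e by linarith
      qed (use M f(3,4) \<open>hsum p / 2 \<le> 2\<close> in auto)
      finally show ?thesis using b[OF radial_var_range[OF p], of "axial_var p"] e by (auto simp: lifted_wave_def)
    qed
    then show ?thesis using M by blast
  qed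
  note * = this
  show "rapid (lifted_wave c a 0)" "rapid (lifted_wave c a 1)" unfolding rapid_def using * by meson+
  show "rapid (\<lambda>p. bdry p * lifted_wave c a 2 p)" unfolding rapid_def
    using * by (metis mult_nonneg_nonneg zero_le_numeral)
qed

lemma rapid_pot:
  assumes c: "c > 0"
  shows "rapid (pot1 c)" "rapid (pot3 c)" "rapid (\<lambda>p. bdry p * pot11 c p)"
    "rapid (\<lambda>p. bdry p * pot13 c p)" "rapid (\<lambda>p. bdry p * pot33 c p)"
proof -
  note r = rapid_lifted_wave[OF c]
  show "rapid (pot1 c)" "rapid (pot3 c)" unfolding pot1_def[abs_def] pot3_def[abs_def]
    by (intro rapid_add rapid_mult r moderate_slopes)+
  have *: "rapid (\<lambda>p. bdry p * ((lifted_wave c 0 2 p * a p + lifted_wave c 1 1 p * b p) * a' p + lifted_wave c 0 1 p * m p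
      + (lifted_wave c 1 1 p * a p + lifted_wave c 2 0 p * b p) * b' p + lifted_wave c 1 0 p * n p))"
    if "moderate a" "moderate b" "moderate a'" "moderate b'" "moderate m" "moderate n" for a b a' b' m n
  proof -
    have "rapid (\<lambda>p. (bdry p * lifted_wave c 0 2 p) * (a p * a' p) + lifted_wave c 1 1 p * (bdry p * (b p * a' p + a p * b' p))
       + lifted_wave c 0 1 p * (bdry p * m p) + lifted_wave c 2 0 p * (bdry p * (b p * b' p)) + lifted_wave c 1 0 p * (bdry p * n p))"
      by (intro rapid_add rapid_mult r moderate_add moderate_mult moderate_basic that)
    then show ?thesis by (rule rapid_cong) (simp add: algebra_simps)
  qed
  show "rapid (\<lambda>p. bdry p * pot11 c p)" "rapid (\<lambda>p. bdry p * pot13 c p)" "rapid (\<lambda>p. bdry p * pot33 c p)"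
    unfolding pot11_def pot13_def pot33_def by (rule *; rule moderate_slopes)+
qed

lemma rapid_pot_grad: "c > 0 \<Longrightarrow> rapid (\<lambda>p. pot_grad c p $ i)"
proof -
  assume c: "c > 0"
  have "rapid (\<lambda>p. pot1 c p * (2 * p $ j))" for j by (intro rapid_mult rapid_pot c moderate_rules)
  then have "rapid (\<lambda>p. 2 * p $ j * pot1 c p)" for j
    by (rule rapid_cong[of "\<lambda>p. pot1 c p * (2 * p $ j)"]) (simp add: mult_ac)
  then show ?thesis using exhaust_3[of i] rapid_pot(2)[OF c] by (elim disjE; simp only: pot_grad_nth)
qed

lemma rapid_pot_hess:
  assumes c: "c > 0" shows "rapid (\<lambda>p. bdry p * pot_hess c p $ i $ k)"
proof -
  define w :: "3 \<Rightarrow> real^3 \<Rightarrow> real" where "w i p = (if i = 3 then 0 else 2 * p $ i)" for i p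
  define e :: "3 \<Rightarrow> real" where "e i = (if i = 3 then 1 else 0)" for i
  define d :: "3 \<Rightarrow> 3 \<Rightarrow> real" where "d i k = (if i = k \<and> i \<noteq> 3 then 2 else 0)" for i k
  have h: "pot_hess c p $ i $ k = pot1 c p * d i k + pot11 c p * (w i p * w k p)
      + pot13 c p * (w i p * e k + e i * w k p) + pot33 c p * (e i * e k)" for p
    using exhaust_3[of i] exhaust_3[of k]
    by (elim disjE; simp add: pot_hess_def w_def e_def d_def power2_eq_square)
  have w: "moderate (w i)" for i unfolding w_def by (cases "i = 3"; simp; intro moderate_rules)
  have "rapid (\<lambda>p. pot1 c p * (bdry p * d i k) + (bdry p * pot11 c p) * (w i p * w k p)
      + (bdry p * pot13 c p) * (w i p * e k + e i * w k p) + (bdry p * pot33 c p) * (e i * e k))"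
    by (intro rapid_add rapid_mult rapid_pot c moderate_add moderate_mult moderate_const moderate_basic w)
  then show ?thesis by (rule rapid_cong) (simp add: h algebra_simps)
qed

lemma rapid_rot_weight:
  assumes c: "c > 0" shows "rapid (\<lambda>p. bdry p * rot_weight c p)"
proof -
  have "rapid (\<lambda>p. pot1 c p * (4 * axis_sq p * (8 / (hsum p)^2 - 8 * bdry p * (2 - hsum p) / ((hsum p)^3 * pole_dist p))
       + 32 * bdry p / (hsum p)^2) + pot3 c p * (16 * p $ 3 / (hsum p)^2 + 16 * p $ 3 * bdry p / ((hsum p)^2 * pole_dist p)))"
    by (intro rapid_add rapid_mult rapid_pot c moderate_rules)
  then show ?thesis
    unfolding rot_weight_def rot_coeff_def rot_coeff1_def rot_coeff3_def
  proof (rule rapid_eqI, goal_cases)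
    case (1 p)
    then show ?case using ball3_nz[of p] by (simp add: divide_simps) algebra
  qed
qed

lemma moderate_rot: "moderate (\<lambda>p. rot p $ i)"
  using exhaust_3[of i] by (elim disjE; simp; intro moderate_rules)

text \<open>The factor \<open>E\<close> compensates both the singular terms of order \<open>1 / E\<close> in the Hessian and the growth of the second
radial derivative at the boundary.\<close>

lemma rapid_cov_hess:
  assumes c: "c > 0" shows "rapid (\<lambda>p. bdry p * cov_hess c p $ i $ k)"
proof -
  have "rapid (\<lambda>p. bdry p * pot_hess c p $ i $ k - (pot_grad c p $ k * (2 * p $ i) + pot_grad c p $ i * (2 * p $ k))
     + (pot_grad c p $ 1 * (p $ 1 * d) + pot_grad c p $ 2 * (p $ 2 * d) + pot_grad c p $ 3 * (p $ 3 * d))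
     - (bdry p * rot_weight c p) * (1 / 2 * (rot p $ i * rot p $ k)))" for d
    by (intro rapid_add rapid_diff rapid_mult rapid_pot_hess rapid_pot_grad rapid_rot_weight c moderate_mult
        moderate_const moderate_nth moderate_rot)
  from this[of "if i = k then 2 else 0"] show ?thesis
  proof (rule rapid_eqI)
    have *: "E * (h - 2 / E * (g + g') + (if Q then 2 / E * (u1 * v1 + u2 * v2 + u3 * v3) else 0) - w / 2 * (r * r'))
      = E * h - 2 * (g + g') + (v1 * (u1 * (if Q then 2 else 0)) + v2 * (u2 * (if Q then 2 else 0)) + v3 * (u3 * (if Q then 2 else 0)))
        - E * w * (1 / 2 * (r * r'))"
      if "E \<noteq> 0" for E h g g' u1 v1 u2 v2 u3 v3 w r r' :: real and Q
      using that by (cases Q) (simp_all add: field_simps)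
    fix p :: "real^3" assume p: "p \<in> ball3"
    show "bdry p * cov_hess c p $ i $ k = bdry p * pot_hess c p $ i $ k
       - (pot_grad c p $ k * (2 * p $ i) + pot_grad c p $ i * (2 * p $ k))
       + (pot_grad c p $ 1 * (p $ 1 * (if i = k then 2 else 0)) + pot_grad c p $ 2 * (p $ 2 * (if i = k then 2 else 0))
          + pot_grad c p $ 3 * (p $ 3 * (if i = k then 2 else 0)))
       - (bdry p * rot_weight c p) * (1 / 2 * (rot p $ i * rot p $ k))"
      unfolding cov_hess_def vec_lambda_beta inner_vec_def sum_3 inner_real_def *[OF ball3_nz(1)[OF p]]
      by (simp add: algebra_simps)
  qed
qed

lemma rapid_ang_hess: "c > 0 \<Longrightarrow> rapid (ang_hess c)"
  unfolding ang_hess_def[abs_def] by (intro rapid_add rapid_mult rapid_pot moderate_rules)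

lemma rapid_field_norms:
  assumes c: "c > 0"
  shows "rapid (\<lambda>p. norm (pot_grad c p))"
    and "rapid (\<lambda>p. sqrt ((\<Sum>i\<in>UNIV. \<Sum>k\<in>UNIV. (bdry p * cov_hess c p $ i $ k)\<^sup>2)
        + (4 * bdry p * axis_sq p / hsum p + 4 * (axis_sq p)\<^sup>2 / (hsum p)\<^sup>2) * (ang_hess c p)\<^sup>2))"
proof -
  have "rapid (\<lambda>p. \<bar>pot_grad c p $ 1\<bar> + \<bar>pot_grad c p $ 2\<bar> + \<bar>pot_grad c p $ 3\<bar>)"
    by (intro rapid_add rapid_abs rapid_pot_grad c)
  then show "rapid (\<lambda>p. norm (pot_grad c p))"
  proof (rule rapid_cong)
    fix p show "\<bar>norm (pot_grad c p)\<bar> \<le> \<bar>\<bar>pot_grad c p $ 1\<bar> + \<bar>pot_grad c p $ 2\<bar> + \<bar>pot_grad c p $ 3\<bar>\<bar>"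
      using norm_le_l1_cart[of "pot_grad c p"] by (simp add: sum_3)
  qed
  have "rapid (\<lambda>p. (\<Sum>i\<in>UNIV. \<Sum>k\<in>UNIV. (bdry p * cov_hess c p $ i $ k)\<^sup>2)
        + (ang_hess c p)\<^sup>2 * (4 * bdry p * axis_sq p / hsum p + 4 * (axis_sq p)\<^sup>2 / (hsum p)\<^sup>2))"
    unfolding sum_3
    by (intro rapid_add rapid_mult rapid_power rapid_cov_hess rapid_ang_hess c moderate_rules; simp)
  then show "rapid (\<lambda>p. sqrt ((\<Sum>i\<in>UNIV. \<Sum>k\<in>UNIV. (bdry p * cov_hess c p $ i $ k)\<^sup>2)
        + (4 * bdry p * axis_sq p / hsum p + 4 * (axis_sq p)\<^sup>2 / (hsum p)\<^sup>2) * (ang_hess c p)\<^sup>2))"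
    by (intro rapid_sqrt) (simp add: mult.commute)
qed

text \<open>The density is \<open>\<surd>(2 / (E\<^sup>5 S))\<close>, and \<open>E\<^sup>n \<le> E\<^sup>2\<close>. One power of \<open>D\<close> from the rapid factor absorbs \<open>1 / \<surd>S\<close>, since
\<open>S \<ge> D\<close>.\<close>

lemma density_power_bound:
  assumes R: "rapid R" "\<And>p. p \<in> ball3 \<Longrightarrow> 0 \<le> R p" and n: "n \<ge> 2"
  shows "\<exists>C. \<forall>p\<in>ball3. vol_density (anderson_metric 2) p * (bdry p * R p) ^ n \<le> C / sqrt (bdry p)"
proof -
  have "rapid (\<lambda>p. R p ^ n)" using n by (intro rapid_power R) auto
  then have "\<exists>C\<ge>0. \<forall>p\<in>ball3. \<bar>R p ^ n\<bar> \<le> C * pole_dist p ^ 1" unfolding rapid_def by blast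
  then obtain C where C: "C \<ge> 0" "\<And>p. p \<in> ball3 \<Longrightarrow> \<bar>R p ^ n\<bar> \<le> C * pole_dist p" by auto
  have "vol_density (anderson_metric 2) p * (bdry p * R p) ^ n \<le> (2 * C) / sqrt (bdry p)" if p: "p \<in> ball3" for p
  proof -
    note f = ball3_facts[OF p]
    let ?E = "bdry p" and ?D = "pole_dist p" and ?S = "hsum p"
    have En: "?E ^ n \<le> ?E\<^sup>2" using f(1,2) n by (intro power_decreasing) auto
    have "vol_density (anderson_metric 2) p * (?E * R p) ^ n = sqrt (2 / (?E^5 * ?S)) * (?E ^ n * R p ^ n)"
      by (simp add: vol_density_metric[OF p] power_mult_distrib)
    also have "\<dots> \<le> sqrt (2 / (?E^5 * ?S)) * (?E\<^sup>2 * (C * ?D))"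
      using C(1) C(2)[OF p] En f(1,3,4) R(2)[OF p] by (intro mult_left_mono mult_mono) auto
    also have "\<dots> = sqrt (2 / (?E^5 * ?S) * (?E\<^sup>2)\<^sup>2) * (C * ?D)"
      by (simp only: real_sqrt_mult real_sqrt_abs) simp
    also have "2 / (?E^5 * ?S) * (?E\<^sup>2)\<^sup>2 = (1 / ?E) * (2 / ?S)"
      using ball3_nz[OF p] by (simp add: field_simps eval_nat_numeral)
    also have "sqrt ((1 / ?E) * (2 / ?S)) * (C * ?D) = C / sqrt ?E * (sqrt (2 / ?S) * ?D)"
      by (simp add: real_sqrt_mult real_sqrt_divide)
    also have "\<dots> \<le> C / sqrt ?E * 2"
    proof (rule mult_left_mono)
      have "sqrt (2 / ?S) * ?D = sqrt (2 / ?S * ?D\<^sup>2)"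
        using f(3) by (simp only: real_sqrt_mult real_sqrt_abs abs_of_pos)
      also have "\<dots> \<le> sqrt 4"
      proof (rule real_sqrt_le_mono)
        have "2 / ?S * ?D\<^sup>2 \<le> 2 / ?D * ?D\<^sup>2" using f(1,3,6) by (intro mult_right_mono divide_left_mono) auto
        also have "\<dots> = 2 * ?D" using f(3) by (simp add: power2_eq_square)
        finally show "2 / ?S * ?D\<^sup>2 \<le> 4" using f(12) by simp
      qed
      finally show "sqrt (2 / ?S) * ?D \<le> 2" by simp
    qed (use C(1) f(1) in auto)
    finally show ?thesis by (simp add: mult.commute)
  qed
  then show ?thesis by blast
qed

section \<open>Integrability of the boundary weight\<close>

lemma emeasure_ball3_shell:
  assumes "0 \<le> e" "e \<le> 1"
  shows "emeasure lborel {p::real^3. norm p < 1 \<and> 1 - e \<le> norm p} \<le> ennreal (3 * unit_ball_vol 3 * e)"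
proof -
  have e: "{p::real^3. norm p < 1 \<and> 1 - e \<le> norm p} = ball 0 1 - ball 0 (1 - e)" by auto
  have "emeasure lborel (ball (0::real^3) 1 - ball 0 (1 - e)) = emeasure lborel (ball (0::real^3) 1) - emeasure lborel (ball (0::real^3) (1 - e))"
    using assms by (intro emeasure_Diff) (auto simp: emeasure_ball)
  also have "\<dots> = ennreal (unit_ball_vol 3) - ennreal (unit_ball_vol 3 * (1 - e) ^ 3)"
    using assms by (simp add: emeasure_ball)
  also have "\<dots> = ennreal (unit_ball_vol 3 * (1 - (1 - e) ^ 3))"
    using assms by (subst ennreal_minus) (auto simp: algebra_simps)
  also have "\<dots> \<le> ennreal (3 * unit_ball_vol 3 * e)"
  proof (rule ennreal_leI)
    have "1 - (1 - e) ^ 3 = 3 * e - e\<^sup>2 * (3 - e)" by (simp add: power2_eq_square power3_eq_cube algebra_simps)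
    also have "\<dots> \<le> 3 * e" using assms by simp
    finally have "unit_ball_vol 3 * (1 - (1 - e) ^ 3) \<le> unit_ball_vol 3 * (3 * e)" by (intro mult_left_mono) auto
    then show "unit_ball_vol 3 * (1 - (1 - e) ^ 3) \<le> 3 * unit_ball_vol 3 * e" by (simp add: mult_ac)
  qed
  finally show ?thesis unfolding e .
qed

lemma ball3_sets: "ball3 \<in> sets lebesgue" "ball3 \<in> sets borel" by (simp_all add: ball3_def)

text \<open>Near the sphere the weight is comparable to the inverse square root of the distance to the sphere; sum
  over the shells on which that distance is at most \<open>4\<^sup>-\<^sup>n\<close>.\<close>

lemma integrable_bdry_weight: "integrable (lebesgue_on ball3) (\<lambda>p. 1 / sqrt (bdry p))"
proof -
  let ?f = "\<lambda>p::real^3. indicator ball3 p *\<^sub>R (1 / sqrt (bdry p))"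
  have bm: "bdry \<in> borel_measurable borel"
    unfolding bdry_eq[abs_def] by measurable
  have m: "?f \<in> borel_measurable lborel"
    using bm ball3_sets(2) by measurable
  define A where "A n = {p::real^3. norm p < 1 \<and> 1 - (1/4) ^ n \<le> norm p}" for n :: nat
  have Am [measurable]: "A n \<in> sets borel" for n
    unfolding A_def by measurable
  have le: "ennreal (norm (?f p)) \<le> (\<Sum>n. ennreal (2 ^ Suc n) * indicator (A n) p)" for p
  proof (cases "p \<in> ball3")
    case True
    then have r: "norm p < 1" by (simp add: ball3_def)
    obtain N where N: "(1/4::real) ^ N < 1 - norm p"
      using real_arch_pow_inv[of "1 - norm p" "1/4"] r by auto
    \<comment> \<open>The shell in which \<open>p\<close> lies has the index preceding \<open>n\<close>.\<close>
    define n where "n = (LEAST n. (1/4::real) ^ n < 1 - norm p)"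
    have n1: "(1/4::real) ^ n < 1 - norm p" unfolding n_def by (rule LeastI[of _ N]) (rule N)
    have "n \<noteq> 0" using n1 by (auto intro!: Nat.gr0I)
    then obtain k where k: "n = Suc k" by (cases n) auto
    have "\<not> (1/4::real) ^ k < 1 - norm p" using not_less_Least[of k "\<lambda>n. (1/4::real) ^ n < 1 - norm p"] k unfolding n_def by simp
    then have pA: "p \<in> A k" using r by (simp add: A_def)
    have "1 - norm p \<le> bdry p"
      unfolding bdry_eq using r by (simp add: power2_eq_square mult_left_le_one_le)
    then have "((1/2) ^ Suc k)\<^sup>2 \<le> bdry p" using n1 k by (simp add: power_mult_distrib power2_eq_square flip: power_mult_distrib)
    then have "(1/2) ^ Suc k \<le> sqrt (bdry p)" by (rule real_le_rsqrt)
    then have "1 / sqrt (bdry p) \<le> 1 / (1/2) ^ Suc k" by (intro divide_left_mono) (auto intro!: mult_pos_pos ball3_facts True)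
    then have "ennreal (norm (?f p)) \<le> ennreal (2 ^ Suc k) * indicator (A k) p"
      using True pA ball3_facts(1)[OF True] by (simp add: power_one_over ennreal_leI)
    also have "\<dots> \<le> (\<Sum>n. ennreal (2 ^ Suc n) * indicator (A n) p)"
      using sum_le_suminf[of "\<lambda>n. ennreal (2 ^ Suc n) * indicator (A n) p" "{k}"]
      by (simp only: sum.insert[OF finite.emptyI] sum.empty empty_iff not_False_eq_True add_0_right) simp
    finally show ?thesis .
  qed simp
  have "(\<integral>\<^sup>+p. ennreal (norm (?f p)) \<partial>lborel) \<le> (\<integral>\<^sup>+p. (\<Sum>n. ennreal (2 ^ Suc n) * indicator (A n) p) \<partial>lborel)"
    by (intro nn_integral_mono le)
  also have "\<dots> = (\<Sum>n. \<integral>\<^sup>+p. ennreal (2 ^ Suc n) * indicator (A n) p \<partial>lborel)"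
    by (intro nn_integral_suminf) measurable
  also have "\<dots> = (\<Sum>n. ennreal (2 ^ Suc n) * emeasure lborel (A n))"
    using Am by (intro suminf_cong) (simp add: nn_integral_cmult_indicator)
  also have "\<dots> \<le> (\<Sum>n. ennreal (6 * unit_ball_vol 3 * (1/2) ^ n))"
  proof (intro suminf_le)
    fix n
    have "ennreal (2 ^ Suc n) * emeasure lborel (A n) \<le> ennreal (2 ^ Suc n) * ennreal (3 * unit_ball_vol 3 * (1/4) ^ n)"
      unfolding A_def by (intro mult_left_mono emeasure_ball3_shell) (auto intro: power_le_one)
    also have "\<dots> = ennreal (2 ^ Suc n * (3 * unit_ball_vol 3 * (1/4) ^ n))"
      by (intro ennreal_mult'[symmetric]) auto
    also have "2 ^ Suc n * (3 * unit_ball_vol 3 * (1/4) ^ n) = 6 * unit_ball_vol 3 * (1/2) ^ n"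
    proof -
      have "(2::real) ^ n * (1/4) ^ n = (1/2) ^ n" by (simp flip: power_mult_distrib)
      then show ?thesis by simp
    qed
    finally show "ennreal (2 ^ Suc n) * emeasure lborel (A n) \<le> ennreal (6 * unit_ball_vol 3 * (1/2) ^ n)" .
  qed auto
  also have "\<dots> = ennreal (\<Sum>n. 6 * unit_ball_vol 3 * (1/2) ^ n)"
    by (intro suminf_ennreal_eq[OF _ summable_sums]) (auto intro!: summable_mult summable_geometric)
  also have "\<dots> < \<infinity>" by simp
  finally have "integrable lborel ?f" using m by (simp add: integrable_iff_bounded)
  then have "integrable lebesgue ?f" using integrable_completion[OF m] by simp
  then show ?thesis using ball3_sets by (subst integrable_restrict_space) auto
qed

section \<open>Weak and classical derivatives\<close>

lemma compact_support_integrable: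
  fixes f :: "real^'n \<Rightarrow> 'b::euclidean_space"
  assumes "compact K" "K \<subseteq> U" "U \<in> sets lebesgue" "continuous_on K f" "\<And>p. p \<in> U \<Longrightarrow> p \<notin> K \<Longrightarrow> f p = 0"
  shows "integrable (lebesgue_on U) f"
proof -
  have i: "integrable lborel (\<lambda>p. indicator K p *\<^sub>R f p)"
    by (rule borel_integrable_compact[OF assms(1,4)])
  then have "integrable lebesgue (\<lambda>p. indicator K p *\<^sub>R f p)"
    using integrable_completion[OF borel_measurable_integrable[OF i]] by simp
  moreover have "(\<lambda>p. indicator K p *\<^sub>R f p) = (\<lambda>p. indicator U p *\<^sub>R f p)"
    using assms(2,5) by (fastforce simp: indicator_def fun_eq_iff)
  ultimately show ?thesis using assms(3) by (subst integrable_restrict_space) auto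
qed

lemma partial_difference_quotient:
  assumes "f differentiable (at p)"
  shows "((\<lambda>t. (f (p + t *\<^sub>R axis i 1) - f p) / t) \<longlongrightarrow> partial i f p) (at 0)"
proof -
  obtain f' where f': "(f has_derivative f') (at p)" using assms unfolding differentiable_def by blast
  from has_field_derivative_along_axis[OF f', of i] show ?thesis
    using partial_eq_derivative[OF f', of i] by (simp add: has_field_derivative_iff)
qed

lemma DERIV_along_axis:
  assumes "f differentiable (at (p + t *\<^sub>R axis i 1))"
  shows "((\<lambda>t. f (p + t *\<^sub>R axis i 1)) has_field_derivative partial i f (p + t *\<^sub>R axis i 1)) (at t)"
proof -
  have "((\<lambda>h. (f (p + t *\<^sub>R axis i 1 + h *\<^sub>R axis i 1) - f (p + t *\<^sub>R axis i 1)) / h) \<longlongrightarrow> partial i f (p + t *\<^sub>R axis i 1)) (at 0)"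
    by (rule partial_difference_quotient[OF assms])
  then show ?thesis by (simp add: DERIV_def scaleR_add_left add.assoc)
qed

text \<open>Translation invariance of the integral makes the integral of each difference quotient vanish.\<close>

lemma integral_partial_eq_0:
  fixes f :: "real^'n \<Rightarrow> real"
  assumes d: "\<And>p. f differentiable (at p)" and c: "continuous_on UNIV (partial i f)"
    and K: "compact K" "\<And>p. p \<notin> K \<Longrightarrow> f p = 0"
  shows "(\<integral>p. partial i f p \<partial>lborel) = 0"
proof -
  let ?e = "axis i 1 :: real^'n"
  have ne: "norm ?e = 1" by simp
  obtain R where R: "K \<subseteq> cball 0 R" "R > 0"
    using bounded_subset_ballD[OF compact_imp_bounded[OF K(1)], of 0] ball_subset_cball by blast
  have fc: "continuous_on UNIV f"
    using d by (simp add: continuous_on_eq_continuous_at differentiable_imp_continuous_within)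
  have pz: "partial i f p = 0" if "p \<notin> K" for p
    by (rule partial_zero_on[of "- K"]) (use that K in \<open>auto simp: compact_imp_closed open_Compl\<close>)
  have "compact (partial i f ` K)" using K(1) c continuous_on_subset by (intro compact_continuous_image) blast
  then obtain B where B: "B > 0" "\<And>p. p \<in> K \<Longrightarrow> \<bar>partial i f p\<bar> \<le> B"
  proof -
    obtain B where "B > 0" "\<forall>x\<in>partial i f ` K. norm x \<le> B"
      using \<open>compact (partial i f ` K)\<close> compact_imp_bounded bounded_pos by metis
    then show ?thesis using that[of B] by auto
  qed
  have Bp: "\<bar>partial i f p\<bar> \<le> B" for p using B pz[of p] by (cases "p \<in> K") auto
  \<comment> \<open>The difference quotients are dominated by the mean value theorem.\<close>
  define q where "q n p = (f (p + (1 / real (Suc n)) *\<^sub>R ?e) - f p) / (1 / real (Suc n))" for n p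
  have fi: "integrable lborel f"
  proof -
    have "integrable lborel (\<lambda>x. indicator K x *\<^sub>R f x)"
      by (rule borel_integrable_compact[OF K(1)]) (use fc continuous_on_subset in blast)
    moreover have "(\<lambda>x. indicator K x *\<^sub>R f x) = f" using K(2) by (fastforce simp: indicator_def)
    ultimately show ?thesis by simp
  qed
  have fm: "f \<in> borel_measurable lborel" using fi by (rule borel_measurable_integrable)
  have tr: "integrable lborel (\<lambda>p. f (p + v)) \<and> (\<integral>p. f (p + v) \<partial>lborel) = (\<integral>p. f p \<partial>lborel)" for v
  proof -
    have "integrable (distr lborel borel ((+) v)) f" using fi by (simp add: lborel_distr_plus)
    then have "integrable lborel (\<lambda>p. f (v + p))" by (subst (asm) integrable_distr_eq) (use fm in auto)
    moreover have "(\<integral>p. f p \<partial>(distr lborel borel ((+) v))) = (\<integral>p. f (v + p) \<partial>lborel)"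
      by (rule integral_distr) (use fm in auto)
    ultimately show ?thesis by (simp add: lborel_distr_plus add.commute)
  qed
  have q0: "(\<integral>p. q n p \<partial>lborel) = 0" for n
    unfolding q_def using tr fi by (simp del: of_nat_Suc)
  have qm: "q n \<in> borel_measurable lborel" for n
    unfolding q_def using tr[THEN conjunct1, THEN borel_measurable_integrable] fm by measurable
  have qlim: "(\<lambda>n. q n p) \<longlonglongrightarrow> partial i f p" for p
  proof -
    have "filterlim (\<lambda>n. 1 / real (Suc n)) (at 0) sequentially"
      using LIMSEQ_inverse_real_of_nat by (auto simp: filterlim_at inverse_eq_divide)
    from filterlim_compose[OF partial_difference_quotient[OF d] this] show ?thesis unfolding q_def by simp
  qed
  have qb: "norm (q n p) \<le> B * indicator (cball 0 (R + 1)) p" for n p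
  proof (cases "p \<in> cball 0 (R + 1)")
    case True
    define h where "h = 1 / real (Suc n)"
    have h: "h > 0" by (simp add: h_def)
    have "\<exists>t. 0 < t \<and> t < h \<and> f (p + h *\<^sub>R ?e) - f (p + 0 *\<^sub>R ?e) = (h - 0) * partial i f (p + t *\<^sub>R ?e)"
      by (rule MVT2[OF h]) (rule DERIV_along_axis[OF d])
    then obtain t where "f (p + h *\<^sub>R ?e) - f p = h * partial i f (p + t *\<^sub>R ?e)" by auto
    then have "q n p = partial i f (p + t *\<^sub>R ?e)" using h unfolding q_def h_def[symmetric] by simp
    then show ?thesis using Bp True by simp
  next
    case False
    have "p \<notin> K" using False R by auto
    moreover have "p + (1 / real (Suc n)) *\<^sub>R ?e \<notin> K"
    proof
      assume "p + (1 / real (Suc n)) *\<^sub>R ?e \<in> K"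
      then have "norm (p + (1 / real (Suc n)) *\<^sub>R ?e) \<le> R" using R by auto
      moreover have "norm ((1 / real (Suc n)) *\<^sub>R ?e) \<le> 1" by simp
      moreover have "norm p \<le> norm (p + (1 / real (Suc n)) *\<^sub>R ?e) + norm ((1 / real (Suc n)) *\<^sub>R ?e)"
        by (metis add_diff_cancel_right' norm_triangle_ineq4)
      ultimately have "norm p \<le> R + 1" by linarith
      then show False using False by simp
    qed
    ultimately show ?thesis using K(2) False by (simp add: q_def)
  qed
  have "(\<lambda>n. \<integral>p. q n p \<partial>lborel) \<longlonglongrightarrow> (\<integral>p. partial i f p \<partial>lborel)"
  proof (rule integral_dominated_convergence[where w = "\<lambda>p. B * indicator (cball 0 (R + 1)) p"])
    show "partial i f \<in> borel_measurable lborel" using c borel_measurable_continuous_onI by auto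
    show "integrable lborel (\<lambda>p. B * indicat_real (cball (0::real^'n) (R + 1)) p)"
      by (intro integrable_mult_right integrable_real_indicator) (use emeasure_bounded_finite[OF bounded_cball] in \<open>auto simp: top.not_eq_extremum\<close>)
  qed (use qm qlim qb in auto)
  then show ?thesis unfolding q0 using LIMSEQ_unique tendsto_const by blast
qed

lemma test_function_facts:
  assumes "test_function_on U \<phi>"
  defines "K \<equiv> closure {p. \<phi> p \<noteq> 0}"
  shows "compact K" "K \<subseteq> U" "\<And>p. p \<notin> K \<Longrightarrow> \<phi> p = 0" "\<And>p. p \<notin> K \<Longrightarrow> partial i \<phi> p = 0"
    "smooth_on UNIV \<phi>" "continuous_on S \<phi>" "continuous_on S (partial i \<phi>)"
proof -
  show "compact K" "K \<subseteq> U" "smooth_on UNIV \<phi>" using assms by (auto simp: test_function_on_def)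
  show z: "\<phi> p = 0" if "p \<notin> K" for p using that closure_subset[of "{p. \<phi> p \<noteq> 0}"] by (auto simp: K_def)
  show "partial i \<phi> p = 0" if "p \<notin> K" for p
  proof (rule partial_zero_on)
    show "open (- K)" by (simp add: K_def open_Compl)
    show "p \<in> - K" using that by simp
    show "\<And>q. q \<in> - K \<Longrightarrow> \<phi> q = 0" using z by simp
  qed
  show "continuous_on S \<phi>" "continuous_on S (partial i \<phi>)"
    by (rule continuous_on_subset[OF smooth_on_imp_continuous[OF \<open>smooth_on UNIV \<phi>\<close>] subset_UNIV],
        rule continuous_on_subset[OF smooth_on_imp_continuous[OF smooth_on_partial[OF \<open>smooth_on UNIV \<phi>\<close>]] subset_UNIV])
qed

lemma continuous_on_UNIV_cover:
  fixes f :: "real^'n \<Rightarrow> real"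
  assumes "open U" "closed K" "K \<subseteq> U" "continuous_on U f" "\<And>p. p \<notin> K \<Longrightarrow> f p = 0"
  shows "continuous_on UNIV f"
proof -
  have "continuous_on (- K) f" by (rule continuous_on_eq[of _ "\<lambda>_. 0"]) (use assms(5) in auto)
  then have "continuous_on (U \<union> - K) f"
    using assms by (intro continuous_on_open_Un) (auto simp: open_Compl)
  moreover have "U \<union> - K = UNIV" using assms(3) by auto
  ultimately show ?thesis by simp
qed

text \<open>Extended by zero, the product of \<open>u\<close> with a test function is continuously differentiable on the whole space.\<close>

lemma integration_by_parts_test_function:
  fixes u :: "real^'n \<Rightarrow> real"
  assumes U: "open U" and u: "smooth_on U u" and \<phi>: "test_function_on U \<phi>"
  shows "(\<integral>p. u p * partial i \<phi> p \<partial>(lebesgue_on U)) = - (\<integral>p. partial i u p * \<phi> p \<partial>(lebesgue_on U))"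
proof -
  define K where "K = closure {p. \<phi> p \<noteq> 0}"
  note t = test_function_facts[OF \<phi>, folded K_def]
  note du = smooth_on_imp_differentiable[OF u U]
  note d\<phi> = smooth_on_imp_differentiable[OF t(5) open_UNIV UNIV_I]
  define g where "g p = (if p \<in> U then u p * \<phi> p else 0)" for p
  have gz: "g p = 0" if "p \<notin> K" for p using t(3)[OF that] by (simp add: g_def)
  have clK: "closed K" using t(1) by (rule compact_imp_closed)
  have pg: "partial i g p = u p * partial i \<phi> p + partial i u p * \<phi> p" if "p \<in> U" for p
    using partial_cong[OF U that, of g "\<lambda>p. u p * \<phi> p" i] partial_mult[OF du[OF that] d\<phi>] by (simp add: g_def)
  have pgz: "partial i g p = 0" if "p \<notin> K" for p
    by (rule partial_zero_on[of "- K"]) (use that gz clK in \<open>auto simp: open_Compl\<close>)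
  have gd: "g differentiable (at p)" for p
  proof (cases "p \<in> U")
    case True
    have "(\<lambda>p. u p * \<phi> p) differentiable (at p)" using du[OF True] d\<phi> by (intro differentiable_mult)
    then obtain D where "((\<lambda>p. u p * \<phi> p) has_derivative D) (at p)" unfolding differentiable_def by blast
    then have "(g has_derivative D) (at p)"
      by (rule has_derivative_transform_within_open[OF _ U True]) (simp add: g_def)
    then show ?thesis unfolding differentiable_def by blast
  next
    case False
    have "((\<lambda>p. 0) has_derivative (\<lambda>_. 0)) (at p)" by simp
    then have "(g has_derivative (\<lambda>_. 0)) (at p)"
      by (rule has_derivative_transform_within_open[of _ _ _ UNIV "- K"]) (use False t(2) gz clK in \<open>auto simp: open_Compl\<close>)
    then show ?thesis unfolding differentiable_def by blast
  qed
  have uc: "continuous_on U u" "continuous_on U (partial i u)"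
    using smooth_on_imp_continuous u smooth_on_partial by blast+
  have "continuous_on U (\<lambda>p. u p * partial i \<phi> p + partial i u p * \<phi> p)"
    by (intro continuous_intros uc t(6,7))
  then have "continuous_on U (partial i g)" by (rule continuous_on_eq) (simp add: pg)
  then have gc: "continuous_on UNIV (partial i g)"
    using continuous_on_UNIV_cover[OF U clK t(2)] pgz by blast
  have "(\<integral>p. partial i g p \<partial>lborel) = 0" by (rule integral_partial_eq_0[OF gd gc t(1) gz])
  then have "(\<integral>p. partial i g p \<partial>lebesgue) = 0"
    using integral_completion[of "partial i g" lborel] gc borel_measurable_continuous_onI by auto
  moreover have "(\<lambda>p. indicator U p *\<^sub>R partial i g p) = partial i g"
    using pgz t(2) by (fastforce simp: indicator_def)
  ultimately have 0: "(\<integral>p. partial i g p \<partial>(lebesgue_on U)) = 0"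
    using U by (subst integral_restrict_space) auto
  have Um: "U \<in> sets lebesgue" using U by auto
  have i1: "integrable (lebesgue_on U) (\<lambda>p. u p * partial i \<phi> p)"
    and i2: "integrable (lebesgue_on U) (\<lambda>p. partial i u p * \<phi> p)"
    using t(3,4) by (intro compact_support_integrable[OF t(1,2) Um] continuous_intros t(6,7) continuous_on_subset[OF uc(1) t(2)]
        continuous_on_subset[OF uc(2) t(2)]; simp)+
  have "(\<integral>p. partial i g p \<partial>(lebesgue_on U)) = (\<integral>p. u p * partial i \<phi> p + partial i u p * \<phi> p \<partial>(lebesgue_on U))"
    by (rule Bochner_Integration.integral_cong) (auto simp: pg)
  also have "\<dots> = (\<integral>p. u p * partial i \<phi> p \<partial>(lebesgue_on U)) + (\<integral>p. partial i u p * \<phi> p \<partial>(lebesgue_on U))"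
    by (rule Bochner_Integration.integral_add[OF i1 i2])
  finally show ?thesis using 0 by simp
qed

lemma continuous_imp_locally_integrable:
  assumes "continuous_on U F" shows "locally_integrable_on U F"
  unfolding locally_integrable_on_def
  by (intro allI impI compact_support_integrable[of K K for K])
     (use assms continuous_on_subset in \<open>auto intro: compact_imp_closed lmeasurable_compact fmeasurableD\<close>)

lemma has_weak_cov_deriv_cov_deriv:
  assumes U: "open U" and X: "\<And>k. smooth_on U (\<lambda>p. X p $ k)"
    and \<Gamma>: "\<And>k i j. continuous_on U (christoffel G k i j)"
  shows "has_weak_cov_deriv G U X (cov_deriv G X)" "continuous_on U X" "continuous_on U (cov_deriv G X)"
proof -
  have Xk: "continuous_on U (\<lambda>p. X p $ k)" for k by (rule smooth_on_imp_continuous[OF X])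
  have "continuous_on U (\<lambda>p. \<chi> k. X p $ k)" by (intro continuous_on_vec_lambda Xk)
  then show Xc: "continuous_on U X" by simp
  show Tc: "continuous_on U (cov_deriv G X)"
    unfolding cov_deriv_def[abs_def]
    by (intro continuous_on_vec_lambda continuous_intros \<Gamma> Xk smooth_on_imp_continuous[OF smooth_on_partial[OF X]])
  have "(\<integral>p. X p $ k * partial i \<phi> p \<partial>(lebesgue_on U)) =
        - (\<integral>p. (cov_deriv G X p $ i $ k - (\<Sum>j\<in>UNIV. christoffel G k i j p * X p $ j)) * \<phi> p \<partial>(lebesgue_on U))"
    if "test_function_on U \<phi>" for \<phi> i k
    using integration_by_parts_test_function[OF U X that] by (simp add: cov_deriv_def)
  then show "has_weak_cov_deriv G U X (cov_deriv G X)"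
    using Xc Tc by (simp add: has_weak_cov_deriv_def continuous_imp_locally_integrable)
qed

lemma christoffel_continuous: "continuous_on ball3 (christoffel (anderson_metric 2) k i j)"
  unfolding christoffel_def[abs_def]
  by (intro smooth_on_imp_continuous smooth_rules open_ball3 smooth_on_partial; simp)

section \<open>Linear combinations of harmonic fields\<close>

lemma partial_lincomb:
  assumes "f differentiable (at p)" "g differentiable (at p)"
  shows "partial i (\<lambda>q. a * f q + b * g q) p = a * partial i f p + b * partial i g p"
proof -
  have "(\<lambda>q. a * f q) differentiable (at p)" "(\<lambda>q. b * g q) differentiable (at p)"
    using assms by (auto intro: differentiable_mult)
  then show ?thesis using assms by (simp add: partial_add partial_cmult)
qed

lemma smooth_mult_vec:
  assumes "open U" "\<And>i j. smooth_on U (\<lambda>q. M q $ i $ j)" "\<And>j. smooth_on U (\<lambda>q. v q $ j)"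
  shows "smooth_on U (\<lambda>q. (M q *v v q) $ i)"
  unfolding matrix_vector_mult_def vec_lambda_beta by (intro smooth_rules assms)

lemma smooth_mult_mat:
  assumes "open U" "\<And>i j. smooth_on U (\<lambda>q. M q $ i $ j)" "\<And>i j. smooth_on U (\<lambda>q. N q $ i $ j)"
  shows "smooth_on U (\<lambda>q. (M q ** N q) $ i $ j)"
  unfolding matrix_matrix_mult_def vec_lambda_beta by (intro smooth_rules assms)

lemma mat_sandwich_lincomb:
  fixes A X Y :: "real^'n^'n"
  shows "(A ** (a *\<^sub>R X + b *\<^sub>R Y) ** A) $ i $ l = a * (A ** X ** A) $ i $ l + b * (A ** Y ** A) $ i $ l"
  by (simp add: matrix_matrix_mult_def sum.distrib sum_distrib_left sum_distrib_right algebra_simps)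

lemma vec_mult_lincomb:
  fixes A :: "real^'n^'m"
  shows "A *v (a *\<^sub>R x + b *\<^sub>R y) = a *\<^sub>R (A *v x) + b *\<^sub>R (A *v y)"
  by (simp add: matrix_vector_right_distrib matrix_vector_mult_scaleR)

lemma smooth_ext_d1:
  assumes "open U" "\<And>i. smooth_on U (\<lambda>q. \<omega> q $ i)"
  shows "smooth_on U (\<lambda>q. ext_d1 \<omega> q $ i $ j)"
  unfolding ext_d1_def vec_lambda_beta by (intro smooth_on_diff smooth_on_partial assms)

lemma hodge_laplacian_lincomb:
  fixes G :: "'n::finite metric_field"
  assumes U: "open U" and G: "\<And>i j. smooth_on U (\<lambda>q. matrix_inv (G q) $ i $ j)" "smooth_on U (vol_density G)"
      "\<And>q. q \<in> U \<Longrightarrow> vol_density G q \<noteq> 0"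
    and \<omega>: "\<And>i. smooth_on U (\<lambda>q. \<omega> q $ i)" and \<eta>: "\<And>i. smooth_on U (\<lambda>q. \<eta> q $ i)" and p: "p \<in> U"
  shows "hodge_laplacian G (\<lambda>q. a *\<^sub>R \<omega> q + b *\<^sub>R \<eta> q) p = a *\<^sub>R hodge_laplacian G \<omega> p + b *\<^sub>R hodge_laplacian G \<eta> p"
proof -
  let ?l = "\<lambda>q. a *\<^sub>R \<omega> q + b *\<^sub>R \<eta> q"
  let ?f = "\<lambda>\<zeta> i q. vol_density G q * (matrix_inv (G q) *v \<zeta> q) $ i"
  let ?h = "\<lambda>\<zeta> i l q. vol_density G q * (matrix_inv (G q) ** ext_d1 \<zeta> q ** matrix_inv (G q)) $ i $ l"
  note d = smooth_on_imp_differentiable[OF _ U]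
  have f: "smooth_on U (?f \<zeta> i)" if "\<And>i. smooth_on U (\<lambda>q. \<zeta> q $ i)" for \<zeta> i
    by (intro smooth_on_mult smooth_mult_vec U G that)
  have c1s: "smooth_on U (codiff1 G \<zeta>)" if "\<And>i. smooth_on U (\<lambda>q. \<zeta> q $ i)" for \<zeta>
    unfolding codiff1_def[abs_def]
    by (intro smooth_on_divide smooth_on_minus smooth_on_sum smooth_on_partial f that U G)
  have c1: "codiff1 G ?l q = a * codiff1 G \<omega> q + b * codiff1 G \<eta> q" if q: "q \<in> U" for q
  proof -
    have "partial i (?f ?l i) q
       = a * partial i (?f \<omega> i) q
       + b * partial i (?f \<eta> i) q" for i
      by (subst partial_lincomb[symmetric]) (auto intro!: d f \<omega> \<eta> q simp: vec_mult_lincomb algebra_simps)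
    then show ?thesis
      by (simp add: codiff1_def sum.distrib sum_distrib_left[symmetric] add_divide_distrib diff_divide_distrib)
  qed
  have e0: "ext_d0 (codiff1 G ?l) p = a *\<^sub>R ext_d0 (codiff1 G \<omega>) p + b *\<^sub>R ext_d0 (codiff1 G \<eta>) p"
  proof -
    have "partial i (codiff1 G ?l) p = a * partial i (codiff1 G \<omega>) p + b * partial i (codiff1 G \<eta>) p" for i
      using partial_cong[OF U p c1] partial_lincomb[OF d[OF c1s[OF \<omega>] p] d[OF c1s[OF \<eta>] p]] by simp
    then show ?thesis by (simp add: ext_d0_def vec_eq_iff)
  qed
  have d1: "ext_d1 ?l q = a *\<^sub>R ext_d1 \<omega> q + b *\<^sub>R ext_d1 \<eta> q" if q: "q \<in> U" for q
  proof -
    have "partial i (\<lambda>q. ?l q $ j) q = a * partial i (\<lambda>q. \<omega> q $ j) q + b * partial i (\<lambda>q. \<eta> q $ j) q" for i j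
      using partial_lincomb[OF d[OF \<omega> q] d[OF \<eta> q]] by simp
    then show ?thesis by (simp add: ext_d1_def vec_eq_iff algebra_simps)
  qed
  have h: "smooth_on U (?h \<zeta> i l)"
    if "\<And>i. smooth_on U (\<lambda>q. \<zeta> q $ i)" for \<zeta> i l
    by (intro smooth_on_mult smooth_mult_mat smooth_ext_d1 U G that)
  have "partial i (?h ?l i l) p
     = a * partial i (?h \<omega> i l) p
     + b * partial i (?h \<eta> i l) p" for i l
  proof -
    have "?h ?l i l q
      = a * (?h \<omega> i l q)
      + b * (?h \<eta> i l q)" if "q \<in> U" for q
      unfolding d1[OF that] mat_sandwich_lincomb by (simp add: algebra_simps)
    from partial_cong[OF U p this] partial_lincomb[OF d[OF h[OF \<omega>] p] d[OF h[OF \<eta>] p]]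
    show ?thesis by simp
  qed
  then have "(\<chi> l. - (\<Sum>i\<in>UNIV. partial i (?h ?l i l) p) / vol_density G p)
    = a *\<^sub>R (\<chi> l. - (\<Sum>i\<in>UNIV. partial i (?h \<omega> i l) p) / vol_density G p)
    + b *\<^sub>R (\<chi> l. - (\<Sum>i\<in>UNIV. partial i (?h \<eta> i l) p) / vol_density G p)"
    by (simp add: vec_eq_iff sum.distrib sum_distrib_left[symmetric] add_divide_distrib diff_divide_distrib)
  then have "codiff2 G (ext_d1 ?l) p = a *\<^sub>R codiff2 G (ext_d1 \<omega>) p + b *\<^sub>R codiff2 G (ext_d1 \<eta>) p"
    unfolding codiff2_def by (simp only: vec_mult_lincomb)
  then show ?thesis unfolding hodge_laplacian_def e0 by (simp add: algebra_simps)
qed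

lemma harmonic_lincomb:
  assumes X: "X \<in> harmonic_vec_fields (anderson_metric 2) ball3" and Y: "Y \<in> harmonic_vec_fields (anderson_metric 2) ball3"
  shows "(\<lambda>p. a *\<^sub>R X p + b *\<^sub>R Y p) \<in> harmonic_vec_fields (anderson_metric 2) ball3"
proof -
  let ?G = "anderson_metric 2"
  have s: "smooth_on ball3 (\<lambda>p. X p $ i)" "smooth_on ball3 (\<lambda>p. Y p $ i)" for i
    using X Y by (auto simp: harmonic_vec_fields_def)
  have fs: "smooth_on ball3 (\<lambda>p. flat ?G Z p $ i)" if "\<And>i. smooth_on ball3 (\<lambda>p. Z p $ i)" for Z i
    unfolding flat_def by (intro smooth_mult_vec open_ball3 smooth_metric that)
  have fl: "flat ?G (\<lambda>p. a *\<^sub>R X p + b *\<^sub>R Y p) = (\<lambda>p. a *\<^sub>R flat ?G X p + b *\<^sub>R flat ?G Y p)"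
    by (simp add: fun_eq_iff flat_def vec_mult_lincomb)
  have v: "vol_density ?G q \<noteq> 0" if "q \<in> ball3" for q
    using ball3_nz[OF that] by (simp add: vol_density_metric[OF that])
  have "smooth_on ball3 (\<lambda>p. (a *\<^sub>R X p + b *\<^sub>R Y p) $ i)" for i
    by (simp; intro smooth_rules open_ball3 s)
  moreover have "hodge_laplacian ?G (flat ?G (\<lambda>p. a *\<^sub>R X p + b *\<^sub>R Y p)) p = 0" if "p \<in> ball3" for p
    unfolding fl
    using hodge_laplacian_lincomb[OF open_ball3 smooth_metric_inv smooth_vol_density v fs[OF s(1)] fs[OF s(2)] that, of a b] X Y that
    by (simp add: harmonic_vec_fields_def)
  ultimately show ?thesis using X Y by (simp add: harmonic_vec_fields_def)
qed

section \<open>The Sobolev spaces are vector spaces\<close>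

lemma powr_sum_le:
  fixes x y c :: real
  assumes "0 \<le> x" "0 \<le> y" "0 \<le> c" "q > 0"
  shows "(c * (x + y)) powr q \<le> (2 * c) powr q * (x powr q + y powr q)"
proof -
  have "(c * (x + y)) powr q \<le> (2 * c * max x y) powr q"
  proof (rule powr_mono2)
    have "c * (x + y) \<le> c * (2 * max x y)" using assms(3) by (intro mult_left_mono) auto
    then show "c * (x + y) \<le> 2 * c * max x y" by (simp add: mult_ac)
  qed (use assms in auto)
  also have "\<dots> = (2 * c) powr q * (max x y) powr q" by (rule powr_mult)
  also have "\<dots> \<le> (2 * c) powr q * (x powr q + y powr q)"
    by (intro mult_left_mono) (auto simp: max_def)
  finally show ?thesis .
qed

lemma integrable_powr_of_le:
  fixes n n1 n2 :: "'a \<Rightarrow> real"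
  assumes "integrable M (\<lambda>x. n1 x powr q)" "integrable M (\<lambda>x. n2 x powr q)" "q > 0"
    "n \<in> borel_measurable M" "0 \<le> c"
    "\<And>x. x \<in> space M \<Longrightarrow> 0 \<le> n x \<and> 0 \<le> n1 x \<and> 0 \<le> n2 x \<and> n x \<le> c * (n1 x + n2 x)"
  shows "integrable M (\<lambda>x. n x powr q)"
proof (rule Bochner_Integration.integrable_bound)
  show "integrable M (\<lambda>x. (2 * c) powr q * (n1 x powr q + n2 x powr q))"
    by (intro integrable_mult_right Bochner_Integration.integrable_add assms(1,2))
  show "(\<lambda>x. n x powr q) \<in> borel_measurable M" using assms(4) by measurable
  have "n x powr q \<le> (2 * c) powr q * (n1 x powr q + n2 x powr q)" if "x \<in> space M" for x
    using powr_sum_le[of "n1 x" "n2 x" c q] powr_mono2[of q "n x" "c * (n1 x + n2 x)"] assms(3,5) assms(6)[OF that]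
    by linarith
  then show "AE x in M. norm (n x powr q) \<le> norm ((2 * c) powr q * (n1 x powr q + n2 x powr q))"
    by (intro AE_I2) simp
qed

text \<open>For membership in \<open>L\<^sup>q\<close> a triangle inequality up to a constant suffices. It follows from the parallelogram law for a
positive semidefinite form.\<close>

lemma sqrt_form_bound:
  assumes "(q::real) \<le> 2 * (a\<^sup>2 * x + b\<^sup>2 * y)" "0 \<le> x" "0 \<le> y"
  shows "sqrt q \<le> (2 * \<bar>a\<bar> + 2 * \<bar>b\<bar>) * (sqrt x + sqrt y)"
proof -
  have "a\<^sup>2 * x \<le> (\<bar>a\<bar> + \<bar>b\<bar>)\<^sup>2 * x" "b\<^sup>2 * y \<le> (\<bar>a\<bar> + \<bar>b\<bar>)\<^sup>2 * y"
    by (intro mult_right_mono assms; simp add: power2_sum)+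
  then have "q \<le> 2 * (\<bar>a\<bar> + \<bar>b\<bar>)\<^sup>2 * (x + y)" using assms(1) by (simp add: algebra_simps)
  also have "\<dots> \<le> (2 * (\<bar>a\<bar> + \<bar>b\<bar>))\<^sup>2 * (x + y)"
    unfolding power_mult_distrib using assms(2,3) by (intro mult_right_mono) auto
  also have "\<dots> \<le> (2 * (\<bar>a\<bar> + \<bar>b\<bar>))\<^sup>2 * (sqrt x + sqrt y)\<^sup>2"
    using assms(2,3) by (intro mult_left_mono) (auto simp: power2_sum)
  finally have "q \<le> ((2 * (\<bar>a\<bar> + \<bar>b\<bar>)) * (sqrt x + sqrt y))\<^sup>2" by (simp add: power_mult_distrib)
  then have "sqrt q \<le> (2 * (\<bar>a\<bar> + \<bar>b\<bar>)) * (sqrt x + sqrt y)"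
    using assms(2,3) by (intro real_le_lsqrt) auto
  then show ?thesis by (simp add: distrib_left)
qed

text \<open>The metric is \<open>1 / E\<^sup>2\<close> minus a multiple of \<open>r r\<^sup>T\<close>, so this is the Cauchy-Schwarz inequality for \<open>r = rot p\<close>.\<close>

lemma metric_form_nonneg:
  assumes p: "p \<in> ball3"
  shows "0 \<le> v \<bullet> (anderson_metric 2 p *v v)"
proof -
  note f = ball3_facts[OF p]
  let ?E = "bdry p" and ?S = "hsum p" and ?D = "pole_dist p"
  have "(rot p \<bullet> v)\<^sup>2 \<le> axis_sq p * (v \<bullet> v)"
    using Cauchy_Schwarz_ineq[of "rot p" v] by (simp add: rot_inner_rot)
  then have "4 / (?E\<^sup>2 * ?S\<^sup>2) * (rot p \<bullet> v)\<^sup>2 \<le> 4 / (?E\<^sup>2 * ?S\<^sup>2) * (axis_sq p * (v \<bullet> v))"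
    by (intro mult_left_mono) auto
  also have "\<dots> = (4 * axis_sq p / ?S\<^sup>2) * (1 / ?E\<^sup>2 * (v \<bullet> v))" by (simp add: mult_ac)
  also have "\<dots> \<le> 1 * (1 / ?E\<^sup>2 * (v \<bullet> v))"
  proof (rule mult_right_mono)
    have "4 * axis_sq p / ?S\<^sup>2 = (?D - ?E) / ?S" unfolding f(7) using f(4) by (simp add: power2_eq_square)
    also have "\<dots> \<le> 1" using f(1,4,6) by simp
    finally show "4 * axis_sq p / ?S\<^sup>2 \<le> 1" .
  qed simp
  finally show ?thesis
    unfolding metric_mult[OF p] inner_diff_right inner_scaleR_right inner_commute[of v "rot p"]
    by (simp add: power2_eq_square mult_ac)
qed

definition endo_form :: "real^3 \<Rightarrow> real^3^3 \<Rightarrow> real" where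
  "endo_form p T = (\<Sum>i\<in>UNIV. \<Sum>j\<in>UNIV. matrix_inv (anderson_metric 2 p) $ i $ j * (T $ i \<bullet> (anderson_metric 2 p *v T $ j)))"

lemma endo_form_nonneg:
  assumes p: "p \<in> ball3"
  shows "0 \<le> endo_form p T"
proof -
  note f = ball3_facts[OF p]
  let ?G = "anderson_metric 2 p" and ?r = "rot p"
  let ?s = "\<Sum>j\<in>UNIV. ?r $ j *\<^sub>R T $ j"
  have s: "?s \<bullet> (?G *v ?s) = (\<Sum>i\<in>UNIV. \<Sum>j\<in>UNIV. ?r $ i * ?r $ j * (T $ i \<bullet> (?G *v T $ j)))"
  proof -
    have "?G *v ?s = (\<Sum>j\<in>UNIV. ?r $ j *\<^sub>R (?G *v T $ j))"
      by (simp add: sum_3 matrix_vector_right_distrib matrix_vector_mult_scaleR matrix_vector_mult_diff_distrib)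
    then show ?thesis by (simp add: sum_3 inner_add_left inner_add_right algebra_simps)
  qed
  have "endo_form p T = (bdry p)\<^sup>2 * (\<Sum>i\<in>UNIV. T $ i \<bullet> (?G *v T $ i)) + 2 * bdry p / hsum p * (?s \<bullet> (?G *v ?s))"
    unfolding s endo_form_def matrix_inv_metric[OF p] metric_inv_def vec_lambda_beta
    by (simp add: sum_3 algebra_simps)
  also have "\<dots> \<ge> 0"
    using f(1,4) by (intro add_nonneg_nonneg mult_nonneg_nonneg sum_nonneg metric_form_nonneg p) auto
  finally show ?thesis .
qed

lemma vec_norm_lincomb:
  assumes p: "p \<in> ball3"
  shows "vec_norm (anderson_metric 2) (\<lambda>p. a *\<^sub>R X p + b *\<^sub>R Y p) p
    \<le> (2 * \<bar>a\<bar> + 2 * \<bar>b\<bar>) * (vec_norm (anderson_metric 2) X p + vec_norm (anderson_metric 2) Y p)"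
proof -
  let ?G = "anderson_metric 2 p"
  have "0 \<le> (a *\<^sub>R X p - b *\<^sub>R Y p) \<bullet> (?G *v (a *\<^sub>R X p - b *\<^sub>R Y p))" by (rule metric_form_nonneg[OF p])
  then have "(a *\<^sub>R X p + b *\<^sub>R Y p) \<bullet> (?G *v (a *\<^sub>R X p + b *\<^sub>R Y p))
     \<le> 2 * (a\<^sup>2 * (X p \<bullet> (?G *v X p)) + b\<^sup>2 * (Y p \<bullet> (?G *v Y p)))"
    unfolding matrix_vector_mult_diff_distrib matrix_vector_right_distrib matrix_vector_mult_scaleR
    by (simp add: inner_add_left inner_add_right inner_diff_left inner_diff_right power2_eq_square algebra_simps)
  then show ?thesis unfolding vec_norm_def
    by (rule sqrt_form_bound) (rule metric_form_nonneg[OF p])+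
qed

lemma endo_norm_lincomb:
  assumes p: "p \<in> ball3"
  shows "endo_norm (anderson_metric 2) (\<lambda>p. a *\<^sub>R S p + b *\<^sub>R T p) p
    \<le> (2 * \<bar>a\<bar> + 2 * \<bar>b\<bar>) * (endo_norm (anderson_metric 2) S p + endo_norm (anderson_metric 2) T p)"
proof -
  let ?G = "anderson_metric 2 p"
  have e: "endo_norm (anderson_metric 2) V p = sqrt (endo_form p (V p))" for V
    by (simp add: endo_norm_def endo_form_def)
  have "endo_form p (a *\<^sub>R S p + b *\<^sub>R T p) + endo_form p (a *\<^sub>R S p - b *\<^sub>R T p)
     = 2 * (a\<^sup>2 * endo_form p (S p) + b\<^sup>2 * endo_form p (T p))"
    unfolding endo_form_def sum.distrib[symmetric] sum_distrib_left
    by (intro sum.cong refl)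
       (simp add: matrix_vector_mult_diff_distrib matrix_vector_right_distrib matrix_vector_mult_scaleR
         inner_add_left inner_add_right inner_diff_left inner_diff_right power2_eq_square algebra_simps)
  then have "endo_form p (a *\<^sub>R S p + b *\<^sub>R T p) \<le> 2 * (a\<^sup>2 * endo_form p (S p) + b\<^sup>2 * endo_form p (T p))"
    using endo_form_nonneg[OF p, of "a *\<^sub>R S p - b *\<^sub>R T p"] by linarith
  then show ?thesis unfolding e by (rule sqrt_form_bound) (rule endo_form_nonneg[OF p])+
qed

lemma measurable_vec_nth_comp:
  fixes f :: "'a \<Rightarrow> ('b::real_normed_vector)^'n"
  assumes "f \<in> borel_measurable M" shows "(\<lambda>x. f x $ i) \<in> borel_measurable M"
  by (rule measurable_compose[OF assms borel_measurable_continuous_onI])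
     (intro linear_continuous_on bounded_linear_vec_nth)

lemma smooth_measurable: "smooth_on ball3 f \<Longrightarrow> f \<in> borel_measurable (lebesgue_on ball3)"
  by (rule continuous_imp_measurable_on_sets_lebesgue[OF smooth_on_imp_continuous ball3_sets(1)])

lemma vec_norm_measurable:
  assumes "X \<in> borel_measurable (lebesgue_on ball3)"
  shows "vec_norm (anderson_metric 2) X \<in> borel_measurable (lebesgue_on ball3)"
proof -
  note [measurable] = measurable_vec_nth_comp[OF assms] smooth_measurable[OF smooth_metric]
  show ?thesis unfolding vec_norm_def[abs_def] inner_vec_def matrix_vector_mult_def vec_lambda_beta inner_real_def
    by measurable
qed

lemma endo_norm_measurable:
  assumes "T \<in> borel_measurable (lebesgue_on ball3)"
  shows "endo_norm (anderson_metric 2) T \<in> borel_measurable (lebesgue_on ball3)"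
proof -
  note [measurable] = measurable_vec_nth_comp[OF measurable_vec_nth_comp[OF assms]]
    smooth_measurable[OF smooth_metric] smooth_measurable[OF smooth_metric_inv]
  show ?thesis unfolding endo_norm_def[abs_def] inner_vec_def matrix_vector_mult_def vec_lambda_beta inner_real_def
    by measurable
qed

lemma vol_measure_basic:
  "space (vol_measure G U) = U" "f \<in> borel_measurable (vol_measure G U) \<longleftrightarrow> f \<in> borel_measurable (lebesgue_on U)"
  by (simp_all add: vol_measure_def)

lemma Lp_vec_lincomb:
  assumes "Lp_vec (anderson_metric 2) ball3 q X" "Lp_vec (anderson_metric 2) ball3 q Y" "q > 0"
  shows "Lp_vec (anderson_metric 2) ball3 q (\<lambda>p. a *\<^sub>R X p + b *\<^sub>R Y p)"
proof -
  let ?G = "anderson_metric 2"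
  note X = assms(1)[unfolded Lp_vec_def] and Y = assms(2)[unfolded Lp_vec_def]
  have m: "(\<lambda>p. a *\<^sub>R X p + b *\<^sub>R Y p) \<in> borel_measurable (lebesgue_on ball3)" using conjunct1[OF X] conjunct1[OF Y] by measurable
  have "integrable (vol_measure ?G ball3) (\<lambda>p. vec_norm ?G (\<lambda>p. a *\<^sub>R X p + b *\<^sub>R Y p) p powr q)"
    by (rule integrable_powr_of_le[OF conjunct2[OF X] conjunct2[OF Y] assms(3), where c = "2 * \<bar>a\<bar> + 2 * \<bar>b\<bar>"])
       (auto simp: vol_measure_basic vec_norm_measurable[OF m] vec_norm_lincomb, auto simp: vec_norm_def metric_form_nonneg)
  then show ?thesis using m by (simp add: Lp_vec_def)
qed

lemma Lp_endo_lincomb: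
  assumes "Lp_endo (anderson_metric 2) ball3 q X" "Lp_endo (anderson_metric 2) ball3 q Y" "q > 0"
  shows "Lp_endo (anderson_metric 2) ball3 q (\<lambda>p. a *\<^sub>R X p + b *\<^sub>R Y p)"
proof -
  let ?G = "anderson_metric 2"
  note X = assms(1)[unfolded Lp_endo_def] and Y = assms(2)[unfolded Lp_endo_def]
  have m: "(\<lambda>p. a *\<^sub>R X p + b *\<^sub>R Y p) \<in> borel_measurable (lebesgue_on ball3)" using conjunct1[OF X] conjunct1[OF Y] by measurable
  have nn: "0 \<le> endo_norm ?G V p" if "p \<in> ball3" for V p
    using endo_form_nonneg[OF that, of "V p"] by (simp add: endo_norm_def endo_form_def)
  have "integrable (vol_measure ?G ball3) (\<lambda>p. endo_norm ?G (\<lambda>p. a *\<^sub>R X p + b *\<^sub>R Y p) p powr q)"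
    by (rule integrable_powr_of_le[OF conjunct2[OF X] conjunct2[OF Y] assms(3), where c = "2 * \<bar>a\<bar> + 2 * \<bar>b\<bar>"])
       (auto simp: vol_measure_basic endo_norm_measurable[OF m] endo_norm_lincomb nn)
  then show ?thesis using m by (simp add: Lp_endo_def)
qed

lemma locally_integrable_mult:
  fixes F :: "real^'n::finite \<Rightarrow> 'b::euclidean_space"
  assumes F: "locally_integrable_on U F" and U: "open U" and g: "continuous_on U g"
    and K: "compact K" "K \<subseteq> U" "\<And>p. p \<in> U \<Longrightarrow> p \<notin> K \<Longrightarrow> g p = 0"
    and l: "bounded_linear l"
  shows "integrable (lebesgue_on U) (\<lambda>p. l (F p) * (g p :: real))"
proof -
  have Km: "K \<in> sets lebesgue" using fmeasurableD[OF lmeasurable_compact[OF K(1)]] .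
  have "integrable (lebesgue_on K) F" using F K by (simp add: locally_integrable_on_def)
  then have i: "integrable (lebesgue_on K) (\<lambda>p. l (F p))" by (rule integrable_bounded_linear[OF l])
  have gK: "continuous_on K g" using g K(2) continuous_on_subset by blast
  have "compact (g ` K)" using K(1) gK by (intro compact_continuous_image)
  then obtain B where B: "\<forall>y\<in>g ` K. norm y \<le> B" using compact_imp_bounded bounded_iff by metis
  have "integrable (lebesgue_on K) (\<lambda>p. l (F p) * g p)"
  proof (rule Bochner_Integration.integrable_bound[OF integrable_mult_right[OF i, of B]])
    show "(\<lambda>p. l (F p) * g p) \<in> borel_measurable (lebesgue_on K)"
      using borel_measurable_integrable[OF i] continuous_imp_measurable_on_sets_lebesgue[OF gK Km] by measurable
    have "norm (l (F p) * g p) \<le> norm (B * l (F p))" if "p \<in> K" for p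
    proof -
      have "\<bar>g p\<bar> \<le> \<bar>B\<bar>" using B that by fastforce
      then have "\<bar>l (F p)\<bar> * \<bar>g p\<bar> \<le> \<bar>l (F p)\<bar> * \<bar>B\<bar>" by (intro mult_left_mono) auto
      then show ?thesis by (simp add: abs_mult mult.commute)
    qed
    then show "AE p in lebesgue_on K. norm (l (F p) * g p) \<le> norm (B * l (F p))"
      by (intro AE_I2) simp
  qed
  then have "integrable lebesgue (\<lambda>p. indicator K p *\<^sub>R (l (F p) * g p))"
    using Km by (subst (asm) integrable_restrict_space) auto
  moreover have "(\<lambda>p. indicator K p *\<^sub>R (l (F p) * g p)) = (\<lambda>p. indicator U p *\<^sub>R (l (F p) * g p))"
    using K(2,3) by (fastforce simp: indicator_def fun_eq_iff)
  ultimately show ?thesis using U by (subst integrable_restrict_space) auto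
qed

lemma locally_integrable_lincomb:
  "locally_integrable_on U F \<Longrightarrow> locally_integrable_on U H \<Longrightarrow>
    locally_integrable_on U (\<lambda>p. a *\<^sub>R F p + b *\<^sub>R H p)"
  unfolding locally_integrable_on_def by auto

lemma has_weak_cov_deriv_lincomb:
  fixes G :: "'n::finite metric_field"
  assumes U: "open U" and \<Gamma>: "\<And>k i j. continuous_on U (christoffel G k i j)"
    and X: "has_weak_cov_deriv G U X S" and Y: "has_weak_cov_deriv G U Y T"
  shows "has_weak_cov_deriv G U (\<lambda>p. a *\<^sub>R X p + b *\<^sub>R Y p) (\<lambda>p. a *\<^sub>R S p + b *\<^sub>R T p)"
proof -
  note X' = X[unfolded has_weak_cov_deriv_def] and Y' = Y[unfolded has_weak_cov_deriv_def]
  have "(\<integral>p. (a *\<^sub>R X p + b *\<^sub>R Y p) $ k * partial i \<phi> p \<partial>(lebesgue_on U)) =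
        - (\<integral>p. ((a *\<^sub>R S p + b *\<^sub>R T p) $ i $ k - (\<Sum>j\<in>UNIV. christoffel G k i j p * (a *\<^sub>R X p + b *\<^sub>R Y p) $ j)) * \<phi> p
            \<partial>(lebesgue_on U))" if \<phi>: "test_function_on U \<phi>" for \<phi> i k
  proof -
    define K where "K = closure {p. \<phi> p \<noteq> 0}"
    note t = test_function_facts[OF \<phi>, folded K_def]
    have i1: "integrable (lebesgue_on U) (\<lambda>p. Z p $ k * partial i \<phi> p)" if "locally_integrable_on U Z" for Z :: "_ \<Rightarrow> real^'n"
      by (rule locally_integrable_mult[OF that U t(7) t(1,2) t(4) bounded_linear_vec_nth])
    have i2: "integrable (lebesgue_on U) (\<lambda>p. Z p $ j * (christoffel G k i j p * \<phi> p))" if "locally_integrable_on U Z" for Z :: "_ \<Rightarrow> real^'n" and j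
      by (rule locally_integrable_mult[OF that U _ t(1,2) _ bounded_linear_vec_nth])
         (use t(3) in \<open>auto intro!: continuous_intros \<Gamma> t(6)\<close>)
    have i3: "integrable (lebesgue_on U) (\<lambda>p. V p $ i $ k * \<phi> p)" if "locally_integrable_on U V" for V :: "_ \<Rightarrow> real^'n^'n"
      by (rule locally_integrable_mult[OF that U t(6) t(1,2) t(3)
            bounded_linear_compose[OF bounded_linear_vec_nth bounded_linear_vec_nth]])
    have i4: "integrable (lebesgue_on U) (\<lambda>p. (V p $ i $ k - (\<Sum>j\<in>UNIV. christoffel G k i j p * Z p $ j)) * \<phi> p)"
      if "locally_integrable_on U V" "locally_integrable_on U Z" for V Z
    proof -
      have "integrable (lebesgue_on U) (\<lambda>p. V p $ i $ k * \<phi> p - (\<Sum>j\<in>UNIV. Z p $ j * (christoffel G k i j p * \<phi> p)))"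
        by (intro Bochner_Integration.integrable_diff Bochner_Integration.integrable_sum i2 i3 that)
      then show ?thesis unfolding left_diff_distrib sum_distrib_right by (simp add: mult_ac)
    qed
    have "(\<integral>p. (a *\<^sub>R X p + b *\<^sub>R Y p) $ k * partial i \<phi> p \<partial>(lebesgue_on U))
      = (\<integral>p. a * (X p $ k * partial i \<phi> p) + b * (Y p $ k * partial i \<phi> p) \<partial>(lebesgue_on U))"
      by (simp add: algebra_simps)
    also have "\<dots> = a * (\<integral>p. X p $ k * partial i \<phi> p \<partial>(lebesgue_on U)) + b * (\<integral>p. Y p $ k * partial i \<phi> p \<partial>(lebesgue_on U))"
      using X' Y' by (subst Bochner_Integration.integral_add) (auto intro!: i1)
    also have "\<dots> = - (a * (\<integral>p. (S p $ i $ k - (\<Sum>j\<in>UNIV. christoffel G k i j p * X p $ j)) * \<phi> p \<partial>(lebesgue_on U))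
       + b * (\<integral>p. (T p $ i $ k - (\<Sum>j\<in>UNIV. christoffel G k i j p * Y p $ j)) * \<phi> p \<partial>(lebesgue_on U)))"
      using X' Y' \<phi> by simp
    also have "\<dots> = - (\<integral>p. a * ((S p $ i $ k - (\<Sum>j\<in>UNIV. christoffel G k i j p * X p $ j)) * \<phi> p)
       + b * ((T p $ i $ k - (\<Sum>j\<in>UNIV. christoffel G k i j p * Y p $ j)) * \<phi> p) \<partial>(lebesgue_on U))"
      using X' Y' by (subst Bochner_Integration.integral_add) (auto intro!: i4)
    also have "(\<lambda>p. a * ((S p $ i $ k - (\<Sum>j\<in>UNIV. christoffel G k i j p * X p $ j)) * \<phi> p)
       + b * ((T p $ i $ k - (\<Sum>j\<in>UNIV. christoffel G k i j p * Y p $ j)) * \<phi> p))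
      = (\<lambda>p. ((a *\<^sub>R S p + b *\<^sub>R T p) $ i $ k - (\<Sum>j\<in>UNIV. christoffel G k i j p * (a *\<^sub>R X p + b *\<^sub>R Y p) $ j)) * \<phi> p)"
      by (simp add: fun_eq_iff sum.distrib sum_distrib_left sum_distrib_right algebra_simps)
    finally show ?thesis .
  qed
  then show ?thesis using X' Y' unfolding has_weak_cov_deriv_def by (blast intro: locally_integrable_lincomb)
qed

lemma sobolev_lincomb:
  assumes "X \<in> sobolev_W1 (anderson_metric 2) ball3 q" "Y \<in> sobolev_W1 (anderson_metric 2) ball3 q" "q > 0"
  shows "(\<lambda>p. a *\<^sub>R X p + b *\<^sub>R Y p) \<in> sobolev_W1 (anderson_metric 2) ball3 q"
  using assms Lp_vec_lincomb[of q X Y a b] Lp_endo_lincomb[of q _ _ a b]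
    has_weak_cov_deriv_lincomb[OF open_ball3 christoffel_continuous, of X _ Y _ a b]
  unfolding sobolev_W1_def by blast

lemma subspace_of_lincomb_closed:
  assumes "X0 \<in> V" "\<And>X Y a b. X \<in> V \<Longrightarrow> Y \<in> V \<Longrightarrow> (\<lambda>p. a *\<^sub>R X p + b *\<^sub>R Y p) \<in> V"
  shows "vf.subspace V"
proof (rule vf.subspaceI)
  show "0 \<in> V" using assms(2)[OF assms(1) assms(1), of 0 0] by (simp add: zero_fun_def)
  show "X + Y \<in> V" if "X \<in> V" "Y \<in> V" for X Y using assms(2)[OF that, of 1 1] by (simp add: plus_fun_def)
  show "(\<lambda>p. c *\<^sub>R X p) \<in> V" if "X \<in> V" for c X using assms(2)[OF that that, of c 0] by simp
qed

section \<open>The fields lie in the Sobolev spaces\<close>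

lemma integrable_vol_power:
  assumes N: "N \<in> borel_measurable (lebesgue_on ball3)" and n: "n \<ge> 2"
    and R: "rapid R" "\<And>p. p \<in> ball3 \<Longrightarrow> 0 \<le> R p" "\<And>p. p \<in> ball3 \<Longrightarrow> N p = bdry p * R p"
  shows "integrable (vol_measure (anderson_metric 2) ball3) (\<lambda>p. N p powr real n)"
proof -
  let ?v = "vol_density (anderson_metric 2)"
  obtain C where C: "\<And>p. p \<in> ball3 \<Longrightarrow> ?v p * (bdry p * R p) ^ n \<le> C / sqrt (bdry p)"
    using density_power_bound[OF R(1,2) n] by blast
  have vm: "?v \<in> borel_measurable (lebesgue_on ball3)" by (rule smooth_measurable[OF smooth_vol_density])
  have v0: "0 \<le> ?v p" if "p \<in> ball3" for p using ball3_facts[OF that] by (simp add: vol_density_metric[OF that])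
  have Nm: "(\<lambda>p. N p powr real n) \<in> borel_measurable (lebesgue_on ball3)" using N by measurable
  have "integrable (lebesgue_on ball3) (\<lambda>p. ?v p * N p powr real n)"
  proof (rule Bochner_Integration.integrable_bound[OF integrable_mult_right[OF integrable_bdry_weight, of C]])
    show "(\<lambda>p. ?v p * N p powr real n) \<in> borel_measurable (lebesgue_on ball3)" using vm Nm by measurable
    have "norm (?v p * N p powr real n) \<le> norm (C * (1 / sqrt (bdry p)))" if p: "p \<in> ball3" for p
    proof -
      have "0 \<le> N p" using R(2,3)[OF p] ball3_facts(1)[OF p] by simp
      then have "N p powr real n = (bdry p * R p) ^ n" using n R(3)[OF p] by (simp add: powr_realpow')
      then have "norm (?v p * N p powr real n) = ?v p * (bdry p * R p) ^ n"
        using v0[OF p] \<open>0 \<le> N p\<close> R(3)[OF p] by simp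
      also have "\<dots> \<le> C / sqrt (bdry p)" by (rule C[OF p])
      also have "\<dots> \<le> norm (C * (1 / sqrt (bdry p)))"
        by (simp only: real_norm_def times_divide_eq_right mult_1_right abs_ge_self)
      finally show ?thesis .
    qed
    then show "AE p in lebesgue_on ball3. norm (?v p * N p powr real n) \<le> norm (C * (1 / sqrt (bdry p)))"
      by (intro AE_I2) simp
  qed
  then show ?thesis unfolding vol_measure_def
    using vm Nm v0 by (subst integrable_density) auto
qed

lemma harm_field_sobolev:
  assumes c: "c > 0" and n: "n \<ge> 2"
  shows "harm_field c \<in> sobolev_W1 (anderson_metric 2) ball3 (real n)"
proof -
  let ?G = "anderson_metric 2"
  have s: "smooth_on ball3 (\<lambda>p. harm_field c p $ k)" for k
    using harm_field_harmonic[OF c] by (simp add: harmonic_vec_fields_def)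
  note w = has_weak_cov_deriv_cov_deriv[OF open_ball3 s christoffel_continuous]
  have mX: "harm_field c \<in> borel_measurable (lebesgue_on ball3)"
    by (rule continuous_imp_measurable_on_sets_lebesgue[OF w(2) ball3_sets(1)])
  have mT: "cov_deriv ?G (harm_field c) \<in> borel_measurable (lebesgue_on ball3)"
    by (rule continuous_imp_measurable_on_sets_lebesgue[OF w(3) ball3_sets(1)])
  have "Lp_vec ?G ball3 (real n) (harm_field c)"
    unfolding Lp_vec_def using mX
    by (auto intro: integrable_vol_power[OF vec_norm_measurable[OF mX] n rapid_field_norms(1)[OF c] _ vec_norm_harm_field])
  moreover have "Lp_endo ?G ball3 (real n) (cov_deriv ?G (harm_field c))"
    unfolding Lp_endo_def
  proof (intro conjI mT integrable_vol_power[OF endo_norm_measurable[OF mT] n rapid_field_norms(2)[OF c] _ endo_norm_harm_field[OF c]])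
    fix p assume "p \<in> ball3"
    then show "0 \<le> sqrt ((\<Sum>i\<in>UNIV. \<Sum>k\<in>UNIV. (bdry p * cov_hess c p $ i $ k)\<^sup>2)
        + (4 * bdry p * axis_sq p / hsum p + 4 * (axis_sq p)\<^sup>2 / (hsum p)\<^sup>2) * (ang_hess c p)\<^sup>2)"
      using ball3_facts[of p] by (auto intro!: add_nonneg_nonneg sum_nonneg mult_nonneg_nonneg divide_nonneg_nonneg)
  qed
  ultimately show ?thesis using w(1) by (auto simp: sobolev_W1_def)
qed

section \<open>Linear independence\<close>

text \<open>In the variable \<open>q = exp (- t\<^sup>2)\<close> the combination is a polynomial that vanishes on \<open>(0, 1)\<close>.\<close>

lemma gauss_combination_eq_0:
  fixes a :: "nat \<Rightarrow> real"
  assumes J: "finite J" and z: "\<And>t. t > 0 \<Longrightarrow> (\<Sum>j\<in>J. a j * real (Suc j) * exp (- real (Suc j) * t\<^sup>2)) = 0" and j: "j \<in> J"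
  shows "a j = 0"
proof (rule ccontr)
  assume aj: "a j \<noteq> 0"
  \<comment> \<open>The coefficients of the polynomial in \<open>q\<close>.\<close>
  define b where "b i = (if i \<in> Suc ` J then a (i - 1) * real i else 0)" for i
  define n where "n = Suc (Max J)"
  have Jn: "Suc ` J \<subseteq> {..n}" using J by (auto simp: n_def)
  have "b (Suc j) \<noteq> 0" "Suc j \<le> n" using aj j Jn by (auto simp: b_def)
  then have fin: "finite {q. (\<Sum>i\<le>n. b i * q ^ i) = 0}" using polyfun_rootbound by blast
  have "{0<..<1} \<subseteq> {q. (\<Sum>i\<le>n. b i * q ^ i) = 0}"
  proof
    fix q :: real assume q: "q \<in> {0<..<1}"
    define t where "t = sqrt (- ln q)"
    have t: "t > 0" "t\<^sup>2 = - ln q" using q by (auto simp: t_def)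
    have e: "exp (- real m * t\<^sup>2) = q ^ m" for m
      using q by (simp add: t(2) exp_of_nat_mult)
    have "(\<Sum>i\<le>n. b i * q ^ i) = (\<Sum>i\<in>Suc ` J. b i * q ^ i)"
      by (rule sum.mono_neutral_right) (use Jn in \<open>auto simp: b_def\<close>)
    also have "\<dots> = (\<Sum>j\<in>J. b (Suc j) * q ^ Suc j)" by (simp add: sum.reindex)
    also have "\<dots> = (\<Sum>j\<in>J. a j * real (Suc j) * exp (- real (Suc j) * t\<^sup>2))"
      unfolding e by (intro sum.cong) (auto simp: b_def)
    finally show "q \<in> {q. (\<Sum>i\<le>n. b i * q ^ i) = 0}" using z[OF t(1)] by simp
  qed
  then have "finite {0::real<..<1}" using fin by (rule finite_subset)
  then show False by (simp add: infinite_Ioo)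
qed

lemma harm_field_combination_eq_0:
  assumes J: "finite J" and z: "(\<Sum>j\<in>J. (\<lambda>p. a j *\<^sub>R harm_field (real (Suc j)) p)) = 0" and j: "j \<in> J"
  shows "a j = 0"
proof (rule gauss_combination_eq_0[OF J _ j])
  fix t :: real assume t: "t > 0"
  define k where "k = - 2 * t * (1 - (tanh t)\<^sup>2)"
  have "(tanh t)\<^sup>2 < 1" using tanh_real_gt_neg1[of t] tanh_real_lt_1[of t] by (simp add: abs_square_less_1)
  then have k: "k \<noteq> 0" using t by (simp add: k_def)
  have "(\<Sum>j\<in>J. (\<lambda>p. a j *\<^sub>R harm_field (real (Suc j)) p)) p = (\<Sum>j\<in>J. a j *\<^sub>R harm_field (real (Suc j)) p)" for p
    using J by (induction J rule: finite_induct) auto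
  then have "(\<Sum>j\<in>J. a j *\<^sub>R harm_field (real (Suc j)) (vector [0, 0, tanh t])) = 0"
    using z by (metis zero_fun_apply)
  then have "(\<Sum>j\<in>J. a j *\<^sub>R harm_field (real (Suc j)) (vector [0, 0, tanh t])) $ 3 = 0" by simp
  then have "(\<Sum>j\<in>J. a j * harm_field (real (Suc j)) (vector [0, 0, tanh t]) $ 3) = 0" by simp
  also have "(\<Sum>j\<in>J. a j * harm_field (real (Suc j)) (vector [0, 0, tanh t]) $ 3)
      = (\<Sum>j\<in>J. (a j * real (Suc j) * exp (- real (Suc j) * t\<^sup>2)) * k)"
    by (intro sum.cong refl) (subst harm_field_axis; simp add: k_def del: of_nat_Suc)
  finally show "(\<Sum>j\<in>J. a j * real (Suc j) * exp (- real (Suc j) * t\<^sup>2)) = 0"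
    using k by (simp add: sum_distrib_right[symmetric] del: of_nat_Suc)
qed

lemma independent_harm_fields:
  "inj (\<lambda>j. harm_field (real (Suc j)))" "\<not> vf.dependent (range (\<lambda>j. harm_field (real (Suc j))))"
proof -
  let ?X = "\<lambda>j. harm_field (real (Suc j))"
  show inj: "inj ?X"
  proof (rule injI, rule ccontr)
    fix i j assume e: "?X i = ?X j" and ij: "i \<noteq> j"
    have "(\<Sum>l\<in>{i, j}. (\<lambda>p. (if l = i then 1 else - 1) *\<^sub>R ?X l p)) = 0"
      using ij e by (auto simp: fun_eq_iff simp del: of_nat_Suc)
    from harm_field_combination_eq_0[OF _ this, of i] show False by simp
  qed
  show "\<not> vf.dependent (range ?X)"
    unfolding vf.independent_explicit_finite_subsets
  proof (intro allI impI ballI)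
    fix S and u :: "(real^3 \<Rightarrow> real^3) \<Rightarrow> real" and v
    assume S: "S \<subseteq> range ?X" and fin: "finite S" and z: "(\<Sum>v\<in>S. (\<lambda>p. u v *\<^sub>R v p)) = 0" and v: "v \<in> S"
    define J where "J = ?X -` S"
    have SJ: "S = ?X ` J" using S by (auto simp: J_def)
    have fJ: "finite J" unfolding J_def using fin inj by (rule finite_vimageI)
    have "(\<Sum>j\<in>J. (\<lambda>p. u (?X j) *\<^sub>R ?X j p)) = 0"
      using z unfolding SJ by (subst (asm) sum.reindex) (use inj in \<open>auto simp: inj_on_def simp del: of_nat_Suc\<close>)
    from harm_field_combination_eq_0[OF fJ this] show "u v = 0" using v SJ by auto
  qed
qed

section \<open>Infinite dimension\<close>

theorem theorem1p2:
  shows "vf.subspace (harmonic_vec_fields (anderson_metric 2) ball3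
           \<inter> sobolev_W1 (anderson_metric 2) ball3 2
           \<inter> sobolev_W1 (anderson_metric 2) ball3 4)
       \<and> infinite_dimensional (harmonic_vec_fields (anderson_metric 2) ball3
           \<inter> sobolev_W1 (anderson_metric 2) ball3 2
           \<inter> sobolev_W1 (anderson_metric 2) ball3 4)" (is "vf.subspace ?V \<and> _")
proof
  have mem: "harm_field c \<in> ?V" if "c > 0" for c
    using harm_field_harmonic[OF that] harm_field_sobolev[OF that, of 2] harm_field_sobolev[OF that, of 4] by simp
  show "vf.subspace ?V"
    by (rule subspace_of_lincomb_closed[OF mem[of 1]]) (auto intro: harmonic_lincomb sobolev_lincomb)
  show "infinite_dimensional ?V"
    unfolding infinite_dimensional_def
  proof
    assume "\<exists>B. finite B \<and> B \<subseteq> ?V \<and> ?V \<subseteq> vf.span B"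
    then obtain B where B: "finite B" "?V \<subseteq> vf.span B" by blast
    let ?X = "\<lambda>j. harm_field (real (Suc j))"
    have "range ?X \<subseteq> vf.span B" using mem B(2) by (auto simp del: of_nat_Suc)
    from vf.independent_span_bound[OF B(1) independent_harm_fields(2) this] have "finite (range ?X)" by blast
    then show False using independent_harm_fields(1) finite_imageD by blast
  qed
qed

end
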